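(* Let $G$ be a finitely generated group given by the presentation \[\langle x_1, \ldots, x_d\ :\ u_1^{m_1}, \ldots,u_r^{m_r}\rangle\] with finitely many generators $x_1,\dots,x_d$ and finitely many relators, where each $u_i$ is an element of the free group on $\{x_1,\dots,x_d\}$ and each $m_i$ is a positive integer, such that the image of $u_i$ in $G$ has order exactly $m_i$ for every $i=1,\dots,r$. \begin{enumerate} \item If $G$ is finite, then $1-d+\sum_{i=1}^r \frac{1}{m_i} > 0$ and \[|G|\geq \frac{1}{1-d+\sum_{i=1}^r \frac{1}{m_i}}.\] \item If the first $\ell^2$ Betti number $\beta^2_1(G)$ of $G$ is zero, then \[1-d+\sum_{i=1}^r \frac{1}{m_i} \geq 0.\] \end{enumerate}
   Context: For a finitely presented group $G$, the first $\ell^2$ Betti number $\beta^2_1(G)$ is the von Neumann dimension, over the group von Neumann algebra $\mathcal{N}(G)$ of $G$, of the first $\ell^2$ homology group of $Y$ with coefficients in $\mathcal{N}(G)$, where $Y$ is the universal cover of the presentation 2-complex of $G$ (for a finite presentation), with its $G$-action. This agrees with Lück's definition $\beta^2_1(G)=\dim_{\mathcal{N}(G)} H_1(G;\mathcal{N}(G))$, valid for any countable discrete group, where $\dim_{\mathcal{N}(G)}$ is the (extended) von Neumann dimension. The case $m_i=1$ is allowed. *)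

theory Defs
  imports "HOL-Algebra.Algebra" "HOL-Analysis.Analysis"
begin

section \<open>Free groups and presentations\<close>

text \<open>
  The letter \<open>(i, True)\<close> stands for the generator with index \<open>i\<close>, and \<open>(i, False)\<close> for its inverse.
\<close>

type_synonym word = "(nat \<times> bool) list"

definition reduced_word :: "word \<Rightarrow> bool" where
  "reduced_word w \<longleftrightarrow> successively (\<lambda>a b. \<not> (fst a = fst b \<and> snd a \<noteq> snd b)) w"

fun cancel_cons :: "nat \<times> bool \<Rightarrow> word \<Rightarrow> word" where
  "cancel_cons a [] = [a]"
| "cancel_cons a (b # w) = (if fst a = fst b \<and> snd a \<noteq> snd b then w else a # b # w)"

definition free_group :: "nat \<Rightarrow> word monoid" where
  "free_group d =
    \<lparr>carrier = {w. reduced_word w \<and> fst ` set w \<subseteq> {..<d}},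
     monoid.mult = (\<lambda>v w. foldr cancel_cons v w),
     one = []\<rparr>"

definition letter_eval :: "('g, 'a) monoid_scheme \<Rightarrow> (nat \<Rightarrow> 'g) \<Rightarrow> nat \<times> bool \<Rightarrow> 'g" where
  "letter_eval G x a = (if snd a then x (fst a) else inv\<^bsub>G\<^esub> (x (fst a)))"

definition word_eval :: "('g, 'a) monoid_scheme \<Rightarrow> (nat \<Rightarrow> 'g) \<Rightarrow> word \<Rightarrow> 'g" where
  "word_eval G x w = foldr (\<lambda>a g. letter_eval G x a \<otimes>\<^bsub>G\<^esub> g) w \<one>\<^bsub>G\<^esub>"

definition normal_closure :: "('g, 'a) monoid_scheme \<Rightarrow> 'g set \<Rightarrow> 'g set" where
  "normal_closure F S =
    generate F (\<Union>g\<in>carrier F. (\<lambda>s. g \<otimes>\<^bsub>F\<^esub> s \<otimes>\<^bsub>F\<^esub> inv\<^bsub>F\<^esub> g) ` S)"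

text \<open>
  \<open>G\<close> is presented by the generators \<open>x 0, \<dots>, x (d - 1)\<close> and the relators \<open>R 0, \<dots>, R (r - 1)\<close>:
  the canonical homomorphism from the free group onto \<open>G\<close> induces an isomorphism from the
  quotient by the normal closure of the relators.
\<close>

definition presented_by ::
  "('g, 'a) monoid_scheme \<Rightarrow> nat \<Rightarrow> (nat \<Rightarrow> 'g) \<Rightarrow> nat \<Rightarrow> (nat \<Rightarrow> word) \<Rightarrow> bool" where
  "presented_by G d x r R \<longleftrightarrow>
    group G \<and> x \<in> {..<d} \<rightarrow> carrier G \<and> R \<in> {..<r} \<rightarrow> carrier (free_group d) \<and>
    word_eval G x ` carrier (free_group d) = carrier G \<and>
    kernel (free_group d) G (word_eval G x) = normal_closure (free_group d) (R ` {..<r})"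


section \<open>The group von Neumann algebra\<close>

text \<open>Elements of \<open>\<ell>\<^sup>2(G)\<close> are functions on the whole type that vanish outside the carrier.\<close>

definition ell2 :: "('g, 'a) monoid_scheme \<Rightarrow> ('g \<Rightarrow> complex) set" where
  "ell2 G = {f. (\<forall>h. h \<notin> carrier G \<longrightarrow> f h = 0) \<and> (\<lambda>h. (cmod (f h))\<^sup>2) summable_on carrier G}"

definition ell2_inner ::
  "('g, 'a) monoid_scheme \<Rightarrow> ('g \<Rightarrow> complex) \<Rightarrow> ('g \<Rightarrow> complex) \<Rightarrow> complex" where
  "ell2_inner G f k = (\<Sum>\<^sub>\<infinity>h\<in>carrier G. f h * cnj (k h))"

definition ell2_norm :: "('g, 'a) monoid_scheme \<Rightarrow> ('g \<Rightarrow> complex) \<Rightarrow> real" where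
  "ell2_norm G f = sqrt (\<Sum>\<^sub>\<infinity>h\<in>carrier G. (cmod (f h))\<^sup>2)"

definition left_translation ::
  "('g, 'a) monoid_scheme \<Rightarrow> 'g \<Rightarrow> ('g \<Rightarrow> complex) \<Rightarrow> ('g \<Rightarrow> complex)" where
  "left_translation G g f = (\<lambda>h. if h \<in> carrier G then f (inv\<^bsub>G\<^esub> g \<otimes>\<^bsub>G\<^esub> h) else 0)"

type_synonym 'g operator = "('g \<Rightarrow> complex) \<Rightarrow> ('g \<Rightarrow> complex)"

text \<open>
  The von Neumann algebra of bounded operators on \<open>\<ell>\<^sup>2(G)\<close> that commute with the left
  translations.  Operators are extensional on \<open>\<ell>\<^sup>2(G)\<close>, and the product is composition.
\<close>

definition vn_operators :: "('g, 'a) monoid_scheme \<Rightarrow> 'g operator set" where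
  "vn_operators G = {T \<in> ell2 G \<rightarrow>\<^sub>E ell2 G.
     (\<forall>f\<in>ell2 G. \<forall>k\<in>ell2 G. \<forall>a b.
        T (\<lambda>h. a * f h + b * k h) = (\<lambda>h. a * T f h + b * T k h)) \<and>
     (\<exists>C. \<forall>f\<in>ell2 G. ell2_norm G (T f) \<le> C * ell2_norm G f) \<and>
     (\<forall>g\<in>carrier G. \<forall>f\<in>ell2 G. T (left_translation G g f) = left_translation G g (T f))}"

definition vn_algebra :: "('g, 'a) monoid_scheme \<Rightarrow> 'g operator ring" where
  "vn_algebra G =
    \<lparr>carrier = vn_operators G,
     monoid.mult = compose (ell2 G),
     one = (\<lambda>f\<in>ell2 G. f),
     ring.zero = (\<lambda>f\<in>ell2 G. (\<lambda>h. 0)),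
     add = (\<lambda>T S. \<lambda>f\<in>ell2 G. (\<lambda>h. T f h + S f h))\<rparr>"

definition unit_vector :: "('g, 'a) monoid_scheme \<Rightarrow> ('g \<Rightarrow> complex)" where
  "unit_vector G = (\<lambda>h. if h = \<one>\<^bsub>G\<^esub> then 1 else 0)"

definition vn_trace :: "('g, 'a) monoid_scheme \<Rightarrow> 'g operator \<Rightarrow> complex" where
  "vn_trace G T = ell2_inner G (T (unit_vector G)) (unit_vector G)"

text \<open>
  The embedding of the integral group ring: a finitely supported \<open>a\<close> acts by the sum of the
  operators \<open>a g \<cdot> (f \<mapsto> (\<lambda>h. f (h g)))\<close>.  Right translation by \<open>g\<close> is taken in the form
  \<open>h \<mapsto> h g\<close>, so that this is a ring homomorphism for composition.
\<close>

definition group_ring_operator :: "('g, 'a) monoid_scheme \<Rightarrow> ('g \<Rightarrow> int) \<Rightarrow> 'g operator" where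
  "group_ring_operator G a = (\<lambda>f\<in>ell2 G. (\<lambda>h. if h \<in> carrier G
     then (\<Sum>g | g \<in> carrier G \<and> a g \<noteq> 0. of_int (a g) * f (h \<otimes>\<^bsub>G\<^esub> g)) else 0))"


section \<open>Modules over a not necessarily commutative ring\<close>

text \<open>
  The locale of modules in the library assumes a commutative ring.  Only its record type and the
  locale of submodules, which makes no such assumption, are used here.  The multiplicative
  fields of a module record are irrelevant.
\<close>

definition free_module :: "('r, 'a) ring_scheme \<Rightarrow> nat \<Rightarrow> ('r, nat \<Rightarrow> 'r) module" where
  "free_module A n =
    \<lparr>carrier = {..<n} \<rightarrow>\<^sub>E carrier A,
     monoid.mult = undefined,
     one = undefined,
     ring.zero = (\<lambda>i\<in>{..<n}. \<zero>\<^bsub>A\<^esub>),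
     add = (\<lambda>v w. \<lambda>i\<in>{..<n}. v i \<oplus>\<^bsub>A\<^esub> w i),
     module.smult = (\<lambda>a v. \<lambda>i\<in>{..<n}. a \<otimes>\<^bsub>A\<^esub> v i)\<rparr>"

definition quotient_module :: "('r, 'm) module \<Rightarrow> 'm set \<Rightarrow> ('r, 'm set) module" where
  "quotient_module M N =
    \<lparr>carrier = a_rcosets\<^bsub>M\<^esub> N,
     monoid.mult = undefined,
     one = undefined,
     ring.zero = N,
     add = set_add M,
     module.smult = (\<lambda>a C. \<Union>y\<in>C. N +>\<^bsub>M\<^esub> (a \<odot>\<^bsub>M\<^esub> y))\<rparr>"

definition module_isomorphic ::
  "('r, 'a) ring_scheme \<Rightarrow> ('r, 'm) module \<Rightarrow> ('r, 'n) module \<Rightarrow> bool" where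
  "module_isomorphic A M N \<longleftrightarrow> (\<exists>\<phi>. bij_betw \<phi> (carrier M) (carrier N) \<and>
     (\<forall>v\<in>carrier M. \<forall>w\<in>carrier M. \<phi> (v \<oplus>\<^bsub>M\<^esub> w) = \<phi> v \<oplus>\<^bsub>N\<^esub> \<phi> w) \<and>
     (\<forall>a\<in>carrier A. \<forall>v\<in>carrier M. \<phi> (a \<odot>\<^bsub>M\<^esub> v) = a \<odot>\<^bsub>N\<^esub> \<phi> v))"

text \<open>An \<open>n \<times> k\<close> matrix over \<open>A\<close> acts on row vectors from the right, which is left \<open>A\<close>-linear.\<close>

definition row_mult ::
  "('r, 'a) ring_scheme \<Rightarrow> nat \<Rightarrow> nat \<Rightarrow> (nat \<Rightarrow> nat \<Rightarrow> 'r) \<Rightarrow> (nat \<Rightarrow> 'r) \<Rightarrow> (nat \<Rightarrow> 'r)" where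
  "row_mult A n k B v = (\<lambda>j\<in>{..<k}. \<Oplus>\<^bsub>A\<^esub>i\<in>{..<n}. v i \<otimes>\<^bsub>A\<^esub> B i j)"

definition idempotent_matrix ::
  "('r, 'a) ring_scheme \<Rightarrow> nat \<Rightarrow> (nat \<Rightarrow> nat \<Rightarrow> 'r) \<Rightarrow> bool" where
  "idempotent_matrix A n E \<longleftrightarrow>
    (\<forall>i<n. \<forall>j<n. E i j \<in> carrier A) \<and>
    (\<forall>i<n. \<forall>j<n. (\<Oplus>\<^bsub>A\<^esub>l\<in>{..<n}. E i l \<otimes>\<^bsub>A\<^esub> E l j) = E i j)"

definition matrix_image ::
  "('r, 'a) ring_scheme \<Rightarrow> nat \<Rightarrow> (nat \<Rightarrow> nat \<Rightarrow> 'r) \<Rightarrow> ('r, nat \<Rightarrow> 'r) module" where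
  "matrix_image A n E =
    (free_module A n)\<lparr>carrier := row_mult A n n E ` carrier (free_module A n)\<rparr>"


section \<open>Von Neumann dimension\<close>

text \<open>
  The finitely generated projective modules are, up to isomorphism, the images of idempotent
  matrices; their dimension is the trace of the matrix.  The trace of an idempotent matrix is real
  and depends only on the isomorphism class of its image.
\<close>

definition fg_projective_of_dim ::
  "('g, 'a) monoid_scheme \<Rightarrow> ('g operator, 'm) module \<Rightarrow> real \<Rightarrow> bool" where
  "fg_projective_of_dim G P t \<longleftrightarrow> (\<exists>n E. idempotent_matrix (vn_algebra G) n E \<and>
     module_isomorphic (vn_algebra G) P (matrix_image (vn_algebra G) n E) \<and>
     t = Re (\<Sum>i<n. vn_trace G (E i i)))"

text \<open>
  The extended dimension of an arbitrary module is the supremum of the dimensions of its finitely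
  generated projective submodules.
\<close>

definition vn_dim :: "('g, 'a) monoid_scheme \<Rightarrow> ('g operator, 'm) module \<Rightarrow> ereal" where
  "vn_dim G M = Sup {ereal t | P t.
     submodule P (vn_algebra G) M \<and> fg_projective_of_dim G (M\<lparr>carrier := P\<rparr>) t}"


section \<open>The universal cover of the presentation complex\<close>

text \<open>
  The universal cover \<open>Y\<close> of the presentation complex is the Cayley complex: its vertices are the
  elements of \<open>G\<close>, the edge \<open>(g, j)\<close> runs from \<open>g\<close> to \<open>g \<cdot> x j\<close>, and the 2-cell \<open>(g, i)\<close> is attached
  along the loop at \<open>g\<close> that reads the word \<open>R i\<close>.  The group acts by left multiplication on the
  first component.
\<close>

definition edge_boundary ::
  "('g, 'a) monoid_scheme \<Rightarrow> (nat \<Rightarrow> 'g) \<Rightarrow> 'g \<times> nat \<Rightarrow> ('g \<Rightarrow> int)" where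
  "edge_boundary G x e =
    (\<lambda>h. of_bool (h = fst e \<otimes>\<^bsub>G\<^esub> x (snd e)) - of_bool (h = fst e))"

fun path_chain ::
  "('g, 'a) monoid_scheme \<Rightarrow> (nat \<Rightarrow> 'g) \<Rightarrow> 'g \<Rightarrow> word \<Rightarrow> ('g \<times> nat \<Rightarrow> int)" where
  "path_chain G x g [] = (\<lambda>e. 0)"
| "path_chain G x g ((j, True) # w) =
    (\<lambda>e. of_bool (e = (g, j)) + path_chain G x (g \<otimes>\<^bsub>G\<^esub> x j) w e)"
| "path_chain G x g ((j, False) # w) =
    (\<lambda>e. - of_bool (e = (g \<otimes>\<^bsub>G\<^esub> inv\<^bsub>G\<^esub> (x j), j)) + path_chain G x (g \<otimes>\<^bsub>G\<^esub> inv\<^bsub>G\<^esub> (x j)) w e)"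

definition face_boundary ::
  "('g, 'a) monoid_scheme \<Rightarrow> (nat \<Rightarrow> 'g) \<Rightarrow> (nat \<Rightarrow> word) \<Rightarrow> 'g \<times> nat \<Rightarrow> ('g \<times> nat \<Rightarrow> int)" where
  "face_boundary G x R c = path_chain G x (fst c) (R (snd c))"

text \<open>
  The cells with first component \<open>\<one>\<close> form \<open>\<int>G\<close>-bases of the cellular chain modules of \<open>Y\<close>.  In these
  bases the chain complex \<open>\<N>(G) \<otimes>\<^bsub>\<int>G\<^esub> C\<^sub>*(Y)\<close> is \<open>\<N>(G)\<^sup>r \<rightarrow> \<N>(G)\<^sup>d \<rightarrow> \<N>(G)\<close>, with the
  following matrices: the coefficient at the basis edge \<open>(\<one>, j)\<close> of a 1-chain \<open>c\<close> is the element
  \<open>\<lambda>h. c (h, j)\<close> of \<open>\<int>G\<close>.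
\<close>

definition boundary_matrix_1 ::
  "('g, 'a) monoid_scheme \<Rightarrow> (nat \<Rightarrow> 'g) \<Rightarrow> nat \<Rightarrow> nat \<Rightarrow> 'g operator" where
  "boundary_matrix_1 G x j k = group_ring_operator G (edge_boundary G x (\<one>\<^bsub>G\<^esub>, j))"

definition boundary_matrix_2 ::
  "('g, 'a) monoid_scheme \<Rightarrow> (nat \<Rightarrow> 'g) \<Rightarrow> (nat \<Rightarrow> word) \<Rightarrow> nat \<Rightarrow> nat \<Rightarrow> 'g operator" where
  "boundary_matrix_2 G x R i j =
    group_ring_operator G (\<lambda>h. face_boundary G x R (\<one>\<^bsub>G\<^esub>, i) (h, j))"

definition cycles_1 ::
  "('g, 'a) monoid_scheme \<Rightarrow> nat \<Rightarrow> (nat \<Rightarrow> 'g) \<Rightarrow> (nat \<Rightarrow> 'g operator) set" where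
  "cycles_1 G d x = {v \<in> carrier (free_module (vn_algebra G) d).
     row_mult (vn_algebra G) d 1 (boundary_matrix_1 G x) v = \<zero>\<^bsub>free_module (vn_algebra G) 1\<^esub>}"

definition boundaries_1 ::
  "('g, 'a) monoid_scheme \<Rightarrow> nat \<Rightarrow> (nat \<Rightarrow> 'g) \<Rightarrow> nat \<Rightarrow> (nat \<Rightarrow> word) \<Rightarrow>
    (nat \<Rightarrow> 'g operator) set" where
  "boundaries_1 G d x r R =
    row_mult (vn_algebra G) r d (boundary_matrix_2 G x R) ` carrier (free_module (vn_algebra G) r)"

definition homology_1 ::
  "('g, 'a) monoid_scheme \<Rightarrow> nat \<Rightarrow> (nat \<Rightarrow> 'g) \<Rightarrow> nat \<Rightarrow> (nat \<Rightarrow> word) \<Rightarrow>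
    ('g operator, (nat \<Rightarrow> 'g operator) set) module" where
  "homology_1 G d x r R =
    quotient_module ((free_module (vn_algebra G) d)\<lparr>carrier := cycles_1 G d x\<rparr>)
      (boundaries_1 G d x r R)"

definition first_l2_betti ::
  "('g, 'a) monoid_scheme \<Rightarrow> nat \<Rightarrow> (nat \<Rightarrow> 'g) \<Rightarrow> nat \<Rightarrow> (nat \<Rightarrow> word) \<Rightarrow> ereal" where
  "first_l2_betti G d x r R = vn_dim G (homology_1 G d x r R)"

end

theory Submission
  imports Defs
begin

text \<open>
  Let \<open>Y\<close> be the Cayley complex of the presentation and consider square-summable functions on its
  vertices, edges and faces.  The proof is an Euler characteristic count in which dimensions are
  replaced by traces per \<open>G\<close>-orbit of cells: one orbit of vertices, \<open>d\<close> of edges and \<open>r\<close> of faces.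

  Let \<open>D\<close> be the sum of the coboundary operator and its adjoint, scaled to a contraction.  It
  exchanges the functions on edges with those on vertices and faces.  The even powers of
  \<open>R = 1 - D\<^sup>2\<close> converge to the projection \<open>E\<close> to the kernel of \<open>D\<close>, the harmonic functions
  (lemmas \<open>R_pow_even_tendsto_E\<close> and \<open>D_E\<close>).  By the trace property, the trace of \<open>R\<^sup>n\<close> over the edges
  minus its trace over the vertices and faces is \<open>d - 1 - r\<close> for every \<open>n\<close>
  (lemma \<open>supertrace_R_pow\<close>).

  The trace over vertices and faces is bounded below by exhibiting vectors in the kernel of \<open>D\<close>.
  The \<open>m\<close> faces that read \<open>u\<^sup>m\<close> from the vertices \<open>1, u, \<dots>, u\<^sup>m\<^sup>-\<^sup>1\<close> have the same boundary loop.
  Since these vertices are distinct, the point mass at a face differs from its average over \<open>m\<close>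
  faces by a kernel vector of squared norm \<open>1 - 1/m\<close>, and so the faces contribute at least
  \<open>\<Sum>i<r. 1 - 1 / m i\<close> (lemma \<open>face_lower_bound\<close>).  The vertices contribute at least 0, and at least
  \<open>1 / |G|\<close> if \<open>G\<close> is finite, by the constant functions (lemma \<open>vertex_lower_bound_finite\<close>).
  Consequently the trace of \<open>E\<close> over the edges is at least \<open>d - 1 - \<Sum>i<r. 1 / m i\<close>, plus \<open>1 / |G|\<close> if \<open>G\<close>
  is finite (lemma \<open>harmonic_edge_trace_lower_bound\<close>).

  The block of \<open>E\<close> on the edges is an idempotent matrix over the group von Neumann algebra.  It is
  annihilated by both boundary matrices, so its image embeds in the first homology and its trace is
  at most the first \<open>\<ell>\<^sup>2\<close> Betti number (lemma \<open>harmonic_trace_le_first_l2_betti\<close>).  This gives the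
  second claim.

  If \<open>G\<close> is finite, then a harmonic function on the edges sums to zero along the relators, hence along
  every word that is trivial in \<open>G\<close>; so it is the coboundary of a function on the vertices, and being
  orthogonal to these it is zero (lemma \<open>finite_harmonic_edge_function_zero\<close>).  The trace of \<open>E\<close>
  over the edges is zero, which gives the first claim.
\<close>

section \<open>Free groups\<close>

definition flip :: "nat \<times> bool \<Rightarrow> nat \<times> bool" where
  "flip a = (fst a, \<not> snd a)"

lemma flip_flip [simp]: "flip (flip a) = a"
  by (simp add: flip_def)

lemma fst_flip [simp]: "fst (flip a) = fst a"
  by (simp add: flip_def)

lemma cancels_iff_flip: "fst a = fst b \<and> snd a \<noteq> snd b \<longleftrightarrow> b = flip a"
  by (cases a; cases b) (auto simp: flip_def)

lemma cancel_cons_Cons: "cancel_cons a (b # w) = (if b = flip a then w else a # b # w)"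
  by (simp add: cancels_iff_flip[symmetric])

declare cancel_cons.simps(2) [simp del]
declare cancel_cons_Cons [simp]

lemma reduced_word_Nil [simp]: "reduced_word []"
  by (simp add: reduced_word_def)

lemma reduced_word_single [simp]: "reduced_word [a]"
  by (simp add: reduced_word_def)

lemma reduced_word_Cons_Cons [simp]:
  "reduced_word (a # b # w) \<longleftrightarrow> b \<noteq> flip a \<and> reduced_word (b # w)"
  by (cases a; cases b) (auto simp: reduced_word_def flip_def)

lemma reduced_word_ConsD: "reduced_word (a # w) \<Longrightarrow> reduced_word w"
  by (cases w) auto

lemma reduced_cancel_cons: "reduced_word w \<Longrightarrow> reduced_word (cancel_cons a w)"
  by (cases w) (auto dest: reduced_word_ConsD)

lemma reduced_foldr_cancel_cons: "reduced_word w \<Longrightarrow> reduced_word (foldr cancel_cons v w)"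
  by (induction v) (auto intro: reduced_cancel_cons)

lemma cancel_cons_flip: "reduced_word w \<Longrightarrow> cancel_cons a (cancel_cons (flip a) w) = w"
  by (cases w; cases "tl w") auto

lemma cancel_cons_reduced: "reduced_word (a # w) \<Longrightarrow> cancel_cons a w = a # w"
  by (cases w) auto

lemma foldr_cancel_cons_Nil: "reduced_word w \<Longrightarrow> foldr cancel_cons w [] = w"
proof (induction w)
  case (Cons a w)
  then show ?case
    using cancel_cons_reduced reduced_word_ConsD by fastforce
qed simp

text \<open>Letters act on the reduced words, and a word acts in the same way as its reduction.
  Associativity of the product is the statement that this is an action.\<close>

lemma foldr_cancel_cons_action:
  assumes "reduced_word z"
  shows "foldr cancel_cons (foldr cancel_cons v w) z = foldr cancel_cons v (foldr cancel_cons w z)"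
proof -
  have step: "foldr cancel_cons (cancel_cons a w) z = cancel_cons a (foldr cancel_cons w z)" for a w
  proof (cases w)
    case (Cons b w')
    then show ?thesis
      using cancel_cons_flip[OF reduced_foldr_cancel_cons[OF assms]] by auto
  qed simp
  show ?thesis
    by (induction v) (auto simp: step)
qed

lemma letters_cancel_cons: "fst ` set (cancel_cons a w) \<subseteq> insert (fst a) (fst ` set w)"
  by (cases w) auto

lemma letters_foldr_cancel_cons:
  "fst ` set (foldr cancel_cons v w) \<subseteq> fst ` set v \<union> fst ` set w"
proof (induction v)
  case (Cons a v)
  then show ?case
    using order_trans[OF letters_cancel_cons[of a "foldr cancel_cons v w"] insert_mono[OF Cons.IH]]
    by simp
qed simp

definition inverse_word :: "word \<Rightarrow> word" where
  "inverse_word w = rev (map flip w)"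

lemma reduced_inverse_word: "reduced_word w \<Longrightarrow> reduced_word (inverse_word w)"
  unfolding reduced_word_def inverse_word_def successively_rev successively_map
  by (erule successively_mono) (auto simp: flip_def)

lemma letters_inverse_word [simp]: "fst ` set (inverse_word w) = fst ` set w"
  by (simp add: inverse_word_def image_image)

lemma inverse_word_left_cancel:
  "reduced_word z \<Longrightarrow> foldr cancel_cons (inverse_word w) (foldr cancel_cons w z) = z"
proof (induction w arbitrary: z)
  case (Cons a w)
  have "foldr cancel_cons (inverse_word (a # w)) (foldr cancel_cons (a # w) z) =
        foldr cancel_cons (inverse_word w) (cancel_cons (flip a) (cancel_cons a (foldr cancel_cons w z)))"
    by (simp add: inverse_word_def)
  also have "\<dots> = foldr cancel_cons (inverse_word w) (foldr cancel_cons w z)"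
    using cancel_cons_flip[of "foldr cancel_cons w z" "flip a"] reduced_foldr_cancel_cons[OF Cons.prems]
    by simp
  finally show ?case
    using Cons by simp
qed (simp add: inverse_word_def)

lemma group_free_group: "group (free_group d)"
proof (rule groupI)
  fix x y z assume "x \<in> carrier (free_group d)" "y \<in> carrier (free_group d)" "z \<in> carrier (free_group d)"
  then show "x \<otimes>\<^bsub>free_group d\<^esub> y \<otimes>\<^bsub>free_group d\<^esub> z = x \<otimes>\<^bsub>free_group d\<^esub> (y \<otimes>\<^bsub>free_group d\<^esub> z)"
    by (simp add: free_group_def foldr_cancel_cons_action)
next
  fix x y assume "x \<in> carrier (free_group d)" "y \<in> carrier (free_group d)"
  then show "x \<otimes>\<^bsub>free_group d\<^esub> y \<in> carrier (free_group d)"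
    using order_trans[OF letters_foldr_cancel_cons[of x y], of "{..<d}"]
    by (simp add: free_group_def reduced_foldr_cancel_cons)
next
  fix x assume x: "x \<in> carrier (free_group d)"
  then have "inverse_word x \<in> carrier (free_group d)"
    by (simp add: free_group_def reduced_inverse_word)
  moreover have "inverse_word x \<otimes>\<^bsub>free_group d\<^esub> x = \<one>\<^bsub>free_group d\<^esub>"
    using x inverse_word_left_cancel[of "[]" x] by (simp add: free_group_def foldr_cancel_cons_Nil)
  ultimately show "\<exists>y\<in>carrier (free_group d). y \<otimes>\<^bsub>free_group d\<^esub> x = \<one>\<^bsub>free_group d\<^esub>"
    by blast
qed (simp_all add: free_group_def)

section \<open>Sums along paths in the Cayley graph\<close>

fun path_sum ::
  "('g, 'a) monoid_scheme \<Rightarrow> (nat \<Rightarrow> 'g) \<Rightarrow> ('g \<times> nat \<Rightarrow> 'b::ab_group_add) \<Rightarrow> 'g \<Rightarrow> word \<Rightarrow> 'b" where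
  "path_sum G x y g [] = 0"
| "path_sum G x y g ((j, True) # w) = y (g, j) + path_sum G x y (g \<otimes>\<^bsub>G\<^esub> x j) w"
| "path_sum G x y g ((j, False) # w) =
    - y (g \<otimes>\<^bsub>G\<^esub> inv\<^bsub>G\<^esub> (x j), j) + path_sum G x y (g \<otimes>\<^bsub>G\<^esub> inv\<^bsub>G\<^esub> (x j)) w"

locale marked_group = group G for G (structure) +
  fixes d :: nat and x :: "nat \<Rightarrow> 'a"
  assumes marking: "x \<in> {..<d} \<rightarrow> carrier G"
begin

abbreviation "F \<equiv> free_group d"

definition words :: "word set" where
  "words = {w. fst ` set w \<subseteq> {..<d}}"

lemma words_simps [simp]: "[] \<in> words" "a # w \<in> words \<longleftrightarrow> fst a < d \<and> w \<in> words"
  by (auto simp: words_def)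

lemma free_group_words: "w \<in> carrier F \<Longrightarrow> w \<in> words"
  by (simp add: free_group_def words_def)

lemma marking_closed [simp]: "j < d \<Longrightarrow> x j \<in> carrier G"
  using marking by auto

lemma letter_eval_closed [simp]: "fst a < d \<Longrightarrow> letter_eval G x a \<in> carrier G"
  by (simp add: letter_eval_def)

lemma word_eval_Nil [simp]: "word_eval G x [] = \<one>"
  by (simp add: word_eval_def)

lemma word_eval_Cons [simp]: "word_eval G x (a # w) = letter_eval G x a \<otimes> word_eval G x w"
  by (simp add: word_eval_def)

lemma word_eval_closed [simp]: "w \<in> words \<Longrightarrow> word_eval G x w \<in> carrier G"
  by (induction w) auto

lemma letter_eval_flip: "fst a < d \<Longrightarrow> letter_eval G x (flip a) = inv (letter_eval G x a)"
  by (simp add: letter_eval_def flip_def)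

lemma word_eval_cancel_cons:
  assumes "fst a < d" "w \<in> words"
  shows "word_eval G x (cancel_cons a w) = letter_eval G x a \<otimes> word_eval G x w"
proof (cases w)
  case (Cons b w')
  show ?thesis
  proof (cases "b = flip a")
    case True
    then show ?thesis
      using Cons assms m_assoc[of "letter_eval G x a" "inv (letter_eval G x a)" "word_eval G x w'"]
      by (simp add: letter_eval_flip)
  qed (use Cons in simp)
qed simp

lemma cancel_cons_words: "fst a < d \<Longrightarrow> w \<in> words \<Longrightarrow> cancel_cons a w \<in> words"
  using order_trans[OF letters_cancel_cons[of a w], of "{..<d}"] by (simp add: words_def)

lemma foldr_cancel_cons_words: "v \<in> words \<Longrightarrow> w \<in> words \<Longrightarrow> foldr cancel_cons v w \<in> words"
  by (induction v) (auto intro: cancel_cons_words)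

lemma word_eval_foldr_cancel_cons:
  "v \<in> words \<Longrightarrow> w \<in> words \<Longrightarrow>
   word_eval G x (foldr cancel_cons v w) = word_eval G x v \<otimes> word_eval G x w"
  by (induction v) (auto simp: word_eval_cancel_cons foldr_cancel_cons_words m_assoc)

lemma word_eval_mult:
  "v \<in> carrier F \<Longrightarrow> w \<in> carrier F \<Longrightarrow>
   word_eval G x (v \<otimes>\<^bsub>F\<^esub> w) = word_eval G x v \<otimes> word_eval G x w"
  using word_eval_foldr_cancel_cons[of v w] free_group_words by (simp add: free_group_def)

lemma word_eval_hom: "word_eval G x \<in> hom F G"
  by (auto simp: hom_def word_eval_mult free_group_words)

lemma path_sum_Cons:
  "path_sum G x y g (a # w) = path_sum G x y g [a] + path_sum G x y (g \<otimes> letter_eval G x a) w"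
  by (cases a rule: prod.exhaust; cases "snd a") (auto simp: letter_eval_def)

text \<open>Going along an edge and straight back contributes nothing, so a sum along a path depends only
  on the reduced word.\<close>

lemma path_sum_cancel_cons:
  assumes "g \<in> carrier G" "fst a < d" "w \<in> words"
  shows "path_sum G x y g (cancel_cons a w) =
         path_sum G x y g [a] + path_sum G x y (g \<otimes> letter_eval G x a) w"
proof (cases w)
  case Nil
  then show ?thesis by simp
next
  case (Cons b w')
  show ?thesis
  proof (cases "b = flip a")
    case True
    then show ?thesis
      using assms Cons
      by (cases a; cases "snd a") (auto simp: letter_eval_def flip_def m_assoc)
  next
    case False
    then have "cancel_cons a w = a # w"
      using Cons by simp
    then show ?thesis
      by (simp only: path_sum_Cons[of y g a w])
  qed
qed

lemma path_sum_foldr_cancel_cons: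
  assumes "g \<in> carrier G" "v \<in> words" "w \<in> words"
  shows "path_sum G x y g (foldr cancel_cons v w) =
         path_sum G x y g v + path_sum G x y (g \<otimes> word_eval G x v) w"
  using assms
proof (induction v arbitrary: g)
  case (Cons a v)
  have "path_sum G x y g (foldr cancel_cons (a # v) w) = path_sum G x y g [a] +
     (path_sum G x y (g \<otimes> letter_eval G x a) v +
      path_sum G x y (g \<otimes> letter_eval G x a \<otimes> word_eval G x v) w)"
    using Cons by (simp add: path_sum_cancel_cons foldr_cancel_cons_words)
  then show ?case
    using Cons.prems by (simp add: path_sum_Cons[of y g a v] m_assoc add.assoc)
qed simp

lemma path_sum_mult:
  assumes "g \<in> carrier G" "v \<in> carrier F" "w \<in> carrier F"
  shows "path_sum G x y g (v \<otimes>\<^bsub>F\<^esub> w) =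
         path_sum G x y g v + path_sum G x y (g \<otimes> word_eval G x v) w"
  using path_sum_foldr_cancel_cons[of g v w] assms free_group_words by (simp add: free_group_def)

lemma path_sum_pow:
  fixes n :: nat
  assumes "g \<in> carrier G" "w \<in> carrier F"
  shows "path_sum G x y g (w [^]\<^bsub>F\<^esub> n) =
         (\<Sum>k<n. path_sum G x y (g \<otimes> word_eval G x w [^] k) w)"
proof -
  interpret F: group F by (rule group_free_group)
  interpret h: group_hom F G "word_eval G x"
    by unfold_locales (rule word_eval_hom)
  show ?thesis
  proof (induction n)
    case 0
    then show ?case
      by (simp add: free_group_def)
  next
    case (Suc n)
    then show ?case
      using assms by (simp add: path_sum_mult h.hom_nat_pow)
  qed
qed

lemma path_sum_translate:
  assumes "k \<in> carrier G" "g \<in> carrier G" "w \<in> words"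
  shows "path_sum G x y (k \<otimes> g) w = path_sum G x (\<lambda>(h, j). y (k \<otimes> h, j)) g w"
  using assms
proof (induction w arbitrary: g)
  case (Cons a w)
  then show ?case
    by (cases a; cases "snd a") (auto simp: m_assoc)
qed simp

text \<open>The cellular 1-chain of a path counts the signed passages through each edge, so summing a
  function along the path is pairing it with the chain.  This turns the boundary matrices, which
  are given by chains, into operators of summation along relators.\<close>

lemma path_sum_eq_sum_path_chain:
  assumes "g \<in> carrier G" "w \<in> words"
  obtains S where "finite S" "S \<subseteq> carrier G \<times> {..<d}"
    "\<And>e. e \<notin> S \<Longrightarrow> path_chain G x g w e = 0"
    "\<And>y :: 'a \<times> nat \<Rightarrow> complex.
       path_sum G x y g w = (\<Sum>e\<in>S. of_int (path_chain G x g w e) * y e)"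
proof -
  have "\<exists>S. finite S \<and> S \<subseteq> carrier G \<times> {..<d} \<and> (\<forall>e. e \<notin> S \<longrightarrow> path_chain G x g w e = 0) \<and>
     (\<forall>y :: 'a \<times> nat \<Rightarrow> complex. path_sum G x y g w = (\<Sum>e\<in>S. of_int (path_chain G x g w e) * y e))"
    using assms
  proof (induction w arbitrary: g)
    case Nil
    then show ?case
      by (intro exI[of _ "{}"]) auto
  next
    case (Cons a w)
    define g' where "g' = g \<otimes> letter_eval G x a"
    define e0 where "e0 = ((if snd a then g else g'), fst a)"
    define s :: int where "s = (if snd a then 1 else -1)"
    have g': "g' \<in> carrier G"
      using Cons.prems by (simp add: g'_def)
    from Cons.IH[OF g'] Cons.prems obtain S where S: "finite S" "S \<subseteq> carrier G \<times> {..<d}"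
      "\<forall>e. e \<notin> S \<longrightarrow> path_chain G x g' w e = 0"
      "\<forall>y :: 'a \<times> nat \<Rightarrow> complex. path_sum G x y g' w = (\<Sum>e\<in>S. of_int (path_chain G x g' w e) * y e)"
      by auto
    have chain: "path_chain G x g (a # w) = (\<lambda>e. s * of_bool (e = e0) + path_chain G x g' w e)"
      by (cases a; cases "snd a") (auto simp: g'_def e0_def s_def letter_eval_def)
    have path: "path_sum G x y g (a # w) = of_int s * y e0 + path_sum G x y g' w"
      for y :: "'a \<times> nat \<Rightarrow> complex"
      by (cases a; cases "snd a") (auto simp: g'_def e0_def s_def letter_eval_def)
    have "path_sum G x y g (a # w) = (\<Sum>e\<in>insert e0 S. of_int (path_chain G x g (a # w) e) * y e)"
      for y :: "'a \<times> nat \<Rightarrow> complex"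
    proof -
      have "(\<Sum>e\<in>insert e0 S. of_int (path_chain G x g (a # w) e) * y e) =
            (\<Sum>e\<in>insert e0 S. of_int s * (of_bool (e = e0) * y e)) +
            (\<Sum>e\<in>insert e0 S. of_int (path_chain G x g' w e) * y e)"
        unfolding chain by (simp add: algebra_simps sum.distrib)
      also have "(\<Sum>e\<in>insert e0 S. of_int s * (of_bool (e = e0) * y e)) =
                 (\<Sum>e\<in>insert e0 S. if e = e0 then of_int s * y e0 else 0)"
        by (intro sum.cong) auto
      also have "\<dots> = of_int s * y e0"
        using S(1) by simp
      also have "(\<Sum>e\<in>insert e0 S. of_int (path_chain G x g' w e) * y e) =
                 (\<Sum>e\<in>S. of_int (path_chain G x g' w e) * y e)"
        using S by (intro sum.mono_neutral_right) auto
      finally show ?thesis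
        using S(4) path by simp
    qed
    moreover have "insert e0 S \<subseteq> carrier G \<times> {..<d}"
      using S(2) Cons.prems g' by (auto simp: e0_def)
    ultimately show ?case
      using S(1,3) by (intro exI[of _ "insert e0 S"]) (auto simp: chain)
  qed
  then show ?thesis
    using that by blast
qed

end

text \<open>The words along which a sum vanishes from every base point form a normal subgroup of the
  free group; if it contains the relators, it contains every word that is trivial in the group.\<close>

lemma path_sum_eq_of_word_eval_eq:
  fixes y :: "'g \<times> nat \<Rightarrow> 'b::ab_group_add"
  assumes pres: "presented_by G d x r R"
    and closed: "\<And>h i. h \<in> carrier G \<Longrightarrow> i < r \<Longrightarrow> path_sum G x y h (R i) = 0"
    and v: "v \<in> carrier (free_group d)" and w: "w \<in> carrier (free_group d)"
    and eq: "word_eval G x v = word_eval G x w" and g: "g \<in> carrier G"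
  shows "path_sum G x y g v = path_sum G x y g w"
proof -
  interpret marked_group G d x
    using pres by (auto simp: presented_by_def marked_group_def marked_group_axioms_def)
  interpret F: group F by (rule group_free_group)
  interpret h: group_hom F G "word_eval G x"
    by unfold_locales (rule word_eval_hom)
  define Z where "Z = {w \<in> kernel F G (word_eval G x). \<forall>h\<in>carrier G. path_sum G x y h w = 0}"
  have ker: "kernel F G (word_eval G x) = normal_closure F (R ` {..<r})"
    using pres by (auto simp: presented_by_def)
  have R: "R i \<in> carrier F" if "i < r" for i
    using pres that by (auto simp: presented_by_def)
  have inv_sum: "path_sum G x y h (inv\<^bsub>F\<^esub> v) = - path_sum G x y (h \<otimes>\<^bsub>G\<^esub> inv\<^bsub>G\<^esub> (word_eval G x v)) v"
    if "v \<in> carrier F" "h \<in> carrier G" for v h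
  proof -
    have "path_sum G x y h (inv\<^bsub>F\<^esub> v \<otimes>\<^bsub>F\<^esub> v) = 0"
      using that(1) by simp (simp add: free_group_def)
    moreover have "path_sum G x y h (inv\<^bsub>F\<^esub> v \<otimes>\<^bsub>F\<^esub> v) =
      path_sum G x y h (inv\<^bsub>F\<^esub> v) + path_sum G x y (h \<otimes>\<^bsub>G\<^esub> inv\<^bsub>G\<^esub> (word_eval G x v)) v"
      using that by (subst path_sum_mult) (simp_all add: h.hom_inv)
    ultimately show ?thesis
      by (metis eq_neg_iff_add_eq_0)
  qed
  have relator: "R i \<in> Z" if "i < r" for i
  proof -
    have "R i \<in> normal_closure F (R ` {..<r})"
      unfolding normal_closure_def
    proof (rule generate.incl, rule UN_I)
      show "\<one>\<^bsub>F\<^esub> \<in> carrier F" by simp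
      show "R i \<in> (\<lambda>s. \<one>\<^bsub>F\<^esub> \<otimes>\<^bsub>F\<^esub> s \<otimes>\<^bsub>F\<^esub> inv\<^bsub>F\<^esub> \<one>\<^bsub>F\<^esub>) ` R ` {..<r}"
        using that R by (auto simp: image_image intro!: image_eqI[of _ _ i])
    qed
    then show ?thesis
      using that closed by (auto simp: Z_def ker)
  qed
  have conj: "c \<otimes>\<^bsub>F\<^esub> s \<otimes>\<^bsub>F\<^esub> inv\<^bsub>F\<^esub> c \<in> Z" if "s \<in> Z" "c \<in> carrier F" for s c
  proof -
    have s: "s \<in> carrier F" "word_eval G x s = \<one>\<^bsub>G\<^esub>" "\<forall>h\<in>carrier G. path_sum G x y h s = 0"
      using that(1) by (auto simp: Z_def kernel_def)
    have [simp]: "word_eval G x c \<in> carrier G"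
      using that(2) by simp
    have "path_sum G x y h (c \<otimes>\<^bsub>F\<^esub> s \<otimes>\<^bsub>F\<^esub> inv\<^bsub>F\<^esub> c) = 0" if h: "h \<in> carrier G" for h
    proof -
      have "path_sum G x y h (c \<otimes>\<^bsub>F\<^esub> s \<otimes>\<^bsub>F\<^esub> inv\<^bsub>F\<^esub> c) =
        path_sum G x y h c + path_sum G x y (h \<otimes>\<^bsub>G\<^esub> word_eval G x c) s +
        path_sum G x y (h \<otimes>\<^bsub>G\<^esub> word_eval G x c) (inv\<^bsub>F\<^esub> c)"
        using s h \<open>c \<in> carrier F\<close>
        by (subst path_sum_mult, simp_all, subst path_sum_mult, simp_all)
      also have "\<dots> = 0"
        using s h \<open>c \<in> carrier F\<close> by (subst inv_sum) (simp_all add: m_assoc)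
      finally show ?thesis .
    qed
    moreover have "word_eval G x (c \<otimes>\<^bsub>F\<^esub> s \<otimes>\<^bsub>F\<^esub> inv\<^bsub>F\<^esub> c) = \<one>\<^bsub>G\<^esub>"
      using s that(2) by simp
    ultimately show ?thesis
      using s that(2) by (simp add: Z_def kernel_def)
  qed
  have "kernel F G (word_eval G x) \<subseteq> Z"
  proof
    fix z assume "z \<in> kernel F G (word_eval G x)"
    then have "z \<in> generate F (\<Union>g\<in>carrier F. (\<lambda>s. g \<otimes>\<^bsub>F\<^esub> s \<otimes>\<^bsub>F\<^esub> inv\<^bsub>F\<^esub> g) ` (R ` {..<r}))"
      unfolding ker normal_closure_def .
    then show "z \<in> Z"
    proof induction
      case one
      then show ?case
        by (simp add: Z_def kernel_def) (simp add: free_group_def)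
    next
      case (incl z)
      then show ?case using conj relator by auto
    next
      case (inv z)
      then have "z \<in> Z" using conj relator by auto
      then show ?case
        by (simp add: Z_def kernel_def inv_sum)
    next
      case (eng z1 z2)
      then show ?case
        by (simp add: Z_def kernel_def path_sum_mult)
    qed
  qed
  moreover have "v \<otimes>\<^bsub>F\<^esub> inv\<^bsub>F\<^esub> w \<in> kernel F G (word_eval G x)"
    using v w eq by (simp add: kernel_def)
  ultimately have "0 = path_sum G x y g (v \<otimes>\<^bsub>F\<^esub> inv\<^bsub>F\<^esub> w)"
    using g by (auto simp: Z_def)
  also have "path_sum G x y g (v \<otimes>\<^bsub>F\<^esub> inv\<^bsub>F\<^esub> w) = path_sum G x y g v - path_sum G x y g w"
    using v w g eq by (subst path_sum_mult) (simp_all add: inv_sum m_assoc)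
  finally show ?thesis
    by simp
qed

section \<open>Square-summable functions on a set\<close>

definition l2 :: "'x set \<Rightarrow> ('x \<Rightarrow> complex) set" where
  "l2 A = {f. (\<forall>x. x \<notin> A \<longrightarrow> f x = 0) \<and> (\<lambda>x. (cmod (f x))\<^sup>2) summable_on A}"

definition l2_inner :: "'x set \<Rightarrow> ('x \<Rightarrow> complex) \<Rightarrow> ('x \<Rightarrow> complex) \<Rightarrow> complex" where
  "l2_inner A f k = (\<Sum>\<^sub>\<infinity>x\<in>A. f x * cnj (k x))"

definition l2_normsq :: "'x set \<Rightarrow> ('x \<Rightarrow> complex) \<Rightarrow> real" where
  "l2_normsq A f = (\<Sum>\<^sub>\<infinity>x\<in>A. (cmod (f x))\<^sup>2)"

definition point_mass :: "'x \<Rightarrow> 'x \<Rightarrow> complex" where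
  "point_mass x = (\<lambda>y. of_bool (y = x))"

lemma ell2_eq_l2: "ell2 G = l2 (carrier G)"
  by (simp add: ell2_def l2_def)

lemma l2_outside: "f \<in> l2 A \<Longrightarrow> x \<notin> A \<Longrightarrow> f x = 0"
  by (simp add: l2_def)

lemma l2_summable: "f \<in> l2 A \<Longrightarrow> (\<lambda>x. (cmod (f x))\<^sup>2) summable_on A"
  by (simp add: l2_def)

lemma l2_finite_support:
  assumes "finite S" "S \<subseteq> A" "\<And>x. x \<notin> S \<Longrightarrow> f x = 0"
  shows "f \<in> l2 A"
proof -
  have "(\<lambda>x. (cmod (f x))\<^sup>2) summable_on A \<longleftrightarrow> (\<lambda>x. (cmod (f x))\<^sup>2) summable_on S"
    using assms by (intro summable_on_cong_neutral) auto
  then show ?thesis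
    using assms by (auto simp: l2_def)
qed

lemma l2_normsq_finite_support:
  assumes "finite S" "S \<subseteq> A" "\<And>x. x \<notin> S \<Longrightarrow> f x = 0"
  shows "l2_normsq A f = (\<Sum>x\<in>S. (cmod (f x))\<^sup>2)"
proof -
  have "l2_normsq A f = (\<Sum>\<^sub>\<infinity>x\<in>S. (cmod (f x))\<^sup>2)"
    unfolding l2_normsq_def using assms by (intro infsum_cong_neutral) auto
  then show ?thesis
    using assms(1) by simp
qed

lemma point_mass_l2 [simp]: "x \<in> A \<Longrightarrow> point_mass x \<in> l2 A"
  by (rule l2_finite_support[of "{x}"]) (auto simp: point_mass_def)

lemma zero_l2 [simp]: "(\<lambda>x. 0) \<in> l2 A"
  by (simp add: l2_def)

lemma l2_scale: "f \<in> l2 A \<Longrightarrow> (\<lambda>x. a * f x) \<in> l2 A"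
  by (auto simp: l2_def norm_mult power_mult_distrib intro: summable_on_cmult_right)

lemma l2_add:
  assumes "f \<in> l2 A" "k \<in> l2 A"
  shows "(\<lambda>x. f x + k x) \<in> l2 A"
proof -
  have "(\<lambda>x. (cmod (f x + k x))\<^sup>2) summable_on A"
  proof (rule summable_on_comparison_test)
    show "(\<lambda>x. 2 * (cmod (f x))\<^sup>2 + 2 * (cmod (k x))\<^sup>2) summable_on A"
      using assms by (intro summable_on_add summable_on_cmult_right l2_summable)
    fix x assume "x \<in> A"
    have "(cmod (f x + k x))\<^sup>2 \<le> (cmod (f x) + cmod (k x))\<^sup>2"
      by (intro power_mono norm_triangle_ineq norm_ge_zero)
    also have "\<dots> \<le> 2 * (cmod (f x))\<^sup>2 + 2 * (cmod (k x))\<^sup>2"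
      using sum_squares_bound[of "cmod (f x)" "cmod (k x)"] by (simp add: power2_sum)
    finally show "(cmod (f x + k x))\<^sup>2 \<le> 2 * (cmod (f x))\<^sup>2 + 2 * (cmod (k x))\<^sup>2" .
  qed auto
  then show ?thesis
    using assms by (simp add: l2_def)
qed

lemma l2_lincomb:
  "f \<in> l2 A \<Longrightarrow> k \<in> l2 A \<Longrightarrow> (\<lambda>x. a * f x + b * k x) \<in> l2 A"
  by (intro l2_add l2_scale)

lemma l2_diff: "f \<in> l2 A \<Longrightarrow> k \<in> l2 A \<Longrightarrow> (\<lambda>x. f x - k x) \<in> l2 A"
  using l2_lincomb[of f A k 1 "-1"] by simp

lemma l2_sum:
  assumes "\<And>i. i \<in> I \<Longrightarrow> f i \<in> l2 A"
  shows "(\<lambda>x. \<Sum>i\<in>I. f i x) \<in> l2 A"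
  using assms by (induction I rule: infinite_finite_induct) (auto intro: l2_add)

lemma l2_inner_summable:
  assumes "f \<in> l2 A" "k \<in> l2 A"
  shows "(\<lambda>x. f x * cnj (k x)) summable_on A"
proof -
  have "(\<lambda>x. norm (f x * f x)) summable_on A"
    using l2_summable[OF assms(1)] by (simp only: norm_mult power2_eq_square)
  moreover have "(\<lambda>x. norm (cnj (k x) * cnj (k x))) summable_on A"
    using l2_summable[OF assms(2)] by (simp only: norm_mult power2_eq_square complex_mod_cnj)
  ultimately have "(\<lambda>x. norm (f x * cnj (k x))) summable_on A"
    by (rule abs_summable_product)
  then show ?thesis
    by (rule abs_summable_summable)
qed

lemma l2_inner_lincomb_left:
  assumes "f \<in> l2 A" "g \<in> l2 A" "k \<in> l2 A"
  shows "l2_inner A (\<lambda>x. a * f x + b * g x) k = a * l2_inner A f k + b * l2_inner A g k"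
proof -
  have "l2_inner A (\<lambda>x. a * f x + b * g x) k =
        (\<Sum>\<^sub>\<infinity>x\<in>A. a * (f x * cnj (k x)) + b * (g x * cnj (k x)))"
    by (simp add: l2_inner_def algebra_simps)
  also have "\<dots> = a * l2_inner A f k + b * l2_inner A g k"
    using assms unfolding l2_inner_def
    by (subst infsum_add) (auto intro!: summable_on_cmult_right l2_inner_summable simp: infsum_cmult_right')
  finally show ?thesis .
qed

lemma l2_inner_scale_left: "l2_inner A (\<lambda>x. a * f x) k = a * l2_inner A f k"
  unfolding l2_inner_def by (simp add: mult.assoc infsum_cmult_right')

lemma l2_inner_sum_left:
  assumes "\<And>i. i \<in> I \<Longrightarrow> f i \<in> l2 A" "k \<in> l2 A"
  shows "l2_inner A (\<lambda>x. \<Sum>i\<in>I. f i x) k = (\<Sum>i\<in>I. l2_inner A (f i) k)"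
  using assms(1)
proof (induction I rule: infinite_finite_induct)
  case (insert i I)
  then show ?case
    using l2_inner_lincomb_left[of "f i" A "\<lambda>x. \<Sum>i\<in>I. f i x" k 1 1] assms(2) by (simp add: l2_sum)
qed (simp_all add: l2_inner_def)

lemma l2_inner_commute: "l2_inner A k f = cnj (l2_inner A f k)"
  unfolding l2_inner_def by (simp flip: infsum_cnj add: mult.commute)

lemma l2_inner_diff_left:
  assumes "f \<in> l2 A" "g \<in> l2 A" "k \<in> l2 A"
  shows "l2_inner A (\<lambda>x. f x - g x) k = l2_inner A f k - l2_inner A g k"
  using l2_inner_lincomb_left[OF assms, of 1 "-1"] by simp

lemma l2_inner_diff_right:
  assumes "f \<in> l2 A" "g \<in> l2 A" "k \<in> l2 A"
  shows "l2_inner A k (\<lambda>x. f x - g x) = l2_inner A k f - l2_inner A k g"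
  using l2_inner_diff_left[OF assms] l2_inner_commute[of A k] by simp

lemma l2_inner_self: "f \<in> l2 A \<Longrightarrow> l2_inner A f f = of_real (l2_normsq A f)"
  unfolding l2_inner_def l2_normsq_def complex_norm_square[symmetric]
  by (intro infsumI has_sum_of_real) (auto simp: l2_summable)

lemma l2_normsq_nonneg [simp]: "0 \<le> l2_normsq A f"
  unfolding l2_normsq_def by (intro infsum_nonneg) auto

lemma norm_sq_le_l2_normsq:
  assumes "f \<in> l2 A"
  shows "(cmod (f x))\<^sup>2 \<le> l2_normsq A f"
proof (cases "x \<in> A")
  case True
  then have "(\<Sum>x\<in>{x}. (cmod (f x))\<^sup>2) \<le> l2_normsq A f"
    unfolding l2_normsq_def using assms
    by (intro finite_sum_le_infsum l2_summable) auto
  then show ?thesis by simp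
qed (use assms in \<open>simp add: l2_outside\<close>)

lemma l2_normsq_eq_0D:
  assumes "f \<in> l2 A" "l2_normsq A f \<le> 0"
  shows "f = (\<lambda>x. 0)"
proof
  fix x
  have "(cmod (f x))\<^sup>2 \<le> 0"
    using norm_sq_le_l2_normsq[OF assms(1), of x] assms(2) by linarith
  then show "f x = 0"
    by simp
qed

lemma l2_normsq_diff:
  assumes "f \<in> l2 A" "g \<in> l2 A"
  shows "l2_normsq A (\<lambda>x. f x - g x) = l2_normsq A f - 2 * Re (l2_inner A f g) + l2_normsq A g"
proof -
  have "complex_of_real (l2_normsq A (\<lambda>x. f x - g x)) =
        of_real (l2_normsq A f) - l2_inner A f g - l2_inner A g f + of_real (l2_normsq A g)"
    using assms
    by (simp flip: l2_inner_self add: l2_diff l2_inner_diff_left l2_inner_diff_right)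
  then have "Re (complex_of_real (l2_normsq A (\<lambda>x. f x - g x))) =
        Re (of_real (l2_normsq A f) - l2_inner A f g - l2_inner A g f + of_real (l2_normsq A g))"
    by (rule arg_cong)
  then show ?thesis
    using l2_inner_commute[of A g f] by simp
qed

lemma l2_inner_point_mass:
  assumes "x \<in> A"
  shows "l2_inner A f (point_mass x) = f x"
proof -
  have "l2_inner A f (point_mass x) = (\<Sum>\<^sub>\<infinity>y\<in>{x}. f y * cnj (point_mass x y))"
    unfolding l2_inner_def using assms
    by (intro infsum_cong_neutral) (auto simp: point_mass_def)
  then show ?thesis
    by (simp add: point_mass_def)
qed

text \<open>Square-summability and the size of the norm are both decided by finite partial sums.\<close>

lemma
  assumes "\<And>x. x \<notin> A \<Longrightarrow> f x = 0"
    and finite_bound: "\<And>S. finite S \<Longrightarrow> S \<subseteq> A \<Longrightarrow> (\<Sum>x\<in>S. (cmod (f x))\<^sup>2) \<le> C"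
  shows l2_of_finite_sums: "f \<in> l2 A" and l2_normsq_le_of_finite_sums: "l2_normsq A f \<le> C"
proof -
  have summable: "(\<lambda>x. (cmod (f x))\<^sup>2) summable_on A"
    by (rule nonneg_bdd_above_summable_on) (auto intro!: bdd_aboveI2 finite_bound)
  then show "f \<in> l2 A"
    using assms(1) by (simp add: l2_def)
  show "l2_normsq A f \<le> C"
    unfolding l2_normsq_def using summable finite_bound by (rule infsum_le_finite_sums)
qed

lemma l2_finite_sum_le:
  assumes "f \<in> l2 A" "finite S" "S \<subseteq> A"
  shows "(\<Sum>x\<in>S. (cmod (f x))\<^sup>2) \<le> l2_normsq A f"
  unfolding l2_normsq_def using assms by (intro finite_sum_le_infsum l2_summable) auto

text \<open>Fatou's lemma: a pointwise limit of a bounded sequence obeys the same bound.\<close>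

lemma l2_pointwise_limit:
  assumes "\<And>n. f n \<in> l2 A" "\<And>n. l2_normsq A (f n) \<le> C"
    and "\<And>x. (\<lambda>n. f n x) \<longlonglongrightarrow> g x"
  shows "g \<in> l2 A" "l2_normsq A g \<le> C"
proof -
  have finite_bound: "(\<Sum>x\<in>S. (cmod (g x))\<^sup>2) \<le> C" if "finite S" "S \<subseteq> A" for S
  proof (rule LIMSEQ_le_const2)
    show "(\<lambda>n. \<Sum>x\<in>S. (cmod (f n x))\<^sup>2) \<longlonglongrightarrow> (\<Sum>x\<in>S. (cmod (g x))\<^sup>2)"
      by (intro tendsto_intros assms)
    have "(\<Sum>x\<in>S. (cmod (f n x))\<^sup>2) \<le> C" for n
      by (rule order_trans[OF l2_finite_sum_le[OF assms(1) that] assms(2)])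
    then show "\<exists>N. \<forall>n\<ge>N. (\<Sum>x\<in>S. (cmod (f n x))\<^sup>2) \<le> C"
      by blast
  qed
  have outside: "g x = 0" if "x \<notin> A" for x
  proof -
    have "(\<lambda>n. f n x) = (\<lambda>n. 0)"
      by (intro ext l2_outside[OF assms(1) that])
    then show ?thesis
      using assms(3)[of x] by (simp add: LIMSEQ_const_iff)
  qed
  show "g \<in> l2 A" "l2_normsq A g \<le> C"
    using l2_of_finite_sums[OF outside finite_bound] l2_normsq_le_of_finite_sums[OF outside finite_bound]
    by auto
qed

section \<open>The projection to the kernel of a self-adjoint contraction\<close>

text \<open>For a self-adjoint contraction \<open>D\<close> the even powers of \<open>R = 1 - D\<^sup>2\<close> converge to the orthogonal projection
  \<open>E\<close> to the kernel of \<open>D\<close>.  All limits below are pointwise; they pass through \<open>D\<close> because \<open>D\<close> is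
  assumed to be continuous for pointwise convergence, as operators given by finite sums are.  This
  way the projection is found together with approximations of it whose entries can be computed.\<close>

locale selfadjoint_contraction =
  fixes A :: "'x set" and D :: "('x \<Rightarrow> complex) \<Rightarrow> ('x \<Rightarrow> complex)"
  assumes D_lincomb: "\<And>a b f k. D (\<lambda>x. a * f x + b * k x) = (\<lambda>x. a * D f x + b * D k x)"
    and D_l2: "\<And>f. f \<in> l2 A \<Longrightarrow> D f \<in> l2 A"
    and D_adjoint: "\<And>f k. f \<in> l2 A \<Longrightarrow> k \<in> l2 A \<Longrightarrow> l2_inner A (D f) k = l2_inner A f (D k)"
    and D_contraction: "\<And>f. f \<in> l2 A \<Longrightarrow> l2_normsq A (D f) \<le> l2_normsq A f"
    and D_continuous: "\<And>f g x. (\<And>x. (\<lambda>n. f n x) \<longlonglongrightarrow> g x) \<Longrightarrow> (\<lambda>n. D (f n) x) \<longlonglongrightarrow> D g x"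
begin

definition R :: "('x \<Rightarrow> complex) \<Rightarrow> ('x \<Rightarrow> complex)" where
  "R f = (\<lambda>x. f x - D (D f) x)"

text \<open>Outside \<open>\<ell>\<^sup>2\<close> the limit need not exist, and \<open>E\<close> has no meaning there.\<close>

definition E :: "('x \<Rightarrow> complex) \<Rightarrow> ('x \<Rightarrow> complex)" where
  "E f = (\<lambda>x. lim (\<lambda>n. (R ^^ (2 * n)) f x))"

lemma D_zero: "D (\<lambda>x. 0) = (\<lambda>x. 0)"
  using D_lincomb[of 0 "\<lambda>x. 0" 0 "\<lambda>x. 0"] by simp

lemma D_diff: "D (\<lambda>x. f x - k x) = (\<lambda>x. D f x - D k x)"
  using D_lincomb[of 1 f "-1" k] by simp

lemma R_l2: "f \<in> l2 A \<Longrightarrow> R f \<in> l2 A"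
  by (simp add: R_def l2_diff D_l2)

lemma R_adjoint:
  "f \<in> l2 A \<Longrightarrow> k \<in> l2 A \<Longrightarrow> l2_inner A (R f) k = l2_inner A f (R k)"
  by (simp add: R_def l2_inner_diff_left l2_inner_diff_right D_l2 D_adjoint)

text \<open>\<open>\<parallel>f - D\<^sup>2 f\<parallel>\<^sup>2 = \<parallel>f\<parallel>\<^sup>2 - 2 \<parallel>D f\<parallel>\<^sup>2 + \<parallel>D (D f)\<parallel>\<^sup>2\<close>, and \<open>D\<close> does not increase the norm of \<open>D f\<close>.\<close>

lemma R_normsq:
  assumes "f \<in> l2 A"
  shows "l2_normsq A (R f) \<le> l2_normsq A f - l2_normsq A (D f)"
proof -
  have "l2_inner A f (D (D f)) = of_real (l2_normsq A (D f))"
    using assms by (simp flip: D_adjoint l2_inner_self add: D_l2)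
  then show ?thesis
    using assms D_contraction[of "D f"] by (simp add: R_def l2_normsq_diff D_l2)
qed

lemma R_lincomb: "R (\<lambda>x. a * f x + b * k x) = (\<lambda>x. a * R f x + b * R k x)"
  by (simp add: R_def D_lincomb algebra_simps)

lemma R_continuous:
  assumes "\<And>x. (\<lambda>n. f n x) \<longlonglongrightarrow> g x"
  shows "(\<lambda>n. R (f n) x) \<longlonglongrightarrow> R g x"
  unfolding R_def by (intro tendsto_diff assms D_continuous)

lemma R_pow_l2: "f \<in> l2 A \<Longrightarrow> (R ^^ n) f \<in> l2 A"
  by (induction n) (auto intro: R_l2)

lemma R_pow_lincomb:
  "(R ^^ n) (\<lambda>x. a * f x + b * k x) = (\<lambda>x. a * (R ^^ n) f x + b * (R ^^ n) k x)"
  by (induction n) (auto simp: R_lincomb)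

lemma R_D: "R (D f) = D (R f)"
  by (simp add: R_def D_diff)

lemma R_pow_D: "(R ^^ n) (D f) = D ((R ^^ n) f)"
  by (induction n) (auto simp: R_D)

lemma R_pow_adjoint:
  "f \<in> l2 A \<Longrightarrow> k \<in> l2 A \<Longrightarrow> l2_inner A ((R ^^ n) f) k = l2_inner A f ((R ^^ n) k)"
proof (induction n arbitrary: k)
  case (Suc n)
  then show ?case
    by (simp add: R_adjoint R_pow_l2 R_l2 funpow_swap1[of R n k])
qed simp

lemma R_pow_fixes_kernel:
  assumes "D f = (\<lambda>x. 0)"
  shows "(R ^^ n) f = f"
proof -
  have "R f = f"
    using assms by (simp add: R_def D_zero)
  then show ?thesis
    by (induction n) auto
qed

lemma R_pow_normsq:
  assumes "f \<in> l2 A"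
  shows "l2_inner A ((R ^^ (2 * n)) f) f = of_real (l2_normsq A ((R ^^ n) f))"
proof -
  have "(R ^^ (2 * n)) f = (R ^^ n) ((R ^^ n) f)"
    by (simp add: mult_2 funpow_add)
  then show ?thesis
    using assms by (simp add: R_pow_adjoint R_pow_l2 l2_inner_self)
qed

lemma R_pow_normsq_decseq:
  assumes "f \<in> l2 A"
  shows "decseq (\<lambda>n. l2_normsq A ((R ^^ n) f))"
proof (rule decseq_SucI)
  fix n
  show "l2_normsq A ((R ^^ Suc n) f) \<le> l2_normsq A ((R ^^ n) f)"
    using R_normsq[OF R_pow_l2[OF assms, of n]] l2_normsq_nonneg[of A "D ((R ^^ n) f)"]
    unfolding funpow.simps o_apply by linarith
qed

text \<open>The numbers \<open>b\<^sub>n = \<parallel>R\<^sup>n f\<parallel>\<^sup>2\<close> decrease, hence converge, and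
  \<open>\<parallel>R\<^sup>2\<^sup>n f - R\<^sup>2\<^sup>m f\<parallel>\<^sup>2 = b\<^sub>2\<^sub>n - 2 b\<^sub>n\<^sub>+\<^sub>m + b\<^sub>2\<^sub>m\<close>.  Only the even powers are compared, because
  \<open>R\<close> itself need not be positive.\<close>

lemma R_pow_even_tendsto_E:
  assumes "f \<in> l2 A"
  shows "(\<lambda>n. (R ^^ (2 * n)) f x) \<longlonglongrightarrow> E f x"
proof -
  define b where "b n = l2_normsq A ((R ^^ n) f)" for n
  have "decseq b" "\<forall>i. 0 \<le> b i"
    using R_pow_normsq_decseq[OF assms] by (simp_all add: b_def[abs_def])
  then obtain l where l: "b \<longlonglongrightarrow> l"
    using decseq_convergent[of b 0] by blast
  have inner: "l2_inner A ((R ^^ (2 * n)) f) ((R ^^ (2 * m)) f) = of_real (b (n + m))" for n m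
  proof -
    have "l2_inner A ((R ^^ (2 * n)) f) ((R ^^ (2 * m)) f) = l2_inner A ((R ^^ (2 * m)) ((R ^^ (2 * n)) f)) f"
      using assms by (simp add: R_pow_adjoint R_pow_l2)
    also have "(R ^^ (2 * m)) ((R ^^ (2 * n)) f) = (R ^^ (2 * (n + m))) f"
      unfolding add.commute[of n m] distrib_left funpow_add by simp
    finally show ?thesis
      using R_pow_normsq[OF assms, of "n + m"] by (simp add: b_def)
  qed
  have dist: "(cmod ((R ^^ (2 * n)) f x - (R ^^ (2 * m)) f x))\<^sup>2 \<le> b (2 * n) - 2 * b (n + m) + b (2 * m)" for n m
  proof -
    have "(cmod ((R ^^ (2 * n)) f x - (R ^^ (2 * m)) f x))\<^sup>2 \<le>
          l2_normsq A (\<lambda>x. (R ^^ (2 * n)) f x - (R ^^ (2 * m)) f x)"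
      using norm_sq_le_l2_normsq[OF l2_diff[OF R_pow_l2[OF assms] R_pow_l2[OF assms]]] .
    also have "\<dots> = b (2 * n) - 2 * b (n + m) + b (2 * m)"
      using assms by (subst l2_normsq_diff) (auto simp: R_pow_l2 inner b_def)
    finally show ?thesis .
  qed
  have "Cauchy (\<lambda>n. (R ^^ (2 * n)) f x)"
  proof (rule metric_CauchyI)
    fix e :: real assume "0 < e"
    then have "0 < e\<^sup>2 / 4" by simp
    with l obtain N where N: "\<And>n. n \<ge> N \<Longrightarrow> \<bar>b n - l\<bar> < e\<^sup>2 / 4"
      unfolding lim_sequentially dist_real_def by meson
    have "dist ((R ^^ (2 * n)) f x) ((R ^^ (2 * m)) f x) < e" if "N \<le> m" "N \<le> n" for m n
    proof -
      have "b (2 * n) - 2 * b (n + m) + b (2 * m) < e\<^sup>2"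
        using N[of "2 * n"] N[of "n + m"] N[of "2 * m"] that by (simp add: abs_if split: if_splits)
      then have "(cmod ((R ^^ (2 * n)) f x - (R ^^ (2 * m)) f x))\<^sup>2 < e\<^sup>2"
        using dist[of n m] by linarith
      then show ?thesis
        using \<open>0 < e\<close> power2_less_imp_less[of _ e] by (simp add: dist_norm)
    qed
    then show "\<exists>M. \<forall>m\<ge>M. \<forall>n\<ge>M. dist ((R ^^ (2 * m)) f x) ((R ^^ (2 * n)) f x) < e"
      by blast
  qed
  then show ?thesis
    unfolding E_def by (simp add: Cauchy_convergent_iff convergent_LIMSEQ_iff)
qed

lemma E_eqI:
  assumes "\<And>x. (\<lambda>n. (R ^^ (2 * n)) f x) \<longlonglongrightarrow> g x"
  shows "E f = g"
  using assms by (auto simp: E_def intro!: limI)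

lemma
  assumes f: "f \<in> l2 A"
  shows E_l2: "E f \<in> l2 A" and E_normsq: "l2_normsq A (E f) \<le> l2_normsq A f"
proof -
  have *: "l2_normsq A ((R ^^ (2 * n)) f) \<le> l2_normsq A f" for n
    using decseqD[OF R_pow_normsq_decseq[OF f], of 0 "2 * n"] by simp
  show "E f \<in> l2 A"
    by (rule l2_pointwise_limit(1)[where f = "\<lambda>n. (R ^^ (2 * n)) f", OF R_pow_l2[OF f] *
          R_pow_even_tendsto_E[OF f]])
  show "l2_normsq A (E f) \<le> l2_normsq A f"
    by (rule l2_pointwise_limit(2)[where f = "\<lambda>n. (R ^^ (2 * n)) f", OF R_pow_l2[OF f] *
          R_pow_even_tendsto_E[OF f]])
qed

lemma E_lincomb:
  assumes "f \<in> l2 A" "k \<in> l2 A"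
  shows "E (\<lambda>x. a * f x + b * k x) = (\<lambda>x. a * E f x + b * E k x)"
  using assms by (intro E_eqI) (auto simp: R_pow_lincomb intro!: tendsto_intros R_pow_even_tendsto_E)

text \<open>The function \<open>y = E f\<close> is fixed by \<open>R\<^sup>2\<close>, so \<open>\<parallel>y\<parallel>\<^sup>2 = \<parallel>R y\<parallel>\<^sup>2 \<le> \<parallel>y\<parallel>\<^sup>2 - \<parallel>D y\<parallel>\<^sup>2\<close>.\<close>

lemma D_E:
  assumes "f \<in> l2 A"
  shows "D (E f) = (\<lambda>x. 0)"
proof -
  have y: "E f \<in> l2 A"
    by (rule E_l2[OF assms])
  have "R (R (E f)) x = E f x" for x
  proof (rule LIMSEQ_unique)
    show "(\<lambda>n. R (R ((R ^^ (2 * n)) f)) x) \<longlonglongrightarrow> R (R (E f)) x"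
      by (intro R_continuous R_pow_even_tendsto_E assms)
    have "(\<lambda>n. (R ^^ (2 * Suc n)) f x) \<longlonglongrightarrow> E f x"
      by (rule LIMSEQ_Suc[OF R_pow_even_tendsto_E[OF assms]])
    then show "(\<lambda>n. R (R ((R ^^ (2 * n)) f)) x) \<longlonglongrightarrow> E f x"
      by simp
  qed
  then have "(R ^^ (2 * 1)) (E f) = E f"
    by (simp add: fun_eq_iff numeral_2_eq_2)
  then have "complex_of_real (l2_normsq A (R (E f))) = of_real (l2_normsq A (E f))"
    using R_pow_normsq[OF y, of 1] y by (simp add: l2_inner_self)
  then have "l2_normsq A (D (E f)) \<le> 0"
    using R_normsq[OF y] by simp
  then show ?thesis
    using D_l2[OF y] by (rule l2_normsq_eq_0D[rotated])
qed

lemma E_fixes_kernel: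
  assumes "D f = (\<lambda>x. 0)"
  shows "E f = f"
  using assms by (intro E_eqI) (simp add: R_pow_fixes_kernel)

lemma E_E: "f \<in> l2 A \<Longrightarrow> E (E f) = E f"
  by (intro E_fixes_kernel D_E)

lemma E_D:
  assumes "f \<in> l2 A"
  shows "E (D f) = (\<lambda>x. 0)"
proof -
  have "E (D f) = D (E f)"
    by (intro E_eqI) (simp add: R_pow_D assms D_continuous R_pow_even_tendsto_E)
  then show ?thesis
    by (simp add: D_E assms)
qed

lemma E_invariant:
  assumes "f \<in> l2 A" and "\<And>f. T (R f) = R (T f)"
    and "\<And>f g x. (\<And>x. (\<lambda>n. f n x) \<longlonglongrightarrow> g x) \<Longrightarrow> (\<lambda>n. T (f n) x) \<longlonglongrightarrow> T g x"
  shows "E (T f) = T (E f)"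
proof (rule E_eqI)
  have "T ((R ^^ n) f) = (R ^^ n) (T f)" for n
    by (induction n) (auto simp: assms(2))
  then show "(\<lambda>n. (R ^^ (2 * n)) (T f) x) \<longlonglongrightarrow> T (E f) x" for x
    using assms(3)[of "\<lambda>n. (R ^^ (2 * n)) f" "E f"] R_pow_even_tendsto_E[OF assms(1)] by simp
qed

text \<open>Powers of \<open>R\<close> do not lose the component of a point mass along a vector \<open>w\<close> of the kernel:
  \<open>\<parallel>R\<^sup>n \<delta> - w\<parallel>\<^sup>2 \<ge> 0\<close> and \<open>\<langle>R\<^sup>n \<delta>, w\<rangle> = \<langle>\<delta>, w\<rangle>\<close>.\<close>

lemma diagonal_entry_lower_bound:
  assumes "x \<in> A" "w \<in> l2 A" "D w = (\<lambda>x. 0)"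
  shows "2 * Re (w x) - l2_normsq A w \<le> Re ((R ^^ (2 * n)) (point_mass x) x)"
proof -
  have p: "point_mass x \<in> l2 A"
    using assms(1) by simp
  have "l2_inner A ((R ^^ n) (point_mass x)) w = l2_inner A (point_mass x) w"
    using assms p by (simp add: R_pow_adjoint R_pow_fixes_kernel)
  also have "\<dots> = cnj (w x)"
    using assms(1) by (simp add: l2_inner_commute[of A _ w] l2_inner_point_mass)
  finally have "l2_normsq A (\<lambda>y. (R ^^ n) (point_mass x) y - w y) =
    l2_normsq A ((R ^^ n) (point_mass x)) - 2 * Re (w x) + l2_normsq A w"
    using assms p by (simp add: l2_normsq_diff R_pow_l2)
  moreover have "Re ((R ^^ (2 * n)) (point_mass x) x) = l2_normsq A ((R ^^ n) (point_mass x))"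
    using R_pow_normsq[OF p, of n] assms(1) by (simp add: l2_inner_point_mass)
  moreover have "0 \<le> l2_normsq A (\<lambda>y. (R ^^ n) (point_mass x) y - w y)"
    by simp
  ultimately show ?thesis
    by linarith
qed

end

section \<open>Symmetric matrices over the real group ring\<close>

text \<open>Functions on \<open>G \<times> I\<close> are the cochains of a complex on which \<open>G\<close> acts freely with the orbits indexed
  by \<open>I\<close>.  The function \<open>k i j\<close> on \<open>S\<close> is the entry at \<open>(i, j)\<close> of a matrix over the group ring.  The matrix
  equals its conjugate transpose.\<close>

locale symmetric_group_ring_matrix = group G for G (structure) +
  fixes I :: "'i set" and S :: "'a set" and k :: "'i \<Rightarrow> 'i \<Rightarrow> 'a \<Rightarrow> real"
  assumes finite_I [simp]: "finite I" and finite_S [simp]: "finite S"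
    and S_carrier: "S \<subseteq> carrier G" and S_inv: "\<And>g. g \<in> S \<Longrightarrow> inv g \<in> S"
    and k_symmetric: "\<And>i j g. i \<in> I \<Longrightarrow> j \<in> I \<Longrightarrow> g \<in> S \<Longrightarrow> k i j (inv g) = k j i g"
begin

definition cells :: "('a \<times> 'i) set" where
  "cells = carrier G \<times> I"

definition M :: "('a \<times> 'i \<Rightarrow> complex) \<Rightarrow> ('a \<times> 'i \<Rightarrow> complex)" where
  "M f = (\<lambda>(h, i). if h \<in> carrier G \<and> i \<in> I
     then \<Sum>j\<in>I. \<Sum>g\<in>S. of_real (k i j g) * f (h \<otimes> g, j) else 0)"

definition translate :: "'a \<Rightarrow> ('a \<times> 'i \<Rightarrow> complex) \<Rightarrow> ('a \<times> 'i \<Rightarrow> complex)" where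
  "translate a f = (\<lambda>(h, i). if h \<in> carrier G then f (inv a \<otimes> h, i) else 0)"

definition component :: "('a \<times> 'i \<Rightarrow> complex) \<Rightarrow> 'i \<Rightarrow> ('a \<Rightarrow> complex)" where
  "component f i = (\<lambda>h. f (h, i))"

definition right_translate :: "'a \<Rightarrow> ('a \<Rightarrow> complex) \<Rightarrow> ('a \<Rightarrow> complex)" where
  "right_translate g u = (\<lambda>h. if h \<in> carrier G then u (h \<otimes> g) else 0)"

lemma S_closed [simp]: "g \<in> S \<Longrightarrow> g \<in> carrier G"
  using S_carrier by auto

lemma M_lincomb: "M (\<lambda>x. a * f x + b * w x) = (\<lambda>x. a * M f x + b * M w x)"
  by (auto simp: M_def fun_eq_iff sum_distrib_left sum.distrib algebra_simps)

lemma M_continuous: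
  assumes "\<And>x. (\<lambda>n. f n x) \<longlonglongrightarrow> w x"
  shows "(\<lambda>n. M (f n) x) \<longlonglongrightarrow> M w x"
  by (cases x) (auto simp: M_def intro!: tendsto_intros assms)

lemma M_translate:
  assumes "a \<in> carrier G"
  shows "M (translate a f) = translate a (M f)"
  using assms by (auto simp: M_def translate_def fun_eq_iff m_assoc intro!: sum.cong)

lemma bij_betw_right_mult: "g \<in> carrier G \<Longrightarrow> bij_betw (\<lambda>h. h \<otimes> g) (carrier G) (carrier G)"
  by (rule bij_betw_byWitness[of _ "\<lambda>h. h \<otimes> inv g"]) (auto simp: m_assoc)

lemma component_finite_sum_le:
  assumes "f \<in> l2 cells" "i \<in> I" "finite T" "T \<subseteq> carrier G"
  shows "(\<Sum>h\<in>T. (cmod (component f i h))\<^sup>2) \<le> l2_normsq cells f"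
proof -
  have "(\<Sum>h\<in>T. (cmod (component f i h))\<^sup>2) = (\<Sum>x\<in>T \<times> {i}. (cmod (f x))\<^sup>2)"
    by (rule sum.reindex_bij_witness[of _ fst "\<lambda>h. (h, i)"]) (auto simp: component_def)
  also have "\<dots> \<le> l2_normsq cells f"
    using assms by (intro l2_finite_sum_le) (auto simp: cells_def)
  finally show ?thesis .
qed

lemma component_l2:
  assumes "f \<in> l2 cells" "i \<in> I"
  shows "component f i \<in> l2 (carrier G)"
proof (rule l2_of_finite_sums)
  show "component f i h = 0" if "h \<notin> carrier G" for h
    using assms(1) that by (auto simp: component_def cells_def intro: l2_outside)
qed (rule component_finite_sum_le[OF assms])

lemma right_translate_l2:
  assumes "u \<in> l2 (carrier G)" "g \<in> carrier G"
  shows "right_translate g u \<in> l2 (carrier G)"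
proof -
  have "(\<lambda>h. (cmod (u (h \<otimes> g)))\<^sup>2) summable_on carrier G"
    using summable_on_reindex_bij_betw[OF bij_betw_right_mult[OF assms(2)], of "\<lambda>h. (cmod (u h))\<^sup>2"]
      l2_summable[OF assms(1)] by simp
  then show ?thesis
    by (simp add: l2_def right_translate_def cong: summable_on_cong)
qed

lemma right_translate_adjoint:
  assumes "g \<in> carrier G"
  shows "l2_inner (carrier G) (right_translate g u) v = l2_inner (carrier G) u (right_translate (inv g) v)"
  unfolding l2_inner_def
  by (rule infsum_reindex_bij_witness[of _ "\<lambda>h. h \<otimes> inv g" "\<lambda>h. h \<otimes> g"])
    (use assms in \<open>auto simp: right_translate_def m_assoc\<close>)

lemma l2_inner_cells:
  assumes "f \<in> l2 cells" "w \<in> l2 cells"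
  shows "l2_inner cells f w = (\<Sum>i\<in>I. l2_inner (carrier G) (component f i) (component w i))"
proof -
  have "(\<Sum>i\<in>I. infsum (\<lambda>x. f x * cnj (w x)) (carrier G \<times> {i})) =
        infsum (\<lambda>x. f x * cnj (w x)) (\<Union>i\<in>I. carrier G \<times> {i})"
  proof (rule sum_infsum)
    show "(\<lambda>x. f x * cnj (w x)) summable_on carrier G \<times> {i}" if "i \<in> I" for i
      by (rule summable_on_subset_banach[OF l2_inner_summable[OF assms]]) (use that in \<open>auto simp: cells_def\<close>)
  qed auto
  moreover have "infsum (\<lambda>x. f x * cnj (w x)) (carrier G \<times> {i}) =
      l2_inner (carrier G) (component f i) (component w i)" for i
    unfolding l2_inner_def component_def
    by (rule infsum_reindex_bij_witness[of _ "\<lambda>h. (h, i)" fst]) auto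
  moreover have "(\<Union>i\<in>I. carrier G \<times> {i}) = cells"
    by (auto simp: cells_def)
  ultimately show ?thesis
    by (simp add: l2_inner_def)
qed

lemma component_M:
  assumes "i \<in> I"
  shows "component (M f) i =
    (\<lambda>h. \<Sum>j\<in>I. \<Sum>g\<in>S. of_real (k i j g) * right_translate g (component f j) h)"
  using assms by (auto simp: component_def M_def right_translate_def fun_eq_iff)

text \<open>The summand 1 only makes the bound positive, so that \<open>M\<close> can be scaled to a contraction.\<close>

definition M_bound :: real where
  "M_bound = 1 + (\<Sum>i\<in>I. \<Sum>j\<in>I. \<Sum>g\<in>S. (k i j g)\<^sup>2) * (card I * card I * card S)"

lemma M_bound_pos: "M_bound > 0"
  unfolding M_bound_def by (intro add_pos_nonneg mult_nonneg_nonneg sum_nonneg) auto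

text \<open>By the Cauchy-Schwarz inequality the square of a value of \<open>M f\<close> is bounded by a multiple of the sum of
  the squares of finitely many values of \<open>f\<close>, and each translate of \<open>f\<close> has the norm of \<open>f\<close>.\<close>

lemma M_finite_sum_le:
  assumes f: "f \<in> l2 cells" and T: "finite T" "T \<subseteq> cells"
  shows "(\<Sum>x\<in>T. (cmod (M f x))\<^sup>2) \<le> M_bound * l2_normsq cells f"
proof -
  define K where "K = (\<Sum>i\<in>I. \<Sum>j\<in>I. \<Sum>g\<in>S. (k i j g)\<^sup>2)"
  have pointwise: "(cmod (M f (h, i)))\<^sup>2 \<le> K * (\<Sum>(j, g)\<in>I \<times> S. (cmod (f (h \<otimes> g, j)))\<^sup>2)"
    if "h \<in> carrier G" "i \<in> I" for h i
  proof -
    have "cmod (M f (h, i)) \<le> (\<Sum>(j, g)\<in>I \<times> S. \<bar>k i j g\<bar> * cmod (f (h \<otimes> g, j)))"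
      using that unfolding M_def
      by (simp add: sum.cartesian_product)
        (rule order_trans[OF norm_sum], simp add: norm_mult split_beta)
    then have "(cmod (M f (h, i)))\<^sup>2 \<le> (\<Sum>(j, g)\<in>I \<times> S. \<bar>k i j g\<bar> * cmod (f (h \<otimes> g, j)))\<^sup>2"
      by (intro power_mono) auto
    also have "\<dots> \<le> (\<Sum>(j, g)\<in>I \<times> S. \<bar>k i j g\<bar>\<^sup>2) * (\<Sum>(j, g)\<in>I \<times> S. (cmod (f (h \<otimes> g, j)))\<^sup>2)"
      unfolding split_beta by (rule Cauchy_Schwarz_ineq_sum)
    also have "(\<Sum>(j, g)\<in>I \<times> S. \<bar>k i j g\<bar>\<^sup>2) \<le> K"
    proof -
      have "(\<Sum>(j, g)\<in>I \<times> S. \<bar>k i j g\<bar>\<^sup>2) = (\<Sum>i\<in>{i}. \<Sum>j\<in>I. \<Sum>g\<in>S. (k i j g)\<^sup>2)"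
        unfolding sum.cartesian_product[symmetric] by simp
      also have "\<dots> \<le> K"
        unfolding K_def using that by (intro sum_mono2) (auto intro!: sum_nonneg)
      finally show ?thesis .
    qed
    finally show ?thesis
      by (simp add: mult_right_mono sum_nonneg split_beta)
  qed
  have translate_bound: "(\<Sum>(h, i)\<in>T. (cmod (f (h \<otimes> g, j)))\<^sup>2) \<le> card I * l2_normsq cells f"
    if "j \<in> I" "g \<in> S" for j g
  proof -
    have "(\<Sum>(h, i)\<in>T. (cmod (f (h \<otimes> g, j)))\<^sup>2) \<le> (\<Sum>(h, i)\<in>fst ` T \<times> I. (cmod (f (h \<otimes> g, j)))\<^sup>2)"
      using T by (intro sum_mono2) (force simp: cells_def)+
    also have "\<dots> = card I * (\<Sum>h\<in>fst ` T. (cmod (f (h \<otimes> g, j)))\<^sup>2)"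
      by (simp add: sum.cartesian_product[symmetric] sum_distrib_left)
    also have "(\<Sum>h\<in>fst ` T. (cmod (f (h \<otimes> g, j)))\<^sup>2) = (\<Sum>x\<in>(\<lambda>h. (h \<otimes> g, j)) ` fst ` T. (cmod (f x))\<^sup>2)"
    proof -
      have "fst ` T \<subseteq> carrier G"
        using T(2) by (auto simp: cells_def)
      then have "inj_on (\<lambda>h. (h \<otimes> g, j)) (fst ` T)"
        using that(2) by (intro inj_onI) (auto simp: subset_iff)
      then show ?thesis
        by (rule sum.reindex_cong[symmetric]) auto
    qed
    also have "\<dots> \<le> l2_normsq cells f"
      using T that by (intro l2_finite_sum_le f) (auto simp: cells_def)
    finally show ?thesis
      by (simp add: mult_left_mono)
  qed
  have K: "0 \<le> K"
    unfolding K_def by (intro sum_nonneg) auto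
  have "(\<Sum>x\<in>T. (cmod (M f x))\<^sup>2) \<le> (\<Sum>(h, i)\<in>T. K * (\<Sum>(j, g)\<in>I \<times> S. (cmod (f (h \<otimes> g, j)))\<^sup>2))"
    using T(2) pointwise by (intro sum_mono) (auto simp: cells_def)
  also have "\<dots> = K * (\<Sum>(j, g)\<in>I \<times> S. \<Sum>(h, i)\<in>T. (cmod (f (h \<otimes> g, j)))\<^sup>2)"
    unfolding split_beta sum_distrib_left[symmetric] by (subst sum.swap) simp
  also have "\<dots> \<le> K * (\<Sum>(j, g)\<in>I \<times> S. card I * l2_normsq cells f)"
    using K translate_bound by (intro mult_left_mono sum_mono) auto
  also have "\<dots> = (K * (card I * card I * card S)) * l2_normsq cells f"
    by simp
  also have "\<dots> \<le> M_bound * l2_normsq cells f"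
    by (intro mult_right_mono) (auto simp: M_bound_def K_def)
  finally show ?thesis .
qed

lemma
  assumes "f \<in> l2 cells"
  shows M_l2: "M f \<in> l2 cells" and M_normsq: "l2_normsq cells (M f) \<le> M_bound * l2_normsq cells f"
proof -
  have "M f x = 0" if "x \<notin> cells" for x
    using that by (cases x) (auto simp: M_def cells_def)
  then show "M f \<in> l2 cells" "l2_normsq cells (M f) \<le> M_bound * l2_normsq cells f"
    using l2_of_finite_sums l2_normsq_le_of_finite_sums M_finite_sum_le[OF assms] by blast+
qed

lemma M_adjoint:
  assumes f: "f \<in> l2 cells" and w: "w \<in> l2 cells"
  shows "l2_inner cells (M f) w = l2_inner cells f (M w)"
proof -
  have expand: "l2_inner cells (M f) w = (\<Sum>i\<in>I. \<Sum>j\<in>I. \<Sum>g\<in>S. of_real (k i j g) *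
      l2_inner (carrier G) (right_translate g (component f j)) (component w i))"
    if "f \<in> l2 cells" "w \<in> l2 cells" for f w
  proof -
    have "l2_inner (carrier G) (component (M f) i) (component w i) =
        (\<Sum>j\<in>I. \<Sum>g\<in>S. of_real (k i j g) *
          l2_inner (carrier G) (right_translate g (component f j)) (component w i))" if "i \<in> I" for i
      using that \<open>f \<in> l2 cells\<close> \<open>w \<in> l2 cells\<close>
      by (simp add: component_M l2_inner_sum_left l2_sum l2_scale right_translate_l2 component_l2
          l2_inner_scale_left)
    then show ?thesis
      using that by (simp add: l2_inner_cells M_l2)
  qed
  have "l2_inner cells f (M w) = cnj (l2_inner cells (M w) f)"
    by (rule l2_inner_commute)
  also have "\<dots> = (\<Sum>i\<in>I. \<Sum>j\<in>I. \<Sum>g\<in>S. of_real (k i j g) *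
      l2_inner (carrier G) (component f i) (right_translate g (component w j)))"
    by (simp add: expand w f l2_inner_commute[of "carrier G" "component f _"])
  also have "\<dots> = (\<Sum>i\<in>I. \<Sum>j\<in>I. \<Sum>g\<in>S. of_real (k i j (inv g)) *
      l2_inner (carrier G) (component f i) (right_translate (inv g) (component w j)))"
    by (intro sum.cong refl sum.reindex_bij_witness[of S "m_inv G" "m_inv G"]) (auto simp: S_inv)
  also have "\<dots> = (\<Sum>i\<in>I. \<Sum>j\<in>I. \<Sum>g\<in>S. of_real (k j i g) *
      l2_inner (carrier G) (right_translate g (component f i)) (component w j))"
    by (intro sum.cong refl) (simp add: k_symmetric right_translate_adjoint)
  also have "\<dots> = l2_inner cells (M f) w"
    unfolding expand[OF f w] by (rule sum.swap)
  finally show ?thesis ..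
qed

definition D :: "('a \<times> 'i \<Rightarrow> complex) \<Rightarrow> ('a \<times> 'i \<Rightarrow> complex)" where
  "D f = (\<lambda>x. of_real (1 / sqrt M_bound) * M f x)"

lemma D_eq_0_iff: "D f = (\<lambda>x. 0) \<longleftrightarrow> M f = (\<lambda>x. 0)"
  using M_bound_pos by (simp add: D_def fun_eq_iff)

sublocale selfadjoint_contraction cells D
proof
  fix a b :: complex and f w :: "'a \<times> 'i \<Rightarrow> complex"
  show "D (\<lambda>x. a * f x + b * w x) = (\<lambda>x. a * D f x + b * D w x)"
    by (simp add: D_def M_lincomb algebra_simps)
next
  fix f :: "'a \<times> 'i \<Rightarrow> complex" assume f: "f \<in> l2 cells"
  then show D: "D f \<in> l2 cells"
    unfolding D_def by (intro l2_scale M_l2)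
  have "l2_normsq cells (D f) = (\<Sum>\<^sub>\<infinity>x\<in>cells. (1 / M_bound) * (cmod (M f x))\<^sup>2)"
    unfolding l2_normsq_def D_def using M_bound_pos
    by (simp add: norm_divide power_divide)
  also have "\<dots> = (1 / M_bound) * l2_normsq cells (M f)"
    unfolding l2_normsq_def by (rule infsum_cmult_right')
  also have "\<dots> \<le> (1 / M_bound) * (M_bound * l2_normsq cells f)"
    using M_bound_pos by (intro mult_left_mono M_normsq f) auto
  finally show "l2_normsq cells (D f) \<le> l2_normsq cells f"
    using M_bound_pos by simp
next
  fix f w :: "'a \<times> 'i \<Rightarrow> complex" assume "f \<in> l2 cells" "w \<in> l2 cells"
  then show "l2_inner cells (D f) w = l2_inner cells f (D w)"
    unfolding D_def l2_inner_commute[of cells f "\<lambda>x. of_real (1 / sqrt M_bound) * M w x"] l2_inner_scale_left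
    by (simp add: M_adjoint l2_inner_commute[of cells f])
next
  fix f :: "nat \<Rightarrow> 'a \<times> 'i \<Rightarrow> complex" and w x
  assume "\<And>x. (\<lambda>n. f n x) \<longlonglongrightarrow> w x"
  then show "(\<lambda>n. D (f n) x) \<longlonglongrightarrow> D w x"
    unfolding D_def by (intro tendsto_intros M_continuous)
qed

lemma D_translate: "a \<in> carrier G \<Longrightarrow> D (translate a f) = translate a (D f)"
  by (simp add: D_def M_translate) (auto simp: translate_def fun_eq_iff)

lemma R_translate: "a \<in> carrier G \<Longrightarrow> R (translate a f) = translate a (R f)"
  by (simp add: R_def D_translate) (auto simp: translate_def fun_eq_iff)

lemma R_pow_translate: "a \<in> carrier G \<Longrightarrow> (R ^^ n) (translate a f) = translate a ((R ^^ n) f)"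
  by (induction n) (auto simp: R_translate)

lemma E_translate:
  assumes "a \<in> carrier G" "f \<in> l2 cells"
  shows "E (translate a f) = translate a (E f)"
proof (rule E_invariant[OF assms(2)])
  show "translate a (R f) = R (translate a f)" for f
    using assms(1) by (simp add: R_translate)
  show "(\<lambda>n. translate a (f n) x) \<longlonglongrightarrow> translate a w x" if "\<And>x. (\<lambda>n. f n x) \<longlonglongrightarrow> w x" for f w x
    using that by (cases x) (auto simp: translate_def)
qed

abbreviation e :: "'i \<Rightarrow> 'a \<times> 'i \<Rightarrow> complex" where
  "e i \<equiv> point_mass (\<one>, i)"

lemma e_l2 [simp]: "i \<in> I \<Longrightarrow> e i \<in> l2 cells"
  by (simp add: cells_def)

text \<open>For a self-adjoint operator that commutes with translations, the coefficient from \<open>(1, j)\<close> to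
  \<open>(h, i)\<close> is conjugate to the one from \<open>(h, i)\<close> to \<open>(1, j)\<close>, which is moved to start at \<open>(1, i)\<close> by
  translation with \<open>h\<^sup>-\<^sup>1\<close>.\<close>

lemma matrix_coefficient_symmetric:
  assumes B_l2: "\<And>f. f \<in> l2 cells \<Longrightarrow> B f \<in> l2 cells"
    and B_adjoint: "\<And>f w. f \<in> l2 cells \<Longrightarrow> w \<in> l2 cells \<Longrightarrow> l2_inner cells (B f) w = l2_inner cells f (B w)"
    and B_translate: "\<And>a f. a \<in> carrier G \<Longrightarrow> B (translate a f) = translate a (B f)"
    and "i \<in> I" "j \<in> I" "h \<in> carrier G"
  shows "B (e j) (h, i) = cnj (B (e i) (inv h, j))"
proof -
  have "inv h \<otimes> y = \<one> \<longleftrightarrow> y = h" if "y \<in> carrier G" for y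
    using that assms(6) inv_solve_left[of \<one> h y] by auto
  then have shift: "point_mass (h, i) = translate h (e i)"
    using assms(6) by (auto simp: point_mass_def translate_def fun_eq_iff)
  have "B (e j) (h, i) = l2_inner cells (B (e j)) (point_mass (h, i))"
    using assms(4,6) by (simp add: l2_inner_point_mass cells_def)
  also have "\<dots> = l2_inner cells (e j) (B (point_mass (h, i)))"
    using assms(4,5,6) by (intro B_adjoint) (auto simp: cells_def)
  also have "\<dots> = cnj (l2_inner cells (B (point_mass (h, i))) (e j))"
    by (rule l2_inner_commute)
  also have "\<dots> = cnj (B (point_mass (h, i)) (\<one>, j))"
    using assms(5) by (simp add: l2_inner_point_mass cells_def)
  also have "B (point_mass (h, i)) (\<one>, j) = B (e i) (inv h, j)"
    using assms(6) by (simp add: shift B_translate) (simp add: translate_def)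
  finally show ?thesis .
qed

end

section \<open>Matrices that exchange two kinds of cells\<close>

text \<open>The parity is meant to be that of the dimension of a cell; the model is the sum of the coboundary
  operator and its adjoint.\<close>

locale odd_group_ring_matrix = symmetric_group_ring_matrix G I S k
  for G (structure) and I :: "'i set" and S :: "'a set" and k :: "'i \<Rightarrow> 'i \<Rightarrow> 'a \<Rightarrow> real" +
  fixes parity :: "'i \<Rightarrow> bool"
  assumes k_odd: "\<And>i j g. parity i = parity j \<Longrightarrow> k i j g = 0"
begin

definition supported :: "bool \<Rightarrow> ('a \<times> 'i \<Rightarrow> complex) \<Rightarrow> bool" where
  "supported p f \<longleftrightarrow> (\<forall>h i. parity i \<noteq> p \<longrightarrow> f (h, i) = 0)"

lemma M_supported: "supported p f \<Longrightarrow> supported (\<not> p) (M f)"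
  unfolding supported_def
proof (intro allI impI)
  fix h i assume f: "\<forall>h i. parity i \<noteq> p \<longrightarrow> f (h, i) = 0" and i: "parity i \<noteq> (\<not> p)"
  have "of_real (k i j g) * f (h \<otimes> g, j) = 0" for j g
    using f i k_odd[of i j g] by (cases "parity j = p") auto
  then show "M f (h, i) = 0"
    by (simp only: M_def prod.case sum.neutral_const if_cancel)
qed

lemma D_supported: "supported p f \<Longrightarrow> supported (\<not> p) (D f)"
  using M_supported by (auto simp: supported_def D_def)

lemma R_supported: "supported p f \<Longrightarrow> supported p (R f)"
  using D_supported[OF D_supported[of p f]] by (auto simp: supported_def R_def)

lemma R_pow_supported: "supported p f \<Longrightarrow> supported p ((R ^^ n) f)"
  by (induction n) (auto intro: R_supported)

lemma E_supported:
  assumes "supported p f" "f \<in> l2 cells"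
  shows "supported p (E f)"
  unfolding supported_def
proof (intro allI impI)
  fix h i assume "parity i \<noteq> p"
  then have "(\<lambda>n. (R ^^ (2 * n)) f (h, i)) = (\<lambda>n. 0)"
    using R_pow_supported[OF assms(1)] by (auto simp: supported_def)
  then show "E f (h, i) = 0"
    using R_pow_even_tendsto_E[OF assms(2), of "(h, i)"] by (simp add: LIMSEQ_const_iff)
qed

lemma e_supported: "supported (parity i) (e i)"
  by (auto simp: supported_def point_mass_def)

text \<open>This is \<open>tr (A B) = tr (B A)\<close>, where the first trace is taken over the odd and the second over the
  even cells: both sides are the sum of the same products of a coefficient of \<open>A\<close> and a
  coefficient of \<open>B\<close> between an odd and an even cell, rearranged by \<open>h \<mapsto> h\<^sup>-\<^sup>1\<close>.\<close>

lemma trace_commute: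
  assumes A_l2: "\<And>f. f \<in> l2 cells \<Longrightarrow> A f \<in> l2 cells"
    and A_adjoint: "\<And>f w. f \<in> l2 cells \<Longrightarrow> w \<in> l2 cells \<Longrightarrow> l2_inner cells (A f) w = l2_inner cells f (A w)"
    and A_translate: "\<And>a f. a \<in> carrier G \<Longrightarrow> A (translate a f) = translate a (A f)"
    and A_supported: "\<And>p f. supported p f \<Longrightarrow> supported (\<not> p) (A f)"
    and B_l2: "\<And>f. f \<in> l2 cells \<Longrightarrow> B f \<in> l2 cells"
    and B_adjoint: "\<And>f w. f \<in> l2 cells \<Longrightarrow> w \<in> l2 cells \<Longrightarrow> l2_inner cells (B f) w = l2_inner cells f (B w)"
    and B_translate: "\<And>a f. a \<in> carrier G \<Longrightarrow> B (translate a f) = translate a (B f)"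
  shows "(\<Sum>j\<in>{j \<in> I. parity j}. l2_inner cells (A (e j)) (B (e j))) =
         (\<Sum>i\<in>{i \<in> I. \<not> parity i}. l2_inner cells (B (e i)) (A (e i)))"
proof -
  define t where "t A B j i = l2_inner (carrier G) (component (A (e j)) i) (component (B (e j)) i)" for A B j i
  have t: "t A B j i = t B A i j" if ij: "i \<in> I" "j \<in> I" for i j
  proof -
    have "A (e j) (h, i) * cnj (B (e j) (h, i)) = B (e i) (inv h, j) * cnj (A (e i) (inv h, j))"
      if h: "h \<in> carrier G" for h
    proof -
      have A: "A (e j) (h, i) = cnj (A (e i) (inv h, j))"
        by (rule matrix_coefficient_symmetric[OF A_l2 A_adjoint A_translate ij h])
      have B: "B (e j) (h, i) = cnj (B (e i) (inv h, j))"
        by (rule matrix_coefficient_symmetric[OF B_l2 B_adjoint B_translate ij h])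
      show ?thesis
        unfolding A B by simp
    qed
    then show ?thesis
      unfolding t_def l2_inner_def component_def
      by (intro infsum_reindex_bij_witness[of _ "m_inv G" "m_inv G"]) auto
  qed
  have vanish: "t A B j i = 0" "t B A j i = 0" if "parity i = parity j" for i j
    using A_supported[OF e_supported[of j]] that
    by (auto simp: t_def l2_inner_def component_def supported_def)
  have "(\<Sum>j\<in>{j \<in> I. parity j}. l2_inner cells (A (e j)) (B (e j))) = (\<Sum>j\<in>{j \<in> I. parity j}. \<Sum>i\<in>I. t A B j i)"
    by (intro sum.cong refl) (simp add: l2_inner_cells A_l2 B_l2 t_def)
  also have "\<dots> = (\<Sum>j\<in>{j \<in> I. parity j}. \<Sum>i\<in>{i \<in> I. \<not> parity i}. t A B j i)"
    by (intro sum.cong refl sum.mono_neutral_right) (auto simp: vanish)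
  also have "\<dots> = (\<Sum>j\<in>{j \<in> I. parity j}. \<Sum>i\<in>{i \<in> I. \<not> parity i}. t B A i j)"
    by (intro sum.cong refl t) auto
  also have "\<dots> = (\<Sum>i\<in>{i \<in> I. \<not> parity i}. \<Sum>j\<in>{j \<in> I. parity j}. t B A i j)"
    by (rule sum.swap)
  also have "\<dots> = (\<Sum>i\<in>{i \<in> I. \<not> parity i}. \<Sum>j\<in>I. t B A i j)"
    by (intro sum.cong refl sum.mono_neutral_left) (auto simp: vanish)
  also have "\<dots> = (\<Sum>i\<in>{i \<in> I. \<not> parity i}. l2_inner cells (B (e i)) (A (e i)))"
    by (intro sum.cong refl) (simp add: l2_inner_cells A_l2 B_l2 t_def)
  finally show ?thesis .
qed

text \<open>The McKean-Singer argument.  Passing from \<open>R\<^sup>n\<close> to \<open>R\<^sup>n\<^sup>+\<^sup>1\<close> subtracts the trace of \<open>R\<^sup>n D D\<close>, and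
  with \<open>A = D\<close> and \<open>B = R\<^sup>n D\<close> the trace property shows that the same amount is subtracted over the
  odd and over the even cells.  So the difference of the traces stays what it is for \<open>n = 0\<close>, an
  Euler characteristic.\<close>

lemma supertrace_R_pow:
  "(\<Sum>j\<in>{j \<in> I. parity j}. (R ^^ n) (e j) (\<one>, j)) - (\<Sum>i\<in>{i \<in> I. \<not> parity i}. (R ^^ n) (e i) (\<one>, i)) =
   of_nat (card {j \<in> I. parity j}) - of_nat (card {i \<in> I. \<not> parity i})"
proof (induction n)
  case 0
  then show ?case
    by (simp add: point_mass_def)
next
  case (Suc n)
  define B where "B f = (R ^^ n) (D f)" for f
  have B_l2: "B f \<in> l2 cells" if "f \<in> l2 cells" for f
    using that by (simp add: B_def R_pow_l2 D_l2)
  have B_adjoint: "l2_inner cells (B f) w = l2_inner cells f (B w)" if "f \<in> l2 cells" "w \<in> l2 cells" for f w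
    using that by (simp add: B_def R_pow_adjoint D_l2 R_pow_l2 D_adjoint R_pow_D)
  have B_translate: "B (translate a f) = translate a (B f)" if "a \<in> carrier G" for a f
    using that by (simp add: B_def D_translate R_pow_translate)
  have step: "(R ^^ Suc n) (e i) (\<one>, i) = (R ^^ n) (e i) (\<one>, i) - l2_inner cells (D (e i)) (B (e i))"
    and step': "l2_inner cells (B (e i)) (D (e i)) = l2_inner cells (D (e i)) (B (e i))" if "i \<in> I" for i
  proof -
    have ei: "e i \<in> l2 cells"
      using that by simp
    have "(R ^^ Suc n) (e i) = (R ^^ n) (\<lambda>x. 1 * e i x + (-1) * D (D (e i)) x)"
      unfolding funpow_Suc_right o_apply by (simp add: R_def)
    also have "\<dots> = (\<lambda>x. (R ^^ n) (e i) x - B (D (e i)) x)"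
      unfolding R_pow_lincomb by (simp add: B_def)
    finally have R: "(R ^^ Suc n) (e i) (\<one>, i) = (R ^^ n) (e i) (\<one>, i) - B (D (e i)) (\<one>, i)"
      by (simp only:)
    have "B (D (e i)) (\<one>, i) = l2_inner cells (B (D (e i))) (e i)"
      using that by (simp add: l2_inner_point_mass cells_def)
    also have "\<dots> = l2_inner cells (D (e i)) (B (e i))"
      using ei by (intro B_adjoint D_l2)
    finally show "(R ^^ Suc n) (e i) (\<one>, i) = (R ^^ n) (e i) (\<one>, i) - l2_inner cells (D (e i)) (B (e i))"
      using R by (simp only:)
    show "l2_inner cells (B (e i)) (D (e i)) = l2_inner cells (D (e i)) (B (e i))"
      unfolding B_def using ei by (intro R_pow_adjoint D_l2)
  qed
  have "(\<Sum>j\<in>{j \<in> I. parity j}. l2_inner cells (D (e j)) (B (e j))) =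
        (\<Sum>i\<in>{i \<in> I. \<not> parity i}. l2_inner cells (B (e i)) (D (e i)))"
    by (rule trace_commute)
      (simp_all add: D_l2 D_adjoint D_translate D_supported B_l2 B_adjoint B_translate)
  also have "\<dots> = (\<Sum>i\<in>{i \<in> I. \<not> parity i}. l2_inner cells (D (e i)) (B (e i)))"
    by (intro sum.cong refl step') auto
  finally show ?case
    using Suc.IH by (simp add: step sum_subtractf del: funpow.simps)
qed

text \<open>The number \<open>b i\<close> is a lower bound for the contribution of the even cell \<open>i\<close> to the trace of all
  even powers of \<open>R\<close>.  The Euler characteristic then bounds the contribution of the odd cells from
  below, and this survives the limit \<open>R\<^sup>2\<^sup>n \<rightarrow> E\<close>.\<close>

lemma harmonic_trace_lower_bound:
  fixes b :: "'i \<Rightarrow> real"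
  assumes "\<And>i n. i \<in> I \<Longrightarrow> \<not> parity i \<Longrightarrow> b i \<le> Re ((R ^^ (2 * n)) (e i) (\<one>, i))"
  shows "real (card {j \<in> I. parity j}) - (\<Sum>i\<in>{i \<in> I. \<not> parity i}. 1 - b i) \<le>
         Re (\<Sum>j\<in>{j \<in> I. parity j}. E (e j) (\<one>, j))"
proof (rule LIMSEQ_le_const)
  show "(\<lambda>n. Re (\<Sum>j\<in>{j \<in> I. parity j}. (R ^^ (2 * n)) (e j) (\<one>, j))) \<longlonglongrightarrow>
      Re (\<Sum>j\<in>{j \<in> I. parity j}. E (e j) (\<one>, j))"
    by (intro tendsto_Re tendsto_sum R_pow_even_tendsto_E) auto
  have "real (card {j \<in> I. parity j}) - (\<Sum>i\<in>{i \<in> I. \<not> parity i}. 1 - b i) \<le>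
      Re (\<Sum>j\<in>{j \<in> I. parity j}. (R ^^ (2 * n)) (e j) (\<one>, j))" for n
  proof -
    have "(\<Sum>i\<in>{i \<in> I. \<not> parity i}. b i) \<le> (\<Sum>i\<in>{i \<in> I. \<not> parity i}. Re ((R ^^ (2 * n)) (e i) (\<one>, i)))"
      by (intro sum_mono assms) auto
    then show ?thesis
      using arg_cong[OF supertrace_R_pow[of "2 * n"], of Re] by (simp add: sum_subtractf)
  qed
  then show "\<exists>N. \<forall>n\<ge>N. real (card {j \<in> I. parity j}) - (\<Sum>i\<in>{i \<in> I. \<not> parity i}. 1 - b i) \<le>
      Re (\<Sum>j\<in>{j \<in> I. parity j}. (R ^^ (2 * n)) (e j) (\<one>, j))"
    by blast
qed

end

section \<open>Embedding the image of an idempotent matrix into homology\<close>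

context ring
begin

lemma finsum_swap:
  assumes "finite I" "finite J" "\<And>i j. i \<in> I \<Longrightarrow> j \<in> J \<Longrightarrow> f i j \<in> carrier R"
  shows "(\<Oplus>i\<in>I. \<Oplus>j\<in>J. f i j) = (\<Oplus>j\<in>J. \<Oplus>i\<in>I. f i j)"
  using assms(1,3)
proof (induction I)
  case empty
  then show ?case
    by (simp add: finsum_zero)
next
  case (insert a I)
  have IH: "(\<Oplus>i\<in>I. \<Oplus>j\<in>J. f i j) = (\<Oplus>j\<in>J. \<Oplus>i\<in>I. f i j)"
    using insert by auto
  have "(\<Oplus>i\<in>insert a I. \<Oplus>j\<in>J. f i j) = (\<Oplus>j\<in>J. f a j) \<oplus> (\<Oplus>j\<in>J. \<Oplus>i\<in>I. f i j)"
    unfolding IH[symmetric] using insert by (intro finsum_insert) auto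
  also have "\<dots> = (\<Oplus>j\<in>J. f a j \<oplus> (\<Oplus>i\<in>I. f i j))"
    using insert by (intro finsum_addf[symmetric]) auto
  also have "\<dots> = (\<Oplus>j\<in>J. \<Oplus>i\<in>insert a I. f i j)"
    using insert by (intro finsum_cong' finsum_insert[symmetric]) auto
  finally show ?case .
qed

abbreviation Fr :: "nat \<Rightarrow> ('a, nat \<Rightarrow> 'a) module" where
  "Fr n \<equiv> free_module R n"

lemma free_module_mem: "v \<in> carrier (Fr n) \<longleftrightarrow> (\<forall>i<n. v i \<in> carrier R) \<and> v \<in> extensional {..<n}"
  by (auto simp: free_module_def PiE_def)

lemma free_module_entry: "v \<in> carrier (Fr n) \<Longrightarrow> i < n \<Longrightarrow> v i \<in> carrier R"
  by (simp add: free_module_mem)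

lemma free_module_eqI:
  assumes "v \<in> carrier (Fr n)" "w \<in> carrier (Fr n)" "\<And>i. i < n \<Longrightarrow> v i = w i"
  shows "v = w"
  using assms by (intro extensionalityI[of v "{..<n}" w]) (auto simp: free_module_mem)

lemma free_module_simps:
  "\<zero>\<^bsub>Fr n\<^esub> = (\<lambda>i\<in>{..<n}. \<zero>)"
  "v \<oplus>\<^bsub>Fr n\<^esub> w = (\<lambda>i\<in>{..<n}. v i \<oplus> w i)"
  "a \<odot>\<^bsub>Fr n\<^esub> v = (\<lambda>i\<in>{..<n}. a \<otimes> v i)"
  by (simp_all add: free_module_def)

lemma free_module_closed:
  "\<zero>\<^bsub>Fr n\<^esub> \<in> carrier (Fr n)"
  "v \<in> carrier (Fr n) \<Longrightarrow> w \<in> carrier (Fr n) \<Longrightarrow> v \<oplus>\<^bsub>Fr n\<^esub> w \<in> carrier (Fr n)"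
  "a \<in> carrier R \<Longrightarrow> v \<in> carrier (Fr n) \<Longrightarrow> a \<odot>\<^bsub>Fr n\<^esub> v \<in> carrier (Fr n)"
  by (auto simp: free_module_mem free_module_simps)

lemma abelian_group_free_module: "abelian_group (Fr n)"
proof (rule abelian_groupI)
  fix x y z assume "x \<in> carrier (Fr n)" "y \<in> carrier (Fr n)" "z \<in> carrier (Fr n)"
  then show "x \<oplus>\<^bsub>Fr n\<^esub> y \<oplus>\<^bsub>Fr n\<^esub> z = x \<oplus>\<^bsub>Fr n\<^esub> (y \<oplus>\<^bsub>Fr n\<^esub> z)"
    by (intro free_module_eqI[where n = n]) (auto simp: free_module_simps free_module_mem a_assoc)
next
  fix x y assume "x \<in> carrier (Fr n)" "y \<in> carrier (Fr n)"
  then show "x \<oplus>\<^bsub>Fr n\<^esub> y = y \<oplus>\<^bsub>Fr n\<^esub> x"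
    by (intro free_module_eqI[where n = n]) (auto simp: free_module_simps free_module_mem a_comm)
next
  fix x assume x: "x \<in> carrier (Fr n)"
  then show "\<zero>\<^bsub>Fr n\<^esub> \<oplus>\<^bsub>Fr n\<^esub> x = x"
    by (intro free_module_eqI[where n = n]) (auto simp: free_module_simps free_module_mem)
  have "(\<lambda>i\<in>{..<n}. \<ominus> x i) \<in> carrier (Fr n)"
    using x by (auto simp: free_module_mem)
  moreover have "(\<lambda>i\<in>{..<n}. \<ominus> x i) \<oplus>\<^bsub>Fr n\<^esub> x = \<zero>\<^bsub>Fr n\<^esub>"
    using x by (auto simp: free_module_simps free_module_entry l_neg intro!: restrict_ext)
  ultimately show "\<exists>y\<in>carrier (Fr n). y \<oplus>\<^bsub>Fr n\<^esub> x = \<zero>\<^bsub>Fr n\<^esub>"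
    by blast
qed (auto intro: free_module_closed)

lemma free_module_minus_one:
  assumes "v \<in> carrier (Fr n)"
  shows "\<ominus>\<^bsub>Fr n\<^esub> v = (\<ominus> \<one>) \<odot>\<^bsub>Fr n\<^esub> v"
proof -
  interpret F: abelian_group "Fr n" by (rule abelian_group_free_module)
  have "(\<ominus> \<one>) \<odot>\<^bsub>Fr n\<^esub> v \<oplus>\<^bsub>Fr n\<^esub> v = \<zero>\<^bsub>Fr n\<^esub>"
    using assms by (auto simp: free_module_simps free_module_entry l_minus l_neg intro!: restrict_ext)
  then show ?thesis
    using assms by (intro F.minus_equality) (auto intro: free_module_closed)
qed

definition matrix_over :: "nat \<Rightarrow> nat \<Rightarrow> (nat \<Rightarrow> nat \<Rightarrow> 'a) \<Rightarrow> bool" where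
  "matrix_over n m B \<longleftrightarrow> (\<forall>i<n. \<forall>j<m. B i j \<in> carrier R)"

lemma matrix_over_entry: "matrix_over n m B \<Longrightarrow> i < n \<Longrightarrow> j < m \<Longrightarrow> B i j \<in> carrier R"
  by (simp add: matrix_over_def)

lemma row_mult_closed:
  assumes "matrix_over n m B" "v \<in> carrier (Fr n)"
  shows "row_mult R n m B v \<in> carrier (Fr m)"
  using assms by (auto simp: free_module_mem row_mult_def matrix_over_def intro!: finsum_closed)

lemma row_mult_add:
  assumes B: "matrix_over n m B" and v: "v \<in> carrier (Fr n)" and w: "w \<in> carrier (Fr n)"
  shows "row_mult R n m B (v \<oplus>\<^bsub>Fr n\<^esub> w) = row_mult R n m B v \<oplus>\<^bsub>Fr m\<^esub> row_mult R n m B w"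
proof (rule free_module_eqI)
  fix j assume j: "j < m"
  have "(\<Oplus>i\<in>{..<n}. (v \<oplus>\<^bsub>Fr n\<^esub> w) i \<otimes> B i j) = (\<Oplus>i\<in>{..<n}. v i \<otimes> B i j \<oplus> w i \<otimes> B i j)"
    using j by (intro finsum_cong')
      (auto simp: free_module_simps l_distr free_module_entry[OF v] free_module_entry[OF w] matrix_over_entry[OF B])
  also have "\<dots> = (\<Oplus>i\<in>{..<n}. v i \<otimes> B i j) \<oplus> (\<Oplus>i\<in>{..<n}. w i \<otimes> B i j)"
    using j by (intro finsum_addf)
      (auto simp: free_module_entry[OF v] free_module_entry[OF w] matrix_over_entry[OF B])
  finally show "row_mult R n m B (v \<oplus>\<^bsub>Fr n\<^esub> w) j = (row_mult R n m B v \<oplus>\<^bsub>Fr m\<^esub> row_mult R n m B w) j"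
    using j by (simp add: row_mult_def free_module_simps)
qed (use assms in \<open>auto intro!: row_mult_closed free_module_closed\<close>)

lemma row_mult_smult:
  assumes B: "matrix_over n m B" and v: "v \<in> carrier (Fr n)" and a: "a \<in> carrier R"
  shows "row_mult R n m B (a \<odot>\<^bsub>Fr n\<^esub> v) = a \<odot>\<^bsub>Fr m\<^esub> row_mult R n m B v"
proof (rule free_module_eqI)
  fix j assume j: "j < m"
  have "(\<Oplus>i\<in>{..<n}. (a \<odot>\<^bsub>Fr n\<^esub> v) i \<otimes> B i j) = (\<Oplus>i\<in>{..<n}. a \<otimes> (v i \<otimes> B i j))"
    using j a by (intro finsum_cong')
      (auto simp: free_module_simps m_assoc free_module_entry[OF v] matrix_over_entry[OF B])
  also have "\<dots> = a \<otimes> (\<Oplus>i\<in>{..<n}. v i \<otimes> B i j)"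
    using j a by (intro finsum_rdistr[symmetric])
      (auto simp: free_module_entry[OF v] matrix_over_entry[OF B])
  finally show "row_mult R n m B (a \<odot>\<^bsub>Fr n\<^esub> v) j = (a \<odot>\<^bsub>Fr m\<^esub> row_mult R n m B v) j"
    using j by (simp add: row_mult_def free_module_simps)
qed (use assms in \<open>auto intro!: row_mult_closed free_module_closed\<close>)

lemma row_mult_assoc:
  assumes B: "matrix_over n m B" and C: "matrix_over m l C" and v: "v \<in> carrier (Fr n)"
  shows "row_mult R m l C (row_mult R n m B v) =
         row_mult R n l (\<lambda>i j. \<Oplus>q\<in>{..<m}. B i q \<otimes> C q j) v"
proof (rule free_module_eqI)
  note entries = free_module_entry[OF v] matrix_over_entry[OF B] matrix_over_entry[OF C]
  fix j assume j: "j < l"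
  have "(\<Oplus>q\<in>{..<m}. row_mult R n m B v q \<otimes> C q j) =
        (\<Oplus>q\<in>{..<m}. \<Oplus>i\<in>{..<n}. v i \<otimes> (B i q \<otimes> C q j))"
  proof (rule finsum_cong')
    fix q assume "q \<in> {..<m}"
    then have "(\<Oplus>i\<in>{..<n}. v i \<otimes> B i q) \<otimes> C q j = (\<Oplus>i\<in>{..<n}. v i \<otimes> B i q \<otimes> C q j)"
      using j by (intro finsum_ldistr) (auto simp: entries)
    also have "\<dots> = (\<Oplus>i\<in>{..<n}. v i \<otimes> (B i q \<otimes> C q j))"
      using j \<open>q \<in> {..<m}\<close> by (intro finsum_cong') (auto simp: entries m_assoc)
    finally show "row_mult R n m B v q \<otimes> C q j = (\<Oplus>i\<in>{..<n}. v i \<otimes> (B i q \<otimes> C q j))"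
      using \<open>q \<in> {..<m}\<close> by (simp add: row_mult_def)
  qed (use j in \<open>auto simp: entries intro!: finsum_closed\<close>)
  also have "\<dots> = (\<Oplus>i\<in>{..<n}. \<Oplus>q\<in>{..<m}. v i \<otimes> (B i q \<otimes> C q j))"
    using j by (intro finsum_swap) (auto simp: entries)
  also have "\<dots> = (\<Oplus>i\<in>{..<n}. v i \<otimes> (\<Oplus>q\<in>{..<m}. B i q \<otimes> C q j))"
    using j by (intro finsum_cong' finsum_rdistr[symmetric]) (auto simp: entries)
  finally show "row_mult R m l C (row_mult R n m B v) j =
      row_mult R n l (\<lambda>i j. \<Oplus>q\<in>{..<m}. B i q \<otimes> C q j) v j"
    using j by (simp add: row_mult_def)
qed (use assms in \<open>auto intro!: row_mult_closed finsum_closed simp: matrix_over_def\<close>)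

lemma row_mult_cong:
  assumes "matrix_over n m B" "\<And>i j. i < n \<Longrightarrow> j < m \<Longrightarrow> B i j = C i j" "v \<in> carrier (Fr n)"
  shows "row_mult R n m B v = row_mult R n m C v"
  unfolding row_mult_def using assms
  by (intro restrict_ext finsum_cong') (auto simp: free_module_entry matrix_over_def)

lemma row_mult_zero_matrix:
  assumes "v \<in> carrier (Fr n)"
  shows "row_mult R n m (\<lambda>i j. \<zero>) v = \<zero>\<^bsub>Fr m\<^esub>"
proof -
  have "(\<Oplus>i\<in>{..<n}. v i \<otimes> \<zero>) = \<zero>"
    using assms by (intro add.finprod_one_eqI) (auto simp: free_module_entry)
  then show ?thesis
    by (simp add: row_mult_def free_module_simps)
qed

text \<open>Here \<open>Z\<close>, \<open>N\<close> and \<open>H\<close> are the cycles, the boundaries and the homology of the complex with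
  boundary matrices \<open>D\<^sub>2\<close> and \<open>D\<^sub>1\<close>.  The image of \<open>E\<close> consists of cycles because \<open>E D\<^sub>1 = 0\<close>; a
  boundary \<open>w D\<^sub>2\<close> in the image is fixed by \<open>E\<close>, hence equal to \<open>w D\<^sub>2 E = 0\<close>.  So the image of \<open>E\<close> meets the boundaries trivially.\<close>

lemma idempotent_image_embeds_in_homology:
  fixes d r :: nat and D\<^sub>1 D\<^sub>2 E :: "nat \<Rightarrow> nat \<Rightarrow> 'a"
  defines "Z \<equiv> {v \<in> carrier (Fr d). row_mult R d 1 D\<^sub>1 v = \<zero>\<^bsub>Fr 1\<^esub>}"
    and "N \<equiv> row_mult R r d D\<^sub>2 ` carrier (Fr r)"
  defines "H \<equiv> quotient_module ((Fr d)\<lparr>carrier := Z\<rparr>) N"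
  assumes D\<^sub>1: "matrix_over d 1 D\<^sub>1" and D\<^sub>2: "matrix_over r d D\<^sub>2" and E: "idempotent_matrix R d E"
    and ED\<^sub>1: "\<And>i j. i < d \<Longrightarrow> j < 1 \<Longrightarrow> (\<Oplus>q\<in>{..<d}. E i q \<otimes> D\<^sub>1 q j) = \<zero>"
    and D\<^sub>2E: "\<And>i j. i < r \<Longrightarrow> j < d \<Longrightarrow> (\<Oplus>q\<in>{..<d}. D\<^sub>2 i q \<otimes> E q j) = \<zero>"
  shows "\<exists>P. submodule P R H \<and> module_isomorphic R (H\<lparr>carrier := P\<rparr>) (matrix_image R d E)"
proof -
  interpret F: abelian_group "Fr d" by (rule abelian_group_free_module)
  have E_over: "matrix_over d d E"
    using E by (simp add: idempotent_matrix_def matrix_over_def)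
  define V where "V = row_mult R d d E ` carrier (Fr d)"
  define coset where "coset v = N +>\<^bsub>Fr d\<^esub> v" for v
  have V_carrier: "v \<in> carrier (Fr d)" if "v \<in> V" for v
    using that by (auto simp: V_def intro: row_mult_closed[OF E_over])
  have N_carrier: "v \<in> carrier (Fr d)" if "v \<in> N" for v
    using that by (auto simp: N_def intro: row_mult_closed[OF D\<^sub>2])
  have V_fixed: "row_mult R d d E v = v" if v: "v \<in> V" for v
  proof -
    obtain w where w: "w \<in> carrier (Fr d)" "v = row_mult R d d E w"
      using v by (auto simp: V_def)
    have "row_mult R d d E v = row_mult R d d (\<lambda>i j. \<Oplus>q\<in>{..<d}. E i q \<otimes> E q j) w"
      unfolding w(2) by (rule row_mult_assoc[OF E_over E_over w(1)])
    also have "\<dots> = row_mult R d d E w"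
      using E by (intro row_mult_cong[symmetric] E_over w(1)) (simp add: idempotent_matrix_def)
    finally show ?thesis
      by (simp add: w(2))
  qed
  have V_cycles: "v \<in> Z" if "v \<in> V" for v
  proof -
    have "row_mult R d 1 D\<^sub>1 (row_mult R d d E v) = row_mult R d 1 (\<lambda>i j. \<Oplus>q\<in>{..<d}. E i q \<otimes> D\<^sub>1 q j) v"
      by (rule row_mult_assoc[OF E_over D\<^sub>1 V_carrier[OF that]])
    also have "\<dots> = row_mult R d 1 (\<lambda>i j. \<zero>) v"
      using ED\<^sub>1 V_carrier[OF that] by (intro row_mult_cong[symmetric]) (auto simp: matrix_over_def)
    finally show ?thesis
      using V_fixed[OF that] V_carrier[OF that] by (simp add: Z_def row_mult_zero_matrix)
  qed
  have V_I: "v \<in> V" if "v \<in> carrier (Fr d)" "row_mult R d d E v = v" for v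
    unfolding V_def using that by (metis image_eqI)
  have V_add: "v \<oplus>\<^bsub>Fr d\<^esub> w \<in> V" if "v \<in> V" "w \<in> V" for v w
    using that by (intro V_I) (simp_all add: row_mult_add[OF E_over] V_carrier V_fixed free_module_closed)
  have V_smult: "a \<odot>\<^bsub>Fr d\<^esub> v \<in> V" if "a \<in> carrier R" "v \<in> V" for a v
    using that by (intro V_I) (simp_all add: row_mult_smult[OF E_over] V_carrier V_fixed free_module_closed)
  have V_minus: "\<ominus>\<^bsub>Fr d\<^esub> v \<in> V" if "v \<in> V" for v
    using that by (simp add: free_module_minus_one V_carrier V_smult)
  have V_zero: "\<zero>\<^bsub>Fr d\<^esub> \<in> V"
  proof -
    have "row_mult R d d E (\<zero>\<^bsub>Fr d\<^esub>) \<in> V"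
      by (auto simp: V_def intro: free_module_closed)
    then show ?thesis
      using V_add[OF _ V_minus] V_carrier F.r_neg by fastforce
  qed
  have N_add: "v \<oplus>\<^bsub>Fr d\<^esub> w \<in> N" if "v \<in> N" "w \<in> N" for v w
    using that by (auto simp: N_def row_mult_add[OF D\<^sub>2, symmetric] intro: free_module_closed)
  have N_smult: "a \<odot>\<^bsub>Fr d\<^esub> v \<in> N" if "a \<in> carrier R" "v \<in> N" for a v
    using that by (auto simp: N_def row_mult_smult[OF D\<^sub>2, symmetric] intro: free_module_closed)
  have N_minus: "\<ominus>\<^bsub>Fr d\<^esub> v \<in> N" if "v \<in> N" for v
    using that by (simp add: free_module_minus_one N_carrier N_smult)
  have "row_mult R r d D\<^sub>2 (\<zero>\<^bsub>Fr r\<^esub>) \<in> N"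
    by (auto simp: N_def intro: free_module_closed)
  then have N_nonempty: "N \<noteq> {}" by auto
  have "abelian_subgroup N (Fr d)"
    by (intro abelian_subgroupI3 additive_subgroupI F.abelian_group_axioms F.add.subgroupI)
      (use N_carrier N_nonempty N_add N_minus in \<open>auto simp flip: a_inv_def\<close>)
  then interpret N: abelian_subgroup N "Fr d" .
  have coset_add: "set_add (Fr d) (coset v) (coset w) = coset (v \<oplus>\<^bsub>Fr d\<^esub> w)"
    if "v \<in> carrier (Fr d)" "w \<in> carrier (Fr d)" for v w
    unfolding coset_def using that by (rule N.a_rcos_sum)
  have coset_eq_iff: "coset v = coset w \<longleftrightarrow> v \<oplus>\<^bsub>Fr d\<^esub> \<ominus>\<^bsub>Fr d\<^esub> w \<in> N"
    if "v \<in> carrier (Fr d)" "w \<in> carrier (Fr d)" for v w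
    unfolding coset_def using that N.a_rcos_self[of v] N.a_rcos_module[of w v] N.a_repr_independence'
    by metis
  have coset_zero: "coset (\<zero>\<^bsub>Fr d\<^esub>) = N"
    unfolding coset_def by (rule N.a_rcos_const) (rule N.zero_closed)
  have coset_smult: "(\<Union>y\<in>coset v. coset (a \<odot>\<^bsub>Fr d\<^esub> y)) = coset (a \<odot>\<^bsub>Fr d\<^esub> v)"
    if a: "a \<in> carrier R" and v: "v \<in> carrier (Fr d)" for a v
  proof -
    have "coset (a \<odot>\<^bsub>Fr d\<^esub> y) = coset (a \<odot>\<^bsub>Fr d\<^esub> v)" if "y \<in> coset v" for y
    proof -
      have y: "y \<in> carrier (Fr d)" "y \<oplus>\<^bsub>Fr d\<^esub> \<ominus>\<^bsub>Fr d\<^esub> v \<in> N"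
        using that v unfolding coset_def by (auto intro: N.a_elemrcos_carrier N.a_rcos_module_imp)
      have "a \<odot>\<^bsub>Fr d\<^esub> (y \<oplus>\<^bsub>Fr d\<^esub> \<ominus>\<^bsub>Fr d\<^esub> v) = a \<odot>\<^bsub>Fr d\<^esub> y \<oplus>\<^bsub>Fr d\<^esub> \<ominus>\<^bsub>Fr d\<^esub> (a \<odot>\<^bsub>Fr d\<^esub> v)"
        unfolding free_module_minus_one[OF v] free_module_minus_one[OF free_module_closed(3)[OF a v]]
        using a v y(1)
        by (auto simp: free_module_simps free_module_entry r_distr l_minus r_minus intro!: restrict_ext)
      then show ?thesis
        using N_smult[OF a y(2)] a v y(1) by (simp add: coset_eq_iff free_module_closed)
    qed
    moreover have "v \<in> coset v"
      unfolding coset_def using v by (rule N.a_rcos_self)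
    ultimately show ?thesis by blast
  qed
  have H: "carrier H = coset ` Z" "\<zero>\<^bsub>H\<^esub> = N" "A \<oplus>\<^bsub>H\<^esub> B = set_add (Fr d) A B"
    "a \<odot>\<^bsub>H\<^esub> A = (\<Union>y\<in>A. coset (a \<odot>\<^bsub>Fr d\<^esub> y))" for A B a
    by (auto simp: H_def quotient_module_def coset_def A_RCOSETS_def RCOSETS_def a_r_coset_def r_coset_def
        set_add_def set_mult_def)
  have coset_inj: "inj_on coset V"
  proof (rule inj_onI)
    fix v w assume v: "v \<in> V" and w: "w \<in> V" and "coset v = coset w"
    define u where "u = v \<oplus>\<^bsub>Fr d\<^esub> \<ominus>\<^bsub>Fr d\<^esub> w"
    have "u \<in> N"
      using \<open>coset v = coset w\<close> coset_eq_iff V_carrier v w by (simp add: u_def)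
    then obtain z where z: "z \<in> carrier (Fr r)" "u = row_mult R r d D\<^sub>2 z"
      by (auto simp: N_def)
    have "u = row_mult R d d E u"
      using V_fixed[OF V_add[OF v V_minus[OF w]]] by (simp add: u_def)
    also have "\<dots> = row_mult R r d (\<lambda>i j. \<Oplus>q\<in>{..<d}. D\<^sub>2 i q \<otimes> E q j) z"
      unfolding z(2) by (rule row_mult_assoc[OF D\<^sub>2 E_over z(1)])
    also have "\<dots> = row_mult R r d (\<lambda>i j. \<zero>) z"
      using D\<^sub>2E z(1) by (intro row_mult_cong[symmetric]) (auto simp: matrix_over_def)
    also have "\<dots> = \<zero>\<^bsub>Fr d\<^esub>"
      by (rule row_mult_zero_matrix[OF z(1)])
    finally show "v = w"
      using V_carrier[OF v] V_carrier[OF w] F.minus_equality[of v "\<ominus>\<^bsub>Fr d\<^esub> w"]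
      by (simp add: u_def F.minus_minus)
  qed
  define P where "P = coset ` V"
  have "submodule P R H"
  proof (intro submodule.intro submodule_axioms.intro subgroup.intro)
    show "P \<subseteq> carrier (add_monoid H)"
      using V_cycles by (auto simp: P_def H)
    show "\<one>\<^bsub>add_monoid H\<^esub> \<in> P"
      using V_zero coset_zero by (auto simp: P_def H)
    show "A \<otimes>\<^bsub>add_monoid H\<^esub> B \<in> P" if "A \<in> P" "B \<in> P" for A B
      using that V_carrier V_add by (auto simp: P_def H coset_add)
    show "a \<odot>\<^bsub>H\<^esub> A \<in> P" if "a \<in> carrier R" "A \<in> P" for a A
      using that V_carrier V_smult by (auto simp: P_def H coset_smult)
    show "inv\<^bsub>add_monoid H\<^esub> A \<in> P" if A: "A \<in> P" for A
    proof -
      obtain v where v: "v \<in> V" "A = coset v"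
        using A by (auto simp: P_def)
      note vc = V_carrier[OF v(1)]
      have "inv\<^bsub>add_monoid H\<^esub> A = coset (\<ominus>\<^bsub>Fr d\<^esub> v)"
        unfolding m_inv_def
      proof (rule the_equality)
        show "coset (\<ominus>\<^bsub>Fr d\<^esub> v) \<in> carrier (add_monoid H) \<and>
          A \<otimes>\<^bsub>add_monoid H\<^esub> coset (\<ominus>\<^bsub>Fr d\<^esub> v) = \<one>\<^bsub>add_monoid H\<^esub> \<and>
          coset (\<ominus>\<^bsub>Fr d\<^esub> v) \<otimes>\<^bsub>add_monoid H\<^esub> A = \<one>\<^bsub>add_monoid H\<^esub>"
          using V_cycles[OF V_minus[OF v(1)]] vc
          by (auto simp: H v(2) coset_add coset_zero F.r_neg F.l_neg)
      next
        \<comment> \<open>A coset \<open>N + z\<close> with \<open>z + v \<in> N\<close> is the coset of \<open>- v\<close>.\<close>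
        fix B assume B: "B \<in> carrier (add_monoid H) \<and> A \<otimes>\<^bsub>add_monoid H\<^esub> B = \<one>\<^bsub>add_monoid H\<^esub> \<and>
          B \<otimes>\<^bsub>add_monoid H\<^esub> A = \<one>\<^bsub>add_monoid H\<^esub>"
        then obtain z where z: "z \<in> carrier (Fr d)" "B = coset z"
          by (auto simp: H Z_def)
        have "coset (z \<oplus>\<^bsub>Fr d\<^esub> v) = N"
          using B z vc by (simp add: H v(2) coset_add)
        then have "z \<oplus>\<^bsub>Fr d\<^esub> v \<in> N"
          using N.a_rcos_self[of "z \<oplus>\<^bsub>Fr d\<^esub> v"] z vc by (simp add: coset_def)
        then show "B = coset (\<ominus>\<^bsub>Fr d\<^esub> v)"
          using z vc by (simp add: coset_eq_iff F.minus_minus)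
      qed
      then show ?thesis
        using V_minus[OF v(1)] by (auto simp: P_def)
    qed
  qed
  moreover have "module_isomorphic R (H\<lparr>carrier := P\<rparr>) (matrix_image R d E)"
    unfolding module_isomorphic_def
  proof (intro exI conjI ballI)
    have image: "carrier (matrix_image R d E) = V"
      by (simp add: matrix_image_def V_def)
    show "bij_betw (inv_into V coset) (carrier (H\<lparr>carrier := P\<rparr>)) (carrier (matrix_image R d E))"
      unfolding image using coset_inj by (auto simp: P_def intro!: bij_betw_inv_into inj_on_imp_bij_betw)
    show "inv_into V coset (A \<oplus>\<^bsub>H\<lparr>carrier := P\<rparr>\<^esub> B) =
        inv_into V coset A \<oplus>\<^bsub>matrix_image R d E\<^esub> inv_into V coset B"
      if "A \<in> carrier (H\<lparr>carrier := P\<rparr>)" "B \<in> carrier (H\<lparr>carrier := P\<rparr>)" for A B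
      using that coset_inj V_add V_carrier
      by (auto simp: P_def H coset_add matrix_image_def inv_into_f_f)
    show "inv_into V coset (a \<odot>\<^bsub>H\<lparr>carrier := P\<rparr>\<^esub> A) = a \<odot>\<^bsub>matrix_image R d E\<^esub> inv_into V coset A"
      if "a \<in> carrier R" "A \<in> carrier (H\<lparr>carrier := P\<rparr>)" for a A
      using that coset_inj V_smult V_carrier
      by (auto simp: P_def H coset_smult matrix_image_def inv_into_f_f)
  qed
  ultimately show ?thesis
    by blast
qed

end

section \<open>The group von Neumann algebra is a ring\<close>

lemma ell2_norm_eq_sqrt: "ell2_norm G f = sqrt (l2_normsq (carrier G) f)"
  by (simp add: ell2_norm_def l2_normsq_def)

lemma l2_normsq_add_le:
  assumes "f \<in> l2 A" "k \<in> l2 A"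
  shows "l2_normsq A (\<lambda>x. f x + k x) \<le> 2 * l2_normsq A f + 2 * l2_normsq A k"
proof -
  have neg: "(\<lambda>x. - k x) \<in> l2 A"
    using l2_scale[OF assms(2), of "-1"] by simp
  have "l2_normsq A (\<lambda>x. f x - - k x) + l2_normsq A (\<lambda>x. f x - k x) = 2 * l2_normsq A f + 2 * l2_normsq A k"
    using assms neg l2_inner_scale_left[of A "-1" k f] l2_inner_commute[of A f]
    by (simp add: l2_normsq_diff l2_normsq_def[of A "\<lambda>x. - k x"] l2_normsq_def[of A k]
        del: diff_minus_eq_add)
  then show ?thesis
    using l2_normsq_nonneg[of A "\<lambda>x. f x - k x"] unfolding diff_minus_eq_add by linarith
qed

context group
begin

abbreviation L2 :: "('a \<Rightarrow> complex) set" where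
  "L2 \<equiv> l2 (carrier G)"

lemma left_translation_l2:
  assumes "g \<in> carrier G" "f \<in> L2"
  shows "left_translation G g f \<in> L2"
proof -
  have "bij_betw (\<lambda>h. inv g \<otimes> h) (carrier G) (carrier G)"
    by (rule bij_betw_byWitness[of _ "\<lambda>h. g \<otimes> h"]) (use assms(1) in \<open>auto simp flip: m_assoc\<close>)
  from summable_on_reindex_bij_betw[OF this, of "\<lambda>h. (cmod (f h))\<^sup>2"]
  have "(\<lambda>h. (cmod (f (inv g \<otimes> h)))\<^sup>2) summable_on carrier G"
    using l2_summable[OF assms(2)] by simp
  then show ?thesis
    by (simp add: l2_def left_translation_def cong: summable_on_cong)
qed

lemma vn_operatorsI:
  assumes "\<And>f. f \<in> L2 \<Longrightarrow> t f \<in> L2"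
    and "\<And>f k a b. f \<in> L2 \<Longrightarrow> k \<in> L2 \<Longrightarrow> t (\<lambda>h. a * f h + b * k h) = (\<lambda>h. a * t f h + b * t k h)"
    and "\<And>f. f \<in> L2 \<Longrightarrow> l2_normsq (carrier G) (t f) \<le> K * l2_normsq (carrier G) f"
    and "\<And>g f. g \<in> carrier G \<Longrightarrow> f \<in> L2 \<Longrightarrow> t (left_translation G g f) = left_translation G g (t f)"
  shows "(\<lambda>f\<in>L2. t f) \<in> vn_operators G"
proof -
  have "\<exists>C. \<forall>f\<in>L2. ell2_norm G (t f) \<le> C * ell2_norm G f"
  proof (intro exI ballI)
    fix f assume "f \<in> L2"
    then show "ell2_norm G (t f) \<le> sqrt K * ell2_norm G f"
      using assms(3) by (simp add: ell2_norm_eq_sqrt flip: real_sqrt_mult)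
  qed
  then show ?thesis
    unfolding vn_operators_def ell2_eq_l2
    by (auto simp: assms(1,2,4) l2_lincomb left_translation_l2)
qed

lemma
  assumes "T \<in> vn_operators G"
  shows vn_operators_l2: "f \<in> L2 \<Longrightarrow> T f \<in> L2"
    and vn_operators_lincomb:
      "f \<in> L2 \<Longrightarrow> k \<in> L2 \<Longrightarrow> T (\<lambda>h. a * f h + b * k h) = (\<lambda>h. a * T f h + b * T k h)"
    and vn_operators_equivariant:
      "g \<in> carrier G \<Longrightarrow> f \<in> L2 \<Longrightarrow> T (left_translation G g f) = left_translation G g (T f)"
    and vn_operators_extensional: "T \<in> extensional L2"
  using assms by (auto simp: vn_operators_def ell2_eq_l2 PiE_def)

lemma vn_operators_add:
  assumes "T \<in> vn_operators G" "f \<in> L2" "k \<in> L2"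
  shows "T (\<lambda>h. f h + k h) = (\<lambda>h. T f h + T k h)"
  using vn_operators_lincomb[OF assms, of 1 1] by simp

lemma vn_operators_bounded:
  assumes "T \<in> vn_operators G"
  obtains K where "K \<ge> 0" "\<And>f. f \<in> L2 \<Longrightarrow> l2_normsq (carrier G) (T f) \<le> K * l2_normsq (carrier G) f"
proof -
  have "\<exists>C. \<forall>f\<in>L2. ell2_norm G (T f) \<le> C * ell2_norm G f"
    using assms by (simp add: vn_operators_def ell2_eq_l2)
  then obtain C where C: "\<And>f. f \<in> L2 \<Longrightarrow> ell2_norm G (T f) \<le> C * ell2_norm G f"
    by blast
  have "l2_normsq (carrier G) (T f) \<le> C\<^sup>2 * l2_normsq (carrier G) f" if "f \<in> L2" for f
  proof -
    have "(sqrt (l2_normsq (carrier G) (T f)))\<^sup>2 \<le> (C * sqrt (l2_normsq (carrier G) f))\<^sup>2"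
      using C[OF that] by (intro power_mono) (simp_all add: ell2_norm_eq_sqrt)
    then show ?thesis
      by (simp add: power_mult_distrib)
  qed
  then show ?thesis
    by (intro that[of "C\<^sup>2"]) auto
qed

lemma vn_operators_zero: "(\<lambda>f\<in>L2. (\<lambda>h. 0)) \<in> vn_operators G"
  by (rule vn_operatorsI[where K = 0]) (auto simp: left_translation_def l2_normsq_def)

lemma vn_operators_one: "(\<lambda>f\<in>L2. f) \<in> vn_operators G"
  by (rule vn_operatorsI[where K = 1]) auto

lemma vn_operators_plus:
  assumes T: "T \<in> vn_operators G" and S: "S \<in> vn_operators G"
  shows "(\<lambda>f\<in>L2. (\<lambda>h. T f h + S f h)) \<in> vn_operators G"
proof -
  obtain K where K: "K \<ge> 0" "\<And>f. f \<in> L2 \<Longrightarrow> l2_normsq (carrier G) (T f) \<le> K * l2_normsq (carrier G) f"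
    using vn_operators_bounded[OF T] by blast
  obtain K' where K': "K' \<ge> 0" "\<And>f. f \<in> L2 \<Longrightarrow> l2_normsq (carrier G) (S f) \<le> K' * l2_normsq (carrier G) f"
    using vn_operators_bounded[OF S] by blast
  show ?thesis
  proof (rule vn_operatorsI)
    fix f assume f: "f \<in> L2"
    show "(\<lambda>h. T f h + S f h) \<in> L2"
      using f by (intro l2_add vn_operators_l2[OF T] vn_operators_l2[OF S])
    have "l2_normsq (carrier G) (\<lambda>h. T f h + S f h) \<le>
        2 * l2_normsq (carrier G) (T f) + 2 * l2_normsq (carrier G) (S f)"
      using f by (intro l2_normsq_add_le vn_operators_l2[OF T] vn_operators_l2[OF S])
    also have "\<dots> \<le> (2 * K + 2 * K') * l2_normsq (carrier G) f"
      using K(2)[OF f] K'(2)[OF f] by (simp add: algebra_simps)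
    finally show "l2_normsq (carrier G) (\<lambda>h. T f h + S f h) \<le> (2 * K + 2 * K') * l2_normsq (carrier G) f" .
  next
    fix f k a b assume "f \<in> L2" "k \<in> L2"
    then show "(\<lambda>h. T (\<lambda>h. a * f h + b * k h) h + S (\<lambda>h. a * f h + b * k h) h) =
        (\<lambda>h. a * (T f h + S f h) + b * (T k h + S k h))"
      by (simp add: vn_operators_lincomb[OF T] vn_operators_lincomb[OF S] algebra_simps)
  next
    fix g f assume "g \<in> carrier G" "f \<in> L2"
    then show "(\<lambda>h. T (left_translation G g f) h + S (left_translation G g f) h) =
        left_translation G g (\<lambda>h. T f h + S f h)"
      by (simp add: vn_operators_equivariant[OF T] vn_operators_equivariant[OF S])
        (auto simp: left_translation_def)
  qed
qed

lemma vn_operators_compose: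
  assumes T: "T \<in> vn_operators G" and S: "S \<in> vn_operators G"
  shows "compose L2 T S \<in> vn_operators G"
proof -
  obtain K where K: "K \<ge> 0" "\<And>f. f \<in> L2 \<Longrightarrow> l2_normsq (carrier G) (T f) \<le> K * l2_normsq (carrier G) f"
    using vn_operators_bounded[OF T] by blast
  obtain K' where K': "K' \<ge> 0" "\<And>f. f \<in> L2 \<Longrightarrow> l2_normsq (carrier G) (S f) \<le> K' * l2_normsq (carrier G) f"
    using vn_operators_bounded[OF S] by blast
  show ?thesis
    unfolding compose_def
  proof (rule vn_operatorsI)
    fix f assume f: "f \<in> L2"
    have "l2_normsq (carrier G) (T (S f)) \<le> K * l2_normsq (carrier G) (S f)"
      using f by (intro K(2) vn_operators_l2[OF S])
    also have "\<dots> \<le> K * (K' * l2_normsq (carrier G) f)"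
      using f by (intro mult_left_mono K K')
    finally show "l2_normsq (carrier G) (T (S f)) \<le> (K * K') * l2_normsq (carrier G) f"
      by simp
  qed (auto simp: vn_operators_l2[OF T] vn_operators_l2[OF S] vn_operators_lincomb[OF T]
      vn_operators_lincomb[OF S] vn_operators_equivariant[OF T] vn_operators_equivariant[OF S])
qed

lemma vn_algebra_simps:
  "carrier (vn_algebra G) = vn_operators G"
  "\<zero>\<^bsub>vn_algebra G\<^esub> = (\<lambda>f\<in>L2. (\<lambda>h. 0))"
  "\<one>\<^bsub>vn_algebra G\<^esub> = (\<lambda>f\<in>L2. f)"
  "T \<oplus>\<^bsub>vn_algebra G\<^esub> S = (\<lambda>f\<in>L2. (\<lambda>h. T f h + S f h))"
  "T \<otimes>\<^bsub>vn_algebra G\<^esub> S = compose L2 T S"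
  by (simp_all add: vn_algebra_def ell2_eq_l2)

lemma ring_vn_algebra: "ring (vn_algebra G)"
proof (rule ringI)
  show "abelian_group (vn_algebra G)"
  proof (rule abelian_groupI; unfold vn_algebra_simps)
    fix x y z assume "x \<in> vn_operators G" "y \<in> vn_operators G" "z \<in> vn_operators G"
    then show "(\<lambda>f\<in>L2. \<lambda>h. (\<lambda>f\<in>L2. \<lambda>h. x f h + y f h) f h + z f h) =
        (\<lambda>f\<in>L2. \<lambda>h. x f h + (\<lambda>f\<in>L2. \<lambda>h. y f h + z f h) f h)"
      by (intro restrict_ext) (simp add: add.assoc)
  next
    fix x assume x: "x \<in> vn_operators G"
    then show "(\<lambda>f\<in>L2. \<lambda>h. (\<lambda>f\<in>L2. \<lambda>h. 0) f h + x f h) = x"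
      by (intro extensionalityI[of _ L2]) (auto simp: vn_operators_extensional)
    have "(\<lambda>f\<in>L2. \<lambda>h. - x f h) \<in> vn_operators G"
    proof -
      obtain K where K: "K \<ge> 0" "\<And>f. f \<in> L2 \<Longrightarrow> l2_normsq (carrier G) (x f) \<le> K * l2_normsq (carrier G) f"
        using vn_operators_bounded[OF x] by blast
      show ?thesis
      proof (rule vn_operatorsI)
        fix f assume f: "f \<in> L2"
        show "(\<lambda>h. - x f h) \<in> L2"
          using l2_scale[OF vn_operators_l2[OF x f], of "-1"] by simp
        show "l2_normsq (carrier G) (\<lambda>h. - x f h) \<le> K * l2_normsq (carrier G) f"
          using K(2)[OF f] by (simp add: l2_normsq_def)
      qed (simp_all add: vn_operators_lincomb[OF x] vn_operators_equivariant[OF x], auto simp: left_translation_def)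
    qed
    moreover have "(\<lambda>f\<in>L2. \<lambda>h. (\<lambda>f\<in>L2. \<lambda>h. - x f h) f h + x f h) = (\<lambda>f\<in>L2. \<lambda>h. 0)"
      by (intro restrict_ext) simp
    ultimately show "\<exists>y\<in>vn_operators G. (\<lambda>f\<in>L2. \<lambda>h. y f h + x f h) = (\<lambda>f\<in>L2. \<lambda>h. 0)"
      by blast
  qed (auto simp: vn_operators_plus vn_operators_zero add.commute intro!: restrict_ext)
next
  show "monoid (vn_algebra G)"
  proof (rule monoidI; unfold vn_algebra_simps)
    fix x y z assume "x \<in> vn_operators G" "y \<in> vn_operators G" "z \<in> vn_operators G"
    then show "compose L2 (compose L2 x y) z = compose L2 x (compose L2 y z)"
      by (auto simp: compose_def vn_operators_l2 intro!: restrict_ext)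
  next
    fix x assume x: "x \<in> vn_operators G"
    show "compose L2 (\<lambda>f\<in>L2. f) x = x"
      by (intro extensionalityI[of _ L2]) (auto simp: compose_def vn_operators_l2[OF x] vn_operators_extensional[OF x])
    show "compose L2 x (\<lambda>f\<in>L2. f) = x"
      by (intro extensionalityI[of _ L2]) (auto simp: compose_def vn_operators_extensional[OF x])
  qed (auto simp: vn_operators_compose vn_operators_one)
next
  fix x y z assume "x \<in> carrier (vn_algebra G)" "y \<in> carrier (vn_algebra G)" "z \<in> carrier (vn_algebra G)"
  then have xyz: "x \<in> vn_operators G" "y \<in> vn_operators G" "z \<in> vn_operators G"
    by (simp_all add: vn_algebra_simps)
  show "(x \<oplus>\<^bsub>vn_algebra G\<^esub> y) \<otimes>\<^bsub>vn_algebra G\<^esub> z =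
      x \<otimes>\<^bsub>vn_algebra G\<^esub> z \<oplus>\<^bsub>vn_algebra G\<^esub> y \<otimes>\<^bsub>vn_algebra G\<^esub> z"
    unfolding vn_algebra_simps compose_def by (intro restrict_ext) (simp add: vn_operators_l2[OF xyz(3)])
  show "z \<otimes>\<^bsub>vn_algebra G\<^esub> (x \<oplus>\<^bsub>vn_algebra G\<^esub> y) =
      z \<otimes>\<^bsub>vn_algebra G\<^esub> x \<oplus>\<^bsub>vn_algebra G\<^esub> z \<otimes>\<^bsub>vn_algebra G\<^esub> y"
    unfolding vn_algebra_simps compose_def
    by (intro restrict_ext) (simp add: vn_operators_add[OF xyz(3)] vn_operators_l2[OF xyz(1)] vn_operators_l2[OF xyz(2)])
qed

lemma vn_finsum_apply:
  assumes "finite A" "\<And>i. i \<in> A \<Longrightarrow> T i \<in> vn_operators G" "f \<in> L2"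
  shows "(\<Oplus>\<^bsub>vn_algebra G\<^esub>i\<in>A. T i) f = (\<lambda>h. \<Sum>i\<in>A. T i f h)"
proof -
  interpret N: ring "vn_algebra G" by (rule ring_vn_algebra)
  show ?thesis
    using assms(1,2)
  proof (induction A)
    case empty
    then show ?case
      using assms(3) by (simp add: vn_algebra_simps)
  next
    case (insert i A)
    then have "(\<Oplus>\<^bsub>vn_algebra G\<^esub>i\<in>insert i A. T i) = T i \<oplus>\<^bsub>vn_algebra G\<^esub> (\<Oplus>\<^bsub>vn_algebra G\<^esub>i\<in>A. T i)"
      by (intro N.finsum_insert) (auto simp: vn_algebra_simps)
    then show ?case
      using insert assms(3) by (simp add: vn_algebra_simps)
  qed
qed

lemma vn_matrix_product_apply:
  assumes "finite A" "\<And>q. q \<in> A \<Longrightarrow> S q \<in> vn_operators G" "\<And>q. q \<in> A \<Longrightarrow> T q \<in> vn_operators G" "f \<in> L2"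
  shows "(\<Oplus>\<^bsub>vn_algebra G\<^esub>q\<in>A. S q \<otimes>\<^bsub>vn_algebra G\<^esub> T q) f = (\<lambda>h. \<Sum>q\<in>A. S q (T q f) h)"
proof -
  have "S q \<otimes>\<^bsub>vn_algebra G\<^esub> T q \<in> vn_operators G" if "q \<in> A" for q
    using that assms by (simp add: vn_algebra_simps vn_operators_compose)
  then show ?thesis
    using assms by (simp add: vn_finsum_apply) (simp add: vn_algebra_simps compose_def)
qed

end

section \<open>Operators on cochains as matrices over the group von Neumann algebra\<close>

context symmetric_group_ring_matrix
begin

definition embed :: "'i \<Rightarrow> ('a \<Rightarrow> complex) \<Rightarrow> ('a \<times> 'i \<Rightarrow> complex)" where
  "embed j f = (\<lambda>(h, i). if i = j then f h else 0)"

text \<open>The operators on cochains whose blocks belong to the von Neumann algebra.\<close>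

definition invariant_operator :: "(('a \<times> 'i \<Rightarrow> complex) \<Rightarrow> ('a \<times> 'i \<Rightarrow> complex)) \<Rightarrow> bool" where
  "invariant_operator T \<longleftrightarrow> (\<forall>f\<in>l2 cells. T f \<in> l2 cells) \<and>
    (\<forall>f\<in>l2 cells. \<forall>w\<in>l2 cells. \<forall>a b. T (\<lambda>x. a * f x + b * w x) = (\<lambda>x. a * T f x + b * T w x)) \<and>
    (\<exists>K. \<forall>f\<in>l2 cells. l2_normsq cells (T f) \<le> K * l2_normsq cells f) \<and>
    (\<forall>a\<in>carrier G. \<forall>f\<in>l2 cells. T (translate a f) = translate a (T f))"

text \<open>The block of \<open>T\<close> that maps the functions on the orbit \<open>j\<close> to those on the orbit \<open>i\<close>.\<close>

definition entry :: "(('a \<times> 'i \<Rightarrow> complex) \<Rightarrow> ('a \<times> 'i \<Rightarrow> complex)) \<Rightarrow> 'i \<Rightarrow> 'i \<Rightarrow> 'a operator" where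
  "entry T i j = (\<lambda>f\<in>l2 (carrier G). component (T (embed j f)) i)"

lemma invariant_operator_M: "invariant_operator M"
  unfolding invariant_operator_def
proof (intro conjI exI ballI allI)
  show "l2_normsq cells (M f) \<le> M_bound * l2_normsq cells f" if "f \<in> l2 cells" for f
    by (rule M_normsq[OF that])
qed (simp_all add: M_l2 M_lincomb M_translate)

lemma invariant_operator_E: "invariant_operator E"
  unfolding invariant_operator_def
proof (intro conjI exI ballI allI)
  show "l2_normsq cells (E f) \<le> 1 * l2_normsq cells f" if "f \<in> l2 cells" for f
    using E_normsq[OF that] by simp
qed (simp_all add: E_l2 E_lincomb E_translate)

lemma component_normsq_le:
  assumes "f \<in> l2 cells" "i \<in> I"
  shows "l2_normsq (carrier G) (component f i) \<le> l2_normsq cells f"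
  using component_l2[OF assms] component_finite_sum_le[OF assms]
  by (intro l2_normsq_le_of_finite_sums) (auto intro: l2_outside)

lemma
  assumes "f \<in> l2 (carrier G)" "j \<in> I"
  shows embed_l2: "embed j f \<in> l2 cells"
    and embed_normsq_le: "l2_normsq cells (embed j f) \<le> l2_normsq (carrier G) f"
proof -
  have outside: "embed j f x = 0" if "x \<notin> cells" for x
    using that assms(2) l2_outside[OF assms(1), of "fst x"] by (cases x) (auto simp: embed_def cells_def)
  have finite_sum: "(\<Sum>x\<in>T. (cmod (embed j f x))\<^sup>2) \<le> l2_normsq (carrier G) f" if T: "finite T" "T \<subseteq> cells" for T
  proof -
    define B where "B = {h. (h, j) \<in> T}"
    have B: "finite B" "B \<subseteq> carrier G"
      using T finite_subset[of B "fst ` T"] by (force simp: B_def cells_def)+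
    have "(\<Sum>x\<in>T. (cmod (embed j f x))\<^sup>2) = (\<Sum>x\<in>(\<lambda>h. (h, j)) ` B. (cmod (embed j f x))\<^sup>2)"
      by (rule sum.mono_neutral_right[OF T(1)]) (auto simp: B_def embed_def)
    also have "\<dots> = (\<Sum>h\<in>B. (cmod (f h))\<^sup>2)"
      by (subst sum.reindex) (auto simp: inj_on_def embed_def)
    also have "\<dots> \<le> l2_normsq (carrier G) f"
      by (rule l2_finite_sum_le[OF assms(1) B])
    finally show ?thesis .
  qed
  show "embed j f \<in> l2 cells"
    by (rule l2_of_finite_sums[OF outside finite_sum])
  show "l2_normsq cells (embed j f) \<le> l2_normsq (carrier G) f"
    by (rule l2_normsq_le_of_finite_sums[OF outside finite_sum])
qed

lemma embed_lincomb: "embed j (\<lambda>h. a * f h + b * w h) = (\<lambda>x. a * embed j f x + b * embed j w x)"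
  by (auto simp: embed_def)

lemma embed_translate: "embed j (left_translation G g f) = translate g (embed j f)"
  by (auto simp: embed_def left_translation_def translate_def)

lemma component_translate: "component (translate g f) i = left_translation G g (component f i)"
  by (auto simp: component_def left_translation_def translate_def)

lemma entry_vn_operators:
  assumes T: "invariant_operator T" and "i \<in> I" "j \<in> I"
  shows "entry T i j \<in> vn_operators G"
proof -
  have T_l2: "T f \<in> l2 cells" if "f \<in> l2 cells" for f
    using T that by (auto simp: invariant_operator_def)
  obtain K where K: "\<And>f. f \<in> l2 cells \<Longrightarrow> l2_normsq cells (T f) \<le> K * l2_normsq cells f"
    using T unfolding invariant_operator_def by blast
  show ?thesis
    unfolding entry_def
  proof (rule vn_operatorsI)
    fix f assume f: "f \<in> l2 (carrier G)"
    note ef = embed_l2[OF f assms(3)]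
    show "component (T (embed j f)) i \<in> l2 (carrier G)"
      by (intro component_l2 T_l2 ef assms)
    have "l2_normsq (carrier G) (component (T (embed j f)) i) \<le> l2_normsq cells (T (embed j f))"
      by (intro component_normsq_le T_l2 ef assms)
    also have "\<dots> \<le> K * l2_normsq cells (embed j f)"
      by (rule K[OF ef])
    also have "\<dots> \<le> \<bar>K\<bar> * l2_normsq cells (embed j f)"
      by (intro mult_right_mono) auto
    also have "\<dots> \<le> \<bar>K\<bar> * l2_normsq (carrier G) f"
      by (intro mult_left_mono embed_normsq_le f assms) auto
    finally show "l2_normsq (carrier G) (component (T (embed j f)) i) \<le> \<bar>K\<bar> * l2_normsq (carrier G) f" .
  next
    fix f w a b assume "f \<in> l2 (carrier G)" "w \<in> l2 (carrier G)"
    then have "T (embed j (\<lambda>h. a * f h + b * w h)) = (\<lambda>x. a * T (embed j f) x + b * T (embed j w) x)"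
      using T embed_l2 assms unfolding embed_lincomb invariant_operator_def by simp
    then show "component (T (embed j (\<lambda>h. a * f h + b * w h))) i =
        (\<lambda>h. a * component (T (embed j f)) i h + b * component (T (embed j w)) i h)"
      by (simp add: component_def)
  next
    fix g f assume "g \<in> carrier G" "f \<in> l2 (carrier G)"
    then have "T (translate g (embed j f)) = translate g (T (embed j f))"
      using T embed_l2 assms unfolding invariant_operator_def by simp
    then show "component (T (embed j (left_translation G g f))) i =
        left_translation G g (component (T (embed j f)) i)"
      by (simp add: embed_translate component_translate)
  qed
qed

text \<open>Composition of operators is multiplication of matrices; the sum may be restricted to the types
  of cells on which the intermediate function lives.\<close>

lemma entry_compose:
  assumes S: "invariant_operator S'" and T: "invariant_operator T"
    and A: "A \<subseteq> I" and "i \<in> I" "j \<in> I" and f: "f \<in> l2 (carrier G)"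
    and vanish: "\<And>h q. q \<in> I \<Longrightarrow> q \<notin> A \<Longrightarrow> T (embed j f) (h, q) = 0"
  shows "(\<Oplus>\<^bsub>vn_algebra G\<^esub>q\<in>A. entry S' i q \<otimes>\<^bsub>vn_algebra G\<^esub> entry T q j) f =
         component (S' (T (embed j f))) i"
proof -
  define F where "F = T (embed j f)"
  have F: "F \<in> l2 cells"
    using T embed_l2[OF f assms(5)] by (auto simp: F_def invariant_operator_def)
  have S'_lincomb: "S' (\<lambda>x. a * f x + b * w x) = (\<lambda>x. a * S' f x + b * S' w x)"
    if "f \<in> l2 cells" "w \<in> l2 cells" for f w a b
    using S that by (simp add: invariant_operator_def)
  have finite_A: "finite A"
    using A finite_I finite_subset by blast
  have Fq: "embed q (component F q) \<in> l2 cells" if "q \<in> A" for q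
    using that A F by (intro embed_l2 component_l2) auto
  have S'_sum: "S' (\<lambda>x. \<Sum>q\<in>B. embed q (component F q) x) = (\<lambda>x. \<Sum>q\<in>B. S' (embed q (component F q)) x)"
    if "B \<subseteq> A" for B
  proof -
    have "finite B"
      using that finite_A finite_subset by blast
    then show ?thesis
      using that
    proof (induction B)
      case empty
      then show ?case
        using S'_lincomb[OF zero_l2 zero_l2, of 0 0] by simp
    next
      case (insert q B)
      define W where "W = (\<lambda>x. \<Sum>q\<in>B. embed q (component F q) x)"
      have "W \<in> l2 cells"
        unfolding W_def using insert.prems by (intro l2_sum Fq) auto
      moreover have "embed q (component F q) \<in> l2 cells"
        using insert.prems by (intro Fq) auto
      ultimately have sum: "S' (\<lambda>x. embed q (component F q) x + W x) =
          (\<lambda>x. S' (embed q (component F q)) x + S' W x)"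
        using S'_lincomb[of "embed q (component F q)" W 1 1] by simp
      have IH: "S' W = (\<lambda>x. \<Sum>q\<in>B. S' (embed q (component F q)) x)"
        unfolding W_def using insert.prems by (intro insert.IH) auto
      have "(\<lambda>x. \<Sum>q\<in>insert q B. embed q (component F q) x) = (\<lambda>x. embed q (component F q) x + W x)"
        using insert.hyps by (simp add: W_def)
      moreover have "(\<lambda>x. \<Sum>q\<in>insert q B. S' (embed q (component F q)) x) =
          (\<lambda>x. S' (embed q (component F q)) x + S' W x)"
        using insert.hyps by (simp add: IH)
      ultimately show ?case
        by (simp only: sum)
    qed
  qed
  have decompose: "(\<lambda>x. \<Sum>q\<in>A. embed q (component F q) x) = F"
  proof
    fix x :: "'a \<times> 'i"
    obtain h c where x: "x = (h, c)"
      by (cases x)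
    have "(\<Sum>q\<in>A. embed q (component F q) x) = (\<Sum>q\<in>A. if c = q then F (h, q) else 0)"
      by (intro sum.cong) (auto simp: x embed_def component_def)
    also have "\<dots> = (if c \<in> A then F (h, c) else 0)"
      using finite_A by simp
    also have "\<dots> = F x"
    proof (cases "c \<in> I")
      case True
      then show ?thesis
        using vanish[of c h] by (simp add: x F_def)
    next
      case False
      then show ?thesis
        using l2_outside[OF F, of x] A by (auto simp: x cells_def)
    qed
    finally show "(\<Sum>q\<in>A. embed q (component F q) x) = F x" .
  qed
  have "(\<Oplus>\<^bsub>vn_algebra G\<^esub>q\<in>A. entry S' i q \<otimes>\<^bsub>vn_algebra G\<^esub> entry T q j) f =
      (\<lambda>h. \<Sum>q\<in>A. entry S' i q (entry T q j f) h)"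
    by (rule vn_matrix_product_apply[OF finite_A _ _ f]) (use A assms(4,5) in \<open>auto intro!: entry_vn_operators S T\<close>)
  also have "\<dots> = (\<lambda>h. \<Sum>q\<in>A. S' (embed q (component F q)) (h, i))"
  proof -
    have "entry S' i q (entry T q j f) h = S' (embed q (component F q)) (h, i)" if "q \<in> A" for q h
    proof -
      have "component F q \<in> l2 (carrier G)"
        using that A F by (intro component_l2) auto
      then show ?thesis
        using f unfolding entry_def F_def by (simp add: component_def[of _ i])
    qed
    then show ?thesis by simp
  qed
  also have "\<dots> = component (S' F) i"
    using S'_sum[OF order_refl] unfolding decompose by (simp add: component_def)
  finally show ?thesis
    by (simp add: F_def)
qed

lemma M_eq_scaled_D: "M f = (\<lambda>x. of_real (sqrt M_bound) * D f x)"
  using M_bound_pos by (simp add: D_def)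

lemma M_E: "f \<in> l2 cells \<Longrightarrow> M (E f) = (\<lambda>x. 0)"
  using D_E[of f] by (simp add: D_eq_0_iff)

lemma E_M:
  assumes "f \<in> l2 cells"
  shows "E (M f) = (\<lambda>x. 0)"
  using E_lincomb[of "D f" "D f" "of_real (sqrt M_bound)" 0] assms
  by (simp add: M_eq_scaled_D D_l2 E_D)

lemma embed_unit_vector: "embed j (unit_vector G) = e j"
  by (auto simp: embed_def unit_vector_def point_mass_def)

lemma unit_vector_l2: "unit_vector G \<in> l2 (carrier G)"
  by (rule l2_finite_support[of "{\<one>}"]) (auto simp: unit_vector_def)

lemma vn_trace_entry: "vn_trace G (entry T j j) = T (e j) (\<one>, j)"
proof -
  have "unit_vector G = point_mass \<one>"
    by (auto simp: unit_vector_def point_mass_def)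
  then have "vn_trace G (entry T j j) = entry T j j (unit_vector G) \<one>"
    using l2_inner_point_mass[of \<one> "carrier G"] by (simp add: vn_trace_def ell2_inner_def l2_inner_def)
  then show ?thesis
    by (simp add: entry_def unit_vector_l2 embed_unit_vector) (simp add: component_def)
qed

end

section \<open>The Cayley complex\<close>

datatype cell = Vertex | is_Edge: Edge nat | Face nat

locale cayley_complex = marked_group G d x
  for G (structure) and d :: nat and x :: "nat \<Rightarrow> 'a" +
  fixes r :: nat and rel :: "nat \<Rightarrow> word"
  assumes rel: "\<And>i. i < r \<Longrightarrow> rel i \<in> carrier (free_group d)"
begin

definition cell_types :: "cell set" where
  "cell_types = insert Vertex (Edge ` {..<d} \<union> Face ` {..<r})"

fun incidence :: "cell \<Rightarrow> cell \<Rightarrow> 'a \<Rightarrow> int" where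
  "incidence (Edge j) Vertex g = edge_boundary G x (\<one>, j) g"
| "incidence (Face i) (Edge j) g = face_boundary G x rel (\<one>, i) (g, j)"
| "incidence _ _ g = 0"

text \<open>The incidence numbers lead from a cell to the cells of its boundary, and give the coboundary
  operator; the second summand adds its adjoint.\<close>

definition coefficient :: "cell \<Rightarrow> cell \<Rightarrow> 'a \<Rightarrow> real" where
  "coefficient p q g = of_int (incidence p q g + incidence q p (inv g))"

definition support :: "'a set" where
  "support = (\<Union>p\<in>cell_types. \<Union>q\<in>cell_types. {g \<in> carrier G. incidence p q g \<noteq> 0})"

text \<open>A finite symmetric set that contains the supports of all entries.\<close>

definition S :: "'a set" where
  "S = support \<union> m_inv G ` support"

lemma cell_types_simps [simp]:
  "Vertex \<in> cell_types" "Edge j \<in> cell_types \<longleftrightarrow> j < d" "Face i \<in> cell_types \<longleftrightarrow> i < r"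
  by (auto simp: cell_types_def)

lemma finite_cell_types: "finite cell_types"
  by (simp add: cell_types_def)

lemma sum_cell_types:
  "(\<Sum>c\<in>cell_types. f c) = f Vertex + (\<Sum>j<d. f (Edge j)) + (\<Sum>i<r. f (Face i))"
proof -
  have "(\<Sum>c\<in>cell_types. f c) = f Vertex + ((\<Sum>c\<in>Edge ` {..<d}. f c) + (\<Sum>c\<in>Face ` {..<r}. f c))"
  proof -
    have "(\<Sum>c\<in>cell_types. f c) = f Vertex + (\<Sum>c\<in>Edge ` {..<d} \<union> Face ` {..<r}. f c)"
      unfolding cell_types_def by (rule sum.insert) auto
    also have "(\<Sum>c\<in>Edge ` {..<d} \<union> Face ` {..<r}. f c) =
        (\<Sum>c\<in>Edge ` {..<d}. f c) + (\<Sum>c\<in>Face ` {..<r}. f c)"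
      by (rule sum.union_disjoint) auto
    finally show ?thesis .
  qed
  then show ?thesis
    by (simp add: sum.reindex inj_on_def add.assoc)
qed

lemma edge_cell_types: "{c \<in> cell_types. is_Edge c} = Edge ` {..<d}"
  by (auto simp: cell_types_def)

lemma even_cell_types: "{c \<in> cell_types. \<not> is_Edge c} = insert Vertex (Face ` {..<r})"
  by (auto simp: cell_types_def)

lemma rel_words [simp]: "i < r \<Longrightarrow> rel i \<in> words"
  using rel free_group_words by blast

lemma incidence_finite:
  assumes "p \<in> cell_types" "q \<in> cell_types"
  shows "finite {g \<in> carrier G. incidence p q g \<noteq> 0}"
  using assms
proof (induction p q \<one> rule: incidence.induct)
  case (1 j)
  have "{g \<in> carrier G. incidence (Edge j) Vertex g \<noteq> 0} \<subseteq> {\<one> \<otimes> x j, \<one>}"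
    by (auto simp: edge_boundary_def split: if_splits)
  then show ?case
    using finite_subset by blast
next
  case (2 i j)
  then have i: "i < r" by simp
  obtain T where T: "finite T" "\<And>e. e \<notin> T \<Longrightarrow> path_chain G x \<one> (rel i) e = 0"
    by (rule path_sum_eq_sum_path_chain[OF one_closed rel_words[OF i]]) (rule that, simp_all)
  have "{g \<in> carrier G. incidence (Face i) (Edge j) g \<noteq> 0} \<subseteq> fst ` T"
  proof
    fix g assume "g \<in> {g \<in> carrier G. incidence (Face i) (Edge j) g \<noteq> 0}"
    then have "(g, j) \<in> T"
      using T(2)[of "(g, j)"] by (auto simp: face_boundary_def)
    then show "g \<in> fst ` T"
      by (rule image_eqI[rotated]) simp
  qed
  then show ?case
    using T(1) finite_subset by blast
qed auto

lemma support_carrier: "g \<in> support \<Longrightarrow> g \<in> carrier G"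
  by (auto simp: support_def)

lemma S_finite: "finite S"
  using finite_cell_types incidence_finite by (auto simp: S_def support_def)

lemma incidence_outside_S:
  assumes "p \<in> cell_types" "q \<in> cell_types" "g \<in> carrier G" "g \<notin> S"
  shows "incidence p q g = 0"
  using assms by (auto simp: S_def support_def)

sublocale odd_group_ring_matrix G cell_types S coefficient is_Edge
proof
  show "finite cell_types" "finite S"
    by (rule finite_cell_types, rule S_finite)
  show "S \<subseteq> carrier G"
    by (auto simp: S_def support_def)
  show "inv g \<in> S" if "g \<in> S" for g
    using that by (auto simp: S_def support_carrier)
  show "coefficient p q (inv g) = coefficient q p g" if "g \<in> S" for p q g
    using that \<open>S \<subseteq> carrier G\<close> by (auto simp: coefficient_def)
  show "coefficient p q g = 0" if "is_Edge p = is_Edge q" for p q g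
    using that by (cases p; cases q) (auto simp: coefficient_def)
qed

lemma M_Face_sum:
  assumes "h \<in> carrier G" "i < r"
  shows "M f (h, Face i) =
    (\<Sum>j<d. \<Sum>g\<in>S. of_int (incidence (Face i) (Edge j) g) * f (h \<otimes> g, Edge j))"
  using assms by (simp add: M_def sum_cell_types coefficient_def)

lemma M_Face:
  assumes h: "h \<in> carrier G" and i: "i < r"
  shows "M f (h, Face i) = path_sum G x (\<lambda>(h', j). f (h', Edge j)) h (rel i)"
proof -
  obtain T where T: "finite T" "T \<subseteq> carrier G \<times> {..<d}"
      "\<And>e. e \<notin> T \<Longrightarrow> path_chain G x \<one> (rel i) e = 0"
      "\<And>y. path_sum G x y \<one> (rel i) = (\<Sum>e\<in>T. of_int (path_chain G x \<one> (rel i) e) * y e :: complex)"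
    by (rule path_sum_eq_sum_path_chain[OF one_closed rel_words[OF i]]) (rule that, simp_all)
  have "path_sum G x (\<lambda>(h', j). f (h', Edge j)) h (rel i) =
      path_sum G x (\<lambda>(h', j). f (h \<otimes> h', Edge j)) \<one> (rel i)"
    using path_sum_translate[of h \<one> "rel i" "\<lambda>(h', j). f (h', Edge j)"] h i by simp
  also have "\<dots> = (\<Sum>(g, j)\<in>T. of_int (path_chain G x \<one> (rel i) (g, j)) * f (h \<otimes> g, Edge j))"
    unfolding T(4) by (intro sum.cong) auto
  also have "\<dots> = (\<Sum>(g, j)\<in>S \<times> {..<d}. of_int (path_chain G x \<one> (rel i) (g, j)) * f (h \<otimes> g, Edge j))"
  proof (rule sum.mono_neutral_cong)
    show "(case e of (g, j) \<Rightarrow> of_int (path_chain G x \<one> (rel i) (g, j)) * f (h \<otimes> g, Edge j)) = 0"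
      if "e \<in> T - S \<times> {..<d}" for e
    proof -
      obtain g j where e: "e = (g, j)"
        by (cases e)
      have "incidence (Face i) (Edge j) g = 0"
        using that T(2) i by (intro incidence_outside_S) (auto simp: e)
      then show ?thesis
        by (simp add: e face_boundary_def)
    qed
  qed (use T(1,3) S_finite in auto)
  also have "\<dots> = (\<Sum>g\<in>S. \<Sum>j<d. of_int (path_chain G x \<one> (rel i) (g, j)) * f (h \<otimes> g, Edge j))"
    by (rule sum.cartesian_product[symmetric])
  also have "\<dots> = M f (h, Face i)"
    unfolding M_Face_sum[OF h i] by (subst sum.swap) (simp add: face_boundary_def)
  finally show ?thesis ..
qed

lemma M_Edge_sum:
  assumes "h \<in> carrier G" "j < d" "\<And>h i. f (h, Face i) = 0"
  shows "M f (h, Edge j) = (\<Sum>g\<in>S. of_int (incidence (Edge j) Vertex g) * f (h \<otimes> g, Vertex))"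
  using assms by (simp add: M_def sum_cell_types coefficient_def)

lemma M_Edge:
  assumes h: "h \<in> carrier G" and j: "j < d" and f: "\<And>h i. f (h, Face i) = 0"
  shows "M f (h, Edge j) = f (h \<otimes> x j, Vertex) - f (h, Vertex)"
proof -
  have "(\<Sum>g\<in>S. of_int (incidence (Edge j) Vertex g) * f (h \<otimes> g, Vertex)) =
      (\<Sum>g\<in>{x j, \<one>}. of_int (incidence (Edge j) Vertex g) * f (h \<otimes> g, Vertex))"
  proof (rule sum.mono_neutral_cong)
    show "of_int (incidence (Edge j) Vertex g) * f (h \<otimes> g, Vertex) = 0" if g: "g \<in> {x j, \<one>} - S" for g
    proof -
      have "incidence (Edge j) Vertex g = 0"
        using g j by (intro incidence_outside_S) auto
      then show ?thesis
        by (simp only: of_int_0 mult_zero_left)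
    qed
    show "of_int (incidence (Edge j) Vertex g) * f (h \<otimes> g, Vertex) = 0" if g: "g \<in> S - {x j, \<one>}" for g
      using g j by (auto simp: edge_boundary_def)
  qed (simp_all add: S_finite)
  also have "\<dots> = f (h \<otimes> x j, Vertex) - f (h, Vertex)"
    using h j by (cases "x j = \<one>") (auto simp: edge_boundary_def)
  finally show ?thesis
    unfolding M_Edge_sum[of h j f, OF h j f] .
qed

lemma group_ring_operator_eq:
  assumes "p \<in> cell_types" "q \<in> cell_types" "f \<in> l2 (carrier G)" "h \<in> carrier G"
  shows "group_ring_operator G (incidence p q) f h = (\<Sum>g\<in>S. of_int (incidence p q g) * f (h \<otimes> g))"
proof -
  have "(\<Sum>g | g \<in> carrier G \<and> incidence p q g \<noteq> 0. of_int (incidence p q g) * f (h \<otimes> g)) =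
      (\<Sum>g\<in>S. of_int (incidence p q g) * f (h \<otimes> g))"
  proof (rule sum.mono_neutral_left[OF S_finite])
    show "{g \<in> carrier G. incidence p q g \<noteq> 0} \<subseteq> S"
      using incidence_outside_S[OF assms(1,2)] by blast
  qed auto
  then show ?thesis
    using assms(3,4) by (simp add: group_ring_operator_def ell2_eq_l2)
qed

lemma group_ring_operator_eq_entry:
  assumes p: "p \<in> cell_types" and q: "q \<in> cell_types"
    and M: "\<And>f h. f \<in> l2 (carrier G) \<Longrightarrow> h \<in> carrier G \<Longrightarrow>
      M (embed q f) (h, p) = (\<Sum>g\<in>S. of_int (incidence p q g) * f (h \<otimes> g))"
  shows "group_ring_operator G (incidence p q) = entry M p q"
proof
  fix f
  show "group_ring_operator G (incidence p q) f = entry M p q f"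
  proof (cases "f \<in> l2 (carrier G)")
    case True
    have "group_ring_operator G (incidence p q) f h = M (embed q f) (h, p)" for h
    proof (cases "h \<in> carrier G")
      case h: True
      show ?thesis
        unfolding group_ring_operator_eq[OF p q True h] M[OF True h] ..
    next
      case False
      then show ?thesis
        using True by (simp add: group_ring_operator_def ell2_eq_l2 M_def)
    qed
    then have "group_ring_operator G (incidence p q) f = (\<lambda>h. M (embed q f) (h, p))"
      by (rule ext)
    then show ?thesis
      using True by (simp add: entry_def component_def)
  next
    case False
    then show ?thesis
      by (simp add: group_ring_operator_def ell2_eq_l2 entry_def)
  qed
qed

lemma boundary_matrix_1_eq_entry:
  assumes "j < d"
  shows "boundary_matrix_1 G x j k = entry M (Edge j) Vertex"
proof -
  have "edge_boundary G x (\<one>, j) = incidence (Edge j) Vertex"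
    by (rule ext) simp
  moreover have "group_ring_operator G (incidence (Edge j) Vertex) = entry M (Edge j) Vertex"
  proof (rule group_ring_operator_eq_entry)
    fix f :: "'a \<Rightarrow> complex" and h assume "h \<in> carrier G"
    then have "M (embed Vertex f) (h, Edge j) =
        (\<Sum>g\<in>S. of_int (incidence (Edge j) Vertex g) * embed Vertex f (h \<otimes> g, Vertex))"
      using assms by (intro M_Edge_sum) (simp_all add: embed_def)
    then show "M (embed Vertex f) (h, Edge j) = (\<Sum>g\<in>S. of_int (incidence (Edge j) Vertex g) * f (h \<otimes> g))"
      unfolding embed_def by simp
  qed (use assms in simp_all)
  ultimately show ?thesis
    by (simp only: boundary_matrix_1_def)
qed

lemma boundary_matrix_2_eq_entry:
  assumes "i < r" "j < d"
  shows "boundary_matrix_2 G x rel i j = entry M (Face i) (Edge j)"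
proof -
  have "(\<lambda>h. face_boundary G x rel (\<one>, i) (h, j)) = incidence (Face i) (Edge j)"
    by (rule ext) simp
  moreover have "group_ring_operator G (incidence (Face i) (Edge j)) = entry M (Face i) (Edge j)"
  proof (rule group_ring_operator_eq_entry)
    fix f :: "'a \<Rightarrow> complex" and h assume h: "h \<in> carrier G"
    have "M (embed (Edge j) f) (h, Face i) =
        (\<Sum>j'<d. \<Sum>g\<in>S. of_int (incidence (Face i) (Edge j') g) * embed (Edge j) f (h \<otimes> g, Edge j'))"
      by (rule M_Face_sum[OF h assms(1)])
    also have "\<dots> = (\<Sum>j'<d. if j' = j then \<Sum>g\<in>S. of_int (incidence (Face i) (Edge j) g) * f (h \<otimes> g) else 0)"
      by (intro sum.cong refl) (simp add: embed_def)
    also have "\<dots> = (\<Sum>g\<in>S. of_int (incidence (Face i) (Edge j) g) * f (h \<otimes> g))"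
      using assms(2) by simp
    finally show "M (embed (Edge j) f) (h, Face i) =
        (\<Sum>g\<in>S. of_int (incidence (Face i) (Edge j) g) * f (h \<otimes> g))" .
  qed (use assms in simp_all)
  ultimately show ?thesis
    by (simp only: boundary_matrix_2_def)
qed

end

section \<open>Kernel vectors on vertices and faces\<close>

locale power_relator_complex = cayley_complex G d x r "\<lambda>i. u i [^]\<^bsub>free_group d\<^esub> m i"
  for G (structure) and d :: nat and x :: "nat \<Rightarrow> 'a" and r :: nat and u :: "nat \<Rightarrow> word" and m :: "nat \<Rightarrow> nat" +
  assumes u: "\<And>i. i < r \<Longrightarrow> u i \<in> carrier (free_group d)"
    and m_pos: "\<And>i. i < r \<Longrightarrow> m i > 0"
    and ord_u: "\<And>i. i < r \<Longrightarrow> ord (word_eval G x (u i)) = m i"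
begin

definition relator_root :: "nat \<Rightarrow> 'a" where
  "relator_root i = word_eval G x (u i)"

definition root_powers :: "nat \<Rightarrow> 'a set" where
  "root_powers i = (\<lambda>k. relator_root i [^] k) ` {..<m i}"

lemma relator_root_closed [simp]: "i < r \<Longrightarrow> relator_root i \<in> carrier G"
  unfolding relator_root_def by (intro word_eval_closed free_group_words u)

lemma root_pow_m: "i < r \<Longrightarrow> relator_root i [^] m i = \<one>"
  by (metis relator_root_closed pow_ord_eq_1 ord_u relator_root_def)

lemma inj_root_powers:
  assumes "i < r"
  shows "inj_on (\<lambda>k. relator_root i [^] k) {..<m i}"
proof -
  have "inj_on (\<lambda>k. relator_root i [^] k) {0..ord (relator_root i) - 1}"
    using assms by (intro ord_inj) simp
  moreover have "{..<m i} \<subseteq> {0..ord (relator_root i) - 1}"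
    using ord_u[OF assms] by (auto simp: relator_root_def)
  ultimately show ?thesis
    by (rule inj_on_subset)
qed

lemma finite_root_powers [simp]: "finite (root_powers i)"
  by (simp add: root_powers_def)

lemma card_root_powers: "i < r \<Longrightarrow> card (root_powers i) = m i"
  unfolding root_powers_def by (simp add: card_image[OF inj_root_powers])

lemma root_powers_carrier: "i < r \<Longrightarrow> root_powers i \<subseteq> carrier G"
  by (auto simp: root_powers_def)

lemma one_root_powers: "i < r \<Longrightarrow> \<one> \<in> root_powers i"
  unfolding root_powers_def using m_pos[of i] by (intro image_eqI[of _ _ 0]) auto

lemma inj_on_root_powers_mult:
  assumes "i < r" "c \<in> root_powers i"
  shows "inj_on (\<lambda>g. c \<otimes> g) (root_powers i)"
proof (rule inj_onI)
  fix g h assume "g \<in> root_powers i" "h \<in> root_powers i" "c \<otimes> g = c \<otimes> h"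
  then show "g = h"
    using root_powers_carrier[OF assms(1)] assms(2) l_cancel[of c g h] by (simp add: subset_iff)
qed

lemma root_powers_mult:
  assumes i: "i < r" and "c \<in> root_powers i"
  shows "(\<lambda>g. c \<otimes> g) ` root_powers i = root_powers i"
proof -
  obtain l :: nat where l: "c = relator_root i [^] l"
    using assms(2) unfolding root_powers_def by (rule imageE)
  have "c \<otimes> relator_root i [^] k \<in> root_powers i" for k :: nat
  proof -
    have "c \<otimes> relator_root i [^] k = relator_root i [^] (l + k)"
      using i by (simp add: l nat_pow_mult)
    also have "\<dots> = relator_root i [^] ((l + k) mod m i)"
    proof -
      define q where "q = (l + k) div m i"
      define t where "t = (l + k) mod m i"
      have "l + k = m i * q + t"
        unfolding q_def t_def by (rule mult_div_mod_eq[symmetric])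
      then have "relator_root i [^] (l + k) = (relator_root i [^] m i) [^] q \<otimes> relator_root i [^] t"
        using i by (simp only: nat_pow_mult nat_pow_pow relator_root_closed)
      also have "\<dots> = relator_root i [^] t"
        using i by (simp add: root_pow_m)
      finally show ?thesis
        by (simp only: t_def)
    qed
    finally show ?thesis
      unfolding root_powers_def by (rule image_eqI) (use m_pos[OF i] in simp)
  qed
  have "(\<lambda>g. c \<otimes> g) ` root_powers i \<subseteq> root_powers i"
  proof (intro image_subsetI)
    fix g assume "g \<in> root_powers i"
    then obtain k :: nat where "g = relator_root i [^] k"
      unfolding root_powers_def by (rule imageE)
    then show "c \<otimes> g \<in> root_powers i"
      using \<open>\<And>k :: nat. c \<otimes> relator_root i [^] k \<in> root_powers i\<close>[of k] by (simp only:)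
  qed
  then show ?thesis
    by (rule endo_inj_surj[OF finite_root_powers _ inj_on_root_powers_mult[OF assms]])
qed

text \<open>The path \<open>u\<^sup>m\<close> runs through \<open>m\<close> copies of the path \<open>u\<close>, one from each power of \<open>u\<close>.\<close>

lemma path_sum_relator:
  assumes i: "i < r" and c: "c \<in> root_powers i"
  shows "path_sum G x y c (u i [^]\<^bsub>free_group d\<^esub> m i) = (\<Sum>g\<in>root_powers i. path_sum G x y g (u i))"
proof -
  have "c \<in> carrier G"
    using root_powers_carrier[OF i] c by blast
  then have "path_sum G x y c (u i [^]\<^bsub>free_group d\<^esub> m i) =
      (\<Sum>k<m i. path_sum G x y (c \<otimes> relator_root i [^] k) (u i))"
    unfolding relator_root_def by (rule path_sum_pow) (rule u[OF i])
  also have "\<dots> = (\<Sum>g\<in>root_powers i. path_sum G x y (c \<otimes> g) (u i))"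
    unfolding root_powers_def sum.reindex[OF inj_root_powers[OF i]] by simp
  also have "\<dots> = (\<Sum>g\<in>(\<lambda>g. c \<otimes> g) ` root_powers i. path_sum G x y g (u i))"
    unfolding sum.reindex[OF inj_on_root_powers_mult[OF i c]] by simp
  also have "\<dots> = (\<Sum>g\<in>root_powers i. path_sum G x y g (u i))"
    by (simp only: root_powers_mult[OF i c])
  finally show ?thesis .
qed

text \<open>The relator \<open>u\<^sup>m\<close> reads the same loop from each of the \<open>m\<close> vertices \<open>u\<^sup>k\<close>, so there are \<open>m\<close> faces
  with the same boundary.  The face vector is the point mass at one of them minus the average of
  the point masses at all of them, which is orthogonal to all coboundaries.\<close>

definition face_vector :: "nat \<Rightarrow> 'a \<times> cell \<Rightarrow> complex" where
  "face_vector i = (\<lambda>(h, c). if c = Face i \<and> h \<in> root_powers i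
     then of_real (of_bool (h = \<one>) - 1 / real (m i)) else 0)"

lemma face_vector_outside: "p \<notin> root_powers i \<times> {Face i} \<Longrightarrow> face_vector i p = 0"
  by (cases p) (auto simp: face_vector_def)

lemma face_vector_support:
  assumes "i < r"
  shows "root_powers i \<times> {Face i} \<subseteq> cells"
  using root_powers_carrier[OF assms] assms by (auto simp: cells_def)

lemma face_vector_l2: "i < r \<Longrightarrow> face_vector i \<in> l2 cells"
  by (rule l2_finite_support[OF _ face_vector_support face_vector_outside]) auto

lemma sum_one_root_powers:
  fixes a :: real
  assumes "i < r"
  shows "(\<Sum>h\<in>root_powers i. of_bool (h = \<one>) * a) = a"
proof -
  have "(\<Sum>h\<in>root_powers i. of_bool (h = \<one>) * a) = (\<Sum>h\<in>root_powers i. if h = \<one> then a else 0)"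
    by (intro sum.cong) auto
  then show ?thesis
    using one_root_powers[OF assms] by simp
qed

lemma sum_face_vector:
  assumes "i < r"
  shows "(\<Sum>h\<in>root_powers i. of_bool (h = \<one>) - 1 / real (m i)) = 0"
proof -
  have "(\<Sum>h\<in>root_powers i. of_bool (h = \<one>)) = (1 :: real)"
    using sum_one_root_powers[OF assms, of 1] by (simp only: mult_1_right)
  moreover have "(\<Sum>h\<in>root_powers i. 1 / real (m i)) = 1"
    using m_pos[OF assms] by (simp add: card_root_powers[OF assms])
  ultimately show ?thesis
    by (simp only: sum_subtractf diff_self)
qed

lemma face_vector_normsq:
  assumes "i < r"
  shows "l2_normsq cells (face_vector i) = 1 - 1 / real (m i)"
proof -
  have "l2_normsq cells (face_vector i) = (\<Sum>p\<in>root_powers i \<times> {Face i}. (cmod (face_vector i p))\<^sup>2)"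
    using assms by (intro l2_normsq_finite_support face_vector_support face_vector_outside) auto
  also have "\<dots> = (\<Sum>h\<in>root_powers i. (of_bool (h = \<one>) - 1 / real (m i))\<^sup>2)"
    by (rule sum.reindex_bij_witness[of _ "\<lambda>h. (h, Face i)" fst])
      (auto simp: face_vector_def norm_divide simp del: of_real_diff)
  also have "\<dots> = (\<Sum>h\<in>root_powers i. of_bool (h = \<one>) * (1 - 1 / real (m i)) -
      (of_bool (h = \<one>) - 1 / real (m i)) * (1 / real (m i)))"
    by (intro sum.cong refl) (simp add: power2_eq_square algebra_simps)
  also have "\<dots> = (\<Sum>h\<in>root_powers i. of_bool (h = \<one>) * (1 - 1 / real (m i)))"
  proof -
    have "(\<Sum>h\<in>root_powers i. (of_bool (h = \<one>) - 1 / real (m i)) * (1 / real (m i))) = 0"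
      unfolding sum_distrib_right[symmetric] sum_face_vector[OF assms] by simp
    then show ?thesis
      by (subst sum_subtractf) (simp only: diff_zero)
  qed
  also have "\<dots> = 1 - 1 / real (m i)"
    by (rule sum_one_root_powers[OF assms])
  finally show ?thesis .
qed

text \<open>Reading \<open>u\<^sup>m\<close> from the vertices \<open>u\<^sup>k\<close> gives always the same sum, so every coboundary
  takes a constant value on the faces \<open>(u\<^sup>k, i)\<close>; the face vector has sum zero over them.\<close>

lemma M_face_vector:
  assumes i: "i < r"
  shows "M (face_vector i) = (\<lambda>p. 0)"
proof
  fix p :: "'a \<times> cell"
  show "M (face_vector i) p = 0"
  proof (cases "p \<in> cells")
    case True
    define y where "y = (\<lambda>(h, j). point_mass p (h, Edge j))"
    define s where "s = (\<Sum>g\<in>root_powers i. path_sum G x y g (u i))"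
    have face_value: "M (point_mass p) (h, Face i) = s" if h: "h \<in> root_powers i" for h
      using M_Face[of h i "point_mass p"] root_powers_carrier[OF i] h i path_sum_relator[OF i h, of y]
      by (auto simp: s_def y_def)
    have "M (face_vector i) p = l2_inner cells (M (face_vector i)) (point_mass p)"
      using True by (simp add: l2_inner_point_mass)
    also have "\<dots> = l2_inner cells (face_vector i) (M (point_mass p))"
      using True i by (intro M_adjoint face_vector_l2) auto
    also have "\<dots> = (\<Sum>\<^sub>\<infinity>q\<in>root_powers i \<times> {Face i}. face_vector i q * cnj (M (point_mass p) q))"
      unfolding l2_inner_def using face_vector_support[OF i]
      by (intro infsum_cong_neutral) (auto simp: face_vector_outside)
    also have "\<dots> = (\<Sum>q\<in>root_powers i \<times> {Face i}. face_vector i q * cnj (M (point_mass p) q))"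
      by simp
    also have "\<dots> = (\<Sum>h\<in>root_powers i. of_real (of_bool (h = \<one>) - 1 / real (m i)) * cnj s)"
      by (rule sum.reindex_bij_witness[of _ "\<lambda>h. (h, Face i)" fst]) (auto simp: face_vector_def face_value)
    also have "\<dots> = of_real (\<Sum>h\<in>root_powers i. of_bool (h = \<one>) - 1 / real (m i)) * cnj s"
      by (simp only: of_real_sum sum_distrib_right)
    finally show ?thesis
      by (simp only: sum_face_vector[OF i] of_real_0 mult_zero_left)
  next
    case False
    then show ?thesis
      by (cases p) (auto simp: M_def cells_def)
  qed
qed

lemma face_lower_bound:
  assumes "i < r"
  shows "1 - 1 / real (m i) \<le> Re ((R ^^ (2 * n)) (e (Face i)) (\<one>, Face i))"
proof -
  have "2 * Re (face_vector i (\<one>, Face i)) - l2_normsq cells (face_vector i) \<le>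
      Re ((R ^^ (2 * n)) (e (Face i)) (\<one>, Face i))"
    using assms M_face_vector[OF assms]
    by (intro diagonal_entry_lower_bound face_vector_l2) (auto simp: cells_def D_eq_0_iff)
  moreover have "Re (face_vector i (\<one>, Face i)) = 1 - 1 / real (m i)"
    using one_root_powers[OF assms] by (simp add: face_vector_def)
  ultimately show ?thesis
    by (simp add: face_vector_normsq[OF assms])
qed

lemma vertex_lower_bound: "0 \<le> Re ((R ^^ (2 * n)) (e Vertex) (\<one>, Vertex))"
  using diagonal_entry_lower_bound[of "(\<one>, Vertex)" "\<lambda>p. 0" n]
  by (simp add: cells_def D_zero l2_normsq_def)

text \<open>On a finite complex the constant function \<open>1 / |G|\<close> on the vertices lies in the kernel.\<close>

lemma vertex_lower_bound_finite:
  assumes "finite (carrier G)"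
  shows "1 / real (Coset.order G) \<le> Re ((R ^^ (2 * n)) (e Vertex) (\<one>, Vertex))"
proof -
  define c where "c = 1 / real (Coset.order G)"
  define w :: "'a \<times> cell \<Rightarrow> complex" where
    "w = (\<lambda>(h, q). if q = Vertex \<and> h \<in> carrier G then of_real c else 0)"
  have order: "Coset.order G > 0"
    using assms by (simp add: order_gt_0_iff_finite)
  have support: "carrier G \<times> {Vertex} \<subseteq> cells"
    by (auto simp: cells_def)
  have outside: "w p = 0" if "p \<notin> carrier G \<times> {Vertex}" for p
    using that by (cases p) (auto simp: w_def)
  have "w \<in> l2 cells"
    using assms by (intro l2_finite_support[OF _ support outside]) auto
  moreover have "M w = (\<lambda>p. 0)"
  proof
    fix p :: "'a \<times> cell"
    obtain h q where p: "p = (h, q)"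
      by (cases p)
    have "supported False w"
      by (auto simp: supported_def w_def)
    then have "supported True (M w)"
      using M_supported by fastforce
    moreover have "M w (h, Edge j) = 0" if "h \<in> carrier G" "j < d" for j
      using that by (subst M_Edge) (auto simp: w_def)
    moreover have "M w (h, q) = 0" if "h \<notin> carrier G \<or> q \<notin> cell_types"
      using that by (auto simp: M_def)
    ultimately show "M w p = 0"
      by (cases q) (force simp: p supported_def)+
  qed
  ultimately have "2 * Re (w (\<one>, Vertex)) - l2_normsq cells w \<le> Re ((R ^^ (2 * n)) (e Vertex) (\<one>, Vertex))"
    by (intro diagonal_entry_lower_bound) (auto simp: cells_def D_eq_0_iff)
  moreover have "l2_normsq cells w = (\<Sum>p\<in>carrier G \<times> {Vertex}. (cmod (w p))\<^sup>2)"
    using assms by (intro l2_normsq_finite_support support outside) auto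
  moreover have "(\<Sum>p\<in>carrier G \<times> {Vertex}. (cmod (w p))\<^sup>2) = (\<Sum>h\<in>carrier G. c\<^sup>2)"
    by (rule sum.reindex_bij_witness[of _ "\<lambda>h. (h, Vertex)" fst]) (auto simp: w_def)
  moreover have "(\<Sum>h\<in>carrier G. c\<^sup>2) = c"
    using order by (simp add: c_def Coset.order_def power2_eq_square)
  moreover have "Re (w (\<one>, Vertex)) = c"
    by (simp add: w_def)
  ultimately show ?thesis
    by (simp add: c_def)
qed

text \<open>Each face contributes at least \<open>1 - 1 / m i\<close> and the vertex at least \<open>b\<close>, so the Euler
  characteristic \<open>d - (1 + r)\<close> of the odd minus the even cells becomes the left-hand side.\<close>

lemma harmonic_edge_trace_lower_bound:
  assumes "\<And>n. b \<le> Re ((R ^^ (2 * n)) (e Vertex) (\<one>, Vertex))"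
  shows "real d - 1 + b - (\<Sum>i<r. 1 / real (m i)) \<le> Re (\<Sum>j<d. E (e (Edge j)) (\<one>, Edge j))"
proof -
  define b' where "b' c = (case c of Face i \<Rightarrow> 1 - 1 / real (m i) | _ \<Rightarrow> b)" for c
  have "real (card {c \<in> cell_types. is_Edge c}) - (\<Sum>c\<in>{c \<in> cell_types. \<not> is_Edge c}. 1 - b' c) \<le>
      Re (\<Sum>c\<in>{c \<in> cell_types. is_Edge c}. E (e c) (\<one>, c))"
  proof (rule harmonic_trace_lower_bound)
    fix c n assume "c \<in> cell_types" "\<not> is_Edge c"
    then show "b' c \<le> Re ((R ^^ (2 * n)) (e c) (\<one>, c))"
      using assms face_lower_bound by (cases c) (auto simp: b'_def)
  qed
  moreover have "(\<Sum>c\<in>{c \<in> cell_types. \<not> is_Edge c}. 1 - b' c) = 1 - b + (\<Sum>i<r. 1 / real (m i))"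
  proof -
    have "(\<Sum>c\<in>insert Vertex (Face ` {..<r}). 1 - b' c) = (1 - b' Vertex) + (\<Sum>c\<in>Face ` {..<r}. 1 - b' c)"
      by (rule sum.insert) auto
    also have "(\<Sum>c\<in>Face ` {..<r}. 1 - b' c) = (\<Sum>i<r. 1 - b' (Face i))"
      by (subst sum.reindex) (auto simp: inj_on_def)
    finally show ?thesis
      unfolding even_cell_types by (simp add: b'_def)
  qed
  moreover have "card {c \<in> cell_types. is_Edge c} = d"
    unfolding edge_cell_types by (subst card_image) (auto simp: inj_on_def)
  moreover have "(\<Sum>c\<in>{c \<in> cell_types. is_Edge c}. E (e c) (\<one>, c)) = (\<Sum>j<d. E (e (Edge j)) (\<one>, Edge j))"
    unfolding edge_cell_types by (subst sum.reindex) (auto simp: inj_on_def)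
  ultimately show ?thesis
    by simp
qed


section \<open>Vanishing first homology\<close>

lemma E_edge_supported:
  assumes "f \<in> l2 (carrier G)" "j < d"
  shows "supported True (E (embed (Edge j) f))"
proof (rule E_supported)
  show "supported True (embed (Edge j) f)"
    by (auto simp: supported_def embed_def)
  show "embed (Edge j) f \<in> l2 cells"
    using assms by (intro embed_l2) auto
qed

lemma edge_matrix_product:
  assumes S': "invariant_operator S'" and T: "invariant_operator T"
    and pc: "p \<in> cell_types" "c \<in> cell_types"
    and edges: "\<And>f. f \<in> l2 (carrier G) \<Longrightarrow> supported True (T (embed c f))"
  shows "(\<Oplus>\<^bsub>vn_algebra G\<^esub>l\<in>{..<d}. entry S' p (Edge l) \<otimes>\<^bsub>vn_algebra G\<^esub> entry T (Edge l) c) =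
    (\<lambda>f\<in>l2 (carrier G). component (S' (T (embed c f))) p)"
proof -
  interpret N: ring "vn_algebra G" by (rule ring_vn_algebra)
  have product: "entry S' p q \<otimes>\<^bsub>vn_algebra G\<^esub> entry T q c \<in> carrier (vn_algebra G)"
    if "q \<in> cell_types" for q
    using that pc S' T by (intro N.m_closed) (simp_all add: vn_algebra_simps entry_vn_operators)
  have "(\<Oplus>\<^bsub>vn_algebra G\<^esub>l\<in>{..<d}. entry S' p (Edge l) \<otimes>\<^bsub>vn_algebra G\<^esub> entry T (Edge l) c) =
      (\<Oplus>\<^bsub>vn_algebra G\<^esub>q\<in>Edge ` {..<d}. entry S' p q \<otimes>\<^bsub>vn_algebra G\<^esub> entry T q c)" (is "_ = ?sum")
    using product by (intro N.add.finprod_reindex[symmetric]) (auto simp: inj_on_def)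
  also have "?sum = (\<lambda>f\<in>l2 (carrier G). component (S' (T (embed c f))) p)"
  proof (rule extensionalityI[of _ "l2 (carrier G)"])
    have "?sum \<in> carrier (vn_algebra G)"
      using product by (intro N.finsum_closed) auto
    then show "?sum \<in> extensional (l2 (carrier G))"
      by (simp add: vn_algebra_simps vn_operators_extensional)
    fix f :: "'a \<Rightarrow> complex" assume f: "f \<in> l2 (carrier G)"
    have "?sum f = component (S' (T (embed c f))) p"
    proof (rule entry_compose[OF S' T _ pc f])
      show "Edge ` {..<d} \<subseteq> cell_types"
        by auto
      show "T (embed c f) (h, q) = 0" if "q \<in> cell_types" "q \<notin> Edge ` {..<d}" for h q
        using edges[OF f] that by (cases q) (auto simp: supported_def)
    qed
    then show "?sum f = (\<lambda>f\<in>l2 (carrier G). component (S' (T (embed c f))) p) f"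
      using f by simp
  qed simp
  finally show ?thesis .
qed

abbreviation harmonic_matrix :: "nat \<Rightarrow> nat \<Rightarrow> 'a operator" where
  "harmonic_matrix i j \<equiv> entry E (Edge i) (Edge j)"

lemma harmonic_matrix_idempotent: "idempotent_matrix (vn_algebra G) d harmonic_matrix"
  unfolding idempotent_matrix_def
proof (intro conjI allI impI)
  fix i j assume ij: "i < d" "j < d"
  then show "harmonic_matrix i j \<in> carrier (vn_algebra G)"
    by (simp add: vn_algebra_simps entry_vn_operators invariant_operator_E)
  have "(\<Oplus>\<^bsub>vn_algebra G\<^esub>l\<in>{..<d}. harmonic_matrix i l \<otimes>\<^bsub>vn_algebra G\<^esub> harmonic_matrix l j) =
      (\<lambda>f\<in>l2 (carrier G). component (E (E (embed (Edge j) f))) (Edge i))"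
    using ij by (intro edge_matrix_product invariant_operator_E E_edge_supported) auto
  also have "\<dots> = harmonic_matrix i j"
    unfolding entry_def using ij by (intro restrict_ext) (simp add: E_E embed_l2)
  finally show "(\<Oplus>\<^bsub>vn_algebra G\<^esub>l\<in>{..<d}. harmonic_matrix i l \<otimes>\<^bsub>vn_algebra G\<^esub> harmonic_matrix l j) =
      harmonic_matrix i j" .
qed

text \<open>The harmonic projection kills the coboundaries of functions on the vertices, and harmonic
  functions have coboundary zero on the faces.\<close>

lemma harmonic_matrix_boundary_1:
  assumes "i < d"
  shows "(\<Oplus>\<^bsub>vn_algebra G\<^esub>l\<in>{..<d}. harmonic_matrix i l \<otimes>\<^bsub>vn_algebra G\<^esub> entry M (Edge l) Vertex) =
    \<zero>\<^bsub>vn_algebra G\<^esub>"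
proof -
  have "supported True (M (embed Vertex f))" for f
    using M_supported[of False "embed Vertex f"] by (auto simp: supported_def embed_def)
  then have "(\<Oplus>\<^bsub>vn_algebra G\<^esub>l\<in>{..<d}. harmonic_matrix i l \<otimes>\<^bsub>vn_algebra G\<^esub> entry M (Edge l) Vertex) =
      (\<lambda>f\<in>l2 (carrier G). component (E (M (embed Vertex f))) (Edge i))"
    using assms by (intro edge_matrix_product invariant_operator_E invariant_operator_M) auto
  also have "\<dots> = \<zero>\<^bsub>vn_algebra G\<^esub>"
    unfolding vn_algebra_simps by (intro restrict_ext) (simp add: E_M embed_l2 component_def)
  finally show ?thesis .
qed

lemma boundary_2_harmonic_matrix:
  assumes "i < r" "j < d"
  shows "(\<Oplus>\<^bsub>vn_algebra G\<^esub>l\<in>{..<d}. entry M (Face i) (Edge l) \<otimes>\<^bsub>vn_algebra G\<^esub> harmonic_matrix l j) =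
    \<zero>\<^bsub>vn_algebra G\<^esub>"
proof -
  have "(\<Oplus>\<^bsub>vn_algebra G\<^esub>l\<in>{..<d}. entry M (Face i) (Edge l) \<otimes>\<^bsub>vn_algebra G\<^esub> harmonic_matrix l j) =
      (\<lambda>f\<in>l2 (carrier G). component (M (E (embed (Edge j) f))) (Face i))"
    using assms by (intro edge_matrix_product invariant_operator_E invariant_operator_M E_edge_supported) auto
  also have "\<dots> = \<zero>\<^bsub>vn_algebra G\<^esub>"
    unfolding vn_algebra_simps using assms by (intro restrict_ext) (simp add: M_E embed_l2 component_def)
  finally show ?thesis .
qed

text \<open>The image of the harmonic matrix embeds in the first homology as a finitely generated projective
  submodule, and its dimension is the trace of the matrix.\<close>

lemma harmonic_trace_le_first_l2_betti:
  "ereal (Re (\<Sum>j<d. E (e (Edge j)) (\<one>, Edge j))) \<le> first_l2_betti G d x r (\<lambda>i. u i [^]\<^bsub>free_group d\<^esub> m i)"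
proof -
  interpret N: ring "vn_algebra G" by (rule ring_vn_algebra)
  let ?rel = "\<lambda>i. u i [^]\<^bsub>free_group d\<^esub> m i"
  note bm1 = boundary_matrix_1_eq_entry and bm2 = boundary_matrix_2_eq_entry
  have M_vn: "entry M p q \<in> carrier (vn_algebra G)" if "p \<in> cell_types" "q \<in> cell_types" for p q
    using that by (simp add: vn_algebra_simps entry_vn_operators invariant_operator_M)
  have E_vn: "entry E p q \<in> carrier (vn_algebra G)" if "p \<in> cell_types" "q \<in> cell_types" for p q
    using that by (simp add: vn_algebra_simps entry_vn_operators invariant_operator_E)
  have "\<exists>P. submodule P (vn_algebra G) (homology_1 G d x r ?rel) \<and>
      module_isomorphic (vn_algebra G) ((homology_1 G d x r ?rel)\<lparr>carrier := P\<rparr>)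
        (matrix_image (vn_algebra G) d harmonic_matrix)"
    unfolding homology_1_def cycles_1_def boundaries_1_def
  proof (rule N.idempotent_image_embeds_in_homology[OF _ _ harmonic_matrix_idempotent])
    show "N.matrix_over d 1 (boundary_matrix_1 G x)"
      by (simp add: N.matrix_over_def bm1 M_vn)
    show "N.matrix_over r d (boundary_matrix_2 G x ?rel)"
      by (simp add: N.matrix_over_def bm2 M_vn)
    fix i j assume "i < d" "j < (1::nat)"
    have "(\<Oplus>\<^bsub>vn_algebra G\<^esub>q\<in>{..<d}. harmonic_matrix i q \<otimes>\<^bsub>vn_algebra G\<^esub> boundary_matrix_1 G x q j) =
        (\<Oplus>\<^bsub>vn_algebra G\<^esub>q\<in>{..<d}. harmonic_matrix i q \<otimes>\<^bsub>vn_algebra G\<^esub> entry M (Edge q) Vertex)"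
      using \<open>i < d\<close> by (intro N.finsum_cong') (auto simp: bm1 M_vn E_vn)
    then show "(\<Oplus>\<^bsub>vn_algebra G\<^esub>q\<in>{..<d}. harmonic_matrix i q \<otimes>\<^bsub>vn_algebra G\<^esub> boundary_matrix_1 G x q j) =
        \<zero>\<^bsub>vn_algebra G\<^esub>"
      using harmonic_matrix_boundary_1[OF \<open>i < d\<close>] by simp
  next
    fix i j assume ij: "i < r" "j < d"
    have "(\<Oplus>\<^bsub>vn_algebra G\<^esub>q\<in>{..<d}. boundary_matrix_2 G x ?rel i q \<otimes>\<^bsub>vn_algebra G\<^esub> harmonic_matrix q j) =
        (\<Oplus>\<^bsub>vn_algebra G\<^esub>q\<in>{..<d}. entry M (Face i) (Edge q) \<otimes>\<^bsub>vn_algebra G\<^esub> harmonic_matrix q j)"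
      using ij by (intro N.finsum_cong') (auto simp: bm2 M_vn E_vn)
    then show "(\<Oplus>\<^bsub>vn_algebra G\<^esub>q\<in>{..<d}. boundary_matrix_2 G x ?rel i q \<otimes>\<^bsub>vn_algebra G\<^esub> harmonic_matrix q j) =
        \<zero>\<^bsub>vn_algebra G\<^esub>"
      using boundary_2_harmonic_matrix[OF ij] by simp
  qed
  then obtain P where P: "submodule P (vn_algebra G) (homology_1 G d x r ?rel)"
    "module_isomorphic (vn_algebra G) ((homology_1 G d x r ?rel)\<lparr>carrier := P\<rparr>)
        (matrix_image (vn_algebra G) d harmonic_matrix)"
    by blast
  have "fg_projective_of_dim G ((homology_1 G d x r ?rel)\<lparr>carrier := P\<rparr>)
      (Re (\<Sum>j<d. vn_trace G (harmonic_matrix j j)))"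
    unfolding fg_projective_of_dim_def using harmonic_matrix_idempotent P(2) by blast
  then have "ereal (Re (\<Sum>j<d. vn_trace G (harmonic_matrix j j))) \<le> vn_dim G (homology_1 G d x r ?rel)"
    unfolding vn_dim_def using P(1) by (intro Sup_upper) blast
  then show ?thesis
    unfolding vn_trace_entry first_l2_betti_def .
qed

text \<open>On a finite Cayley complex a harmonic function on the edges sums to zero along the relators, so
  it is the coboundary \<open>M \<phi>\<close> of a function on the vertices, and
  \<open>\<langle>y, y\<rangle> = \<langle>M \<phi>, y\<rangle> = \<langle>\<phi>, M y\<rangle> = 0\<close>.\<close>

lemma finite_harmonic_edge_function_zero:
  assumes pres: "presented_by G d x r (\<lambda>i. u i [^]\<^bsub>free_group d\<^esub> m i)"
    and fin: "finite (carrier G)"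
    and y: "y \<in> l2 cells" "supported True y" "M y = (\<lambda>p. 0)"
  shows "y = (\<lambda>p. 0)"
proof -
  define Y where "Y = (\<lambda>(h, j). y (h, Edge j))"
  \<comment> \<open>The potential of a vertex is the sum along any path from the base vertex.\<close>
  define \<phi> where "\<phi> h = path_sum G x Y \<one> (SOME w. w \<in> carrier F \<and> word_eval G x w = h)" for h
  have closed: "path_sum G x Y h (u i [^]\<^bsub>F\<^esub> m i) = 0" if "h \<in> carrier G" "i < r" for h i
    using M_Face[OF that, of y] y(3) by (simp add: Y_def)
  have \<phi>: "\<phi> (word_eval G x w) = path_sum G x Y \<one> w" if w: "w \<in> carrier F" for w
  proof -
    define v where "v = (SOME v. v \<in> carrier F \<and> word_eval G x v = word_eval G x w)"
    have v: "v \<in> carrier F \<and> word_eval G x v = word_eval G x w"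
      unfolding v_def by (rule someI[of _ w]) (simp add: w)
    have "path_sum G x Y \<one> v = path_sum G x Y \<one> w"
      by (rule path_sum_eq_of_word_eval_eq[OF pres closed]) (use v w in auto)
    then show ?thesis
      by (simp add: \<phi>_def v_def)
  qed
  have coboundary: "\<phi> (h \<otimes> x j) - \<phi> h = y (h, Edge j)" if h: "h \<in> carrier G" and j: "j < d" for h j
  proof -
    have "h \<in> word_eval G x ` carrier F"
      using pres h by (simp add: presented_by_def)
    then obtain w where w: "w \<in> carrier F" "word_eval G x w = h"
      by (metis imageE)
    have letter: "[(j, True)] \<in> carrier F"
      using j by (simp add: free_group_def)
    interpret F: group F by (rule group_free_group)
    have "h \<otimes> x j = word_eval G x (w \<otimes>\<^bsub>F\<^esub> [(j, True)])"
      using w letter j by (simp add: word_eval_mult letter_eval_def)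
    then have "\<phi> (h \<otimes> x j) = path_sum G x Y \<one> (w \<otimes>\<^bsub>F\<^esub> [(j, True)])"
      using w letter by (simp add: \<phi>)
    also have "\<dots> = path_sum G x Y \<one> w + path_sum G x Y h [(j, True)]"
      using w letter h by (simp add: path_sum_mult)
    finally show ?thesis
      using w \<phi>[OF w(1)] by (simp add: Y_def)
  qed
  define f where "f = (\<lambda>(h, c). if c = Vertex \<and> h \<in> carrier G then \<phi> h else 0)"
  have f_l2: "f \<in> l2 cells"
  proof (rule l2_finite_support)
    show "finite (carrier G \<times> {Vertex})"
      using fin by simp
  qed (auto simp: cells_def f_def split: if_splits)
  have "M f = y"
  proof
    fix p :: "'a \<times> cell"
    obtain h c where p: "p = (h, c)"
      by (cases p)
    have "supported True (M f)"
      using M_supported[of False f] by (auto simp: supported_def f_def)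
    then have not_edge: "M f (h, c) = 0" "y (h, c) = 0" if "\<not> is_Edge c"
      using that y(2) by (auto simp: supported_def)
    have outside: "M f (h, c) = 0" "y (h, c) = 0" if "h \<notin> carrier G \<or> c \<notin> cell_types"
      using that l2_outside[OF y(1), of "(h, c)"] by (auto simp: M_def cells_def)
    have edge: "M f (h, Edge j) = y (h, Edge j)" if "h \<in> carrier G" "j < d" for j
    proof -
      have "M f (h, Edge j) = f (h \<otimes> x j, Vertex) - f (h, Vertex)"
        using that by (intro M_Edge) (auto simp: f_def)
      then show ?thesis
        using that coboundary by (simp add: f_def)
    qed
    show "M f p = y p"
    proof (cases "is_Edge c \<and> h \<in> carrier G \<and> c \<in> cell_types")
      case True
      then show ?thesis
        using edge by (cases c) (auto simp: p)
    next
      case False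
      then show ?thesis
        using not_edge outside unfolding p by metis
    qed
  qed
  then have "l2_inner cells y y = l2_inner cells f (M y)"
    using M_adjoint[OF f_l2 y(1)] by simp
  also have "\<dots> = 0"
    unfolding y(3) by (simp add: l2_inner_def)
  finally have "l2_normsq cells y = 0"
    using l2_inner_self[OF y(1)] by simp
  then show ?thesis
    using l2_normsq_eq_0D[OF y(1)] by simp
qed

lemma finite_harmonic_projection_zero:
  assumes "presented_by G d x r (\<lambda>i. u i [^]\<^bsub>free_group d\<^esub> m i)" "finite (carrier G)" "j < d"
  shows "E (e (Edge j)) = (\<lambda>p. 0)"
proof (rule finite_harmonic_edge_function_zero[OF assms(1,2)])
  have ej: "e (Edge j) \<in> l2 cells"
    using assms(3) by simp
  show "E (e (Edge j)) \<in> l2 cells"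
    by (rule E_l2[OF ej])
  show "M (E (e (Edge j))) = (\<lambda>p. 0)"
    by (rule M_E[OF ej])
  show "supported True (E (e (Edge j)))"
    using E_supported[OF e_supported[of "Edge j"] ej] by simp
qed

end

theorem theorem1:
  fixes G :: "('g, 'a) monoid_scheme"
    and d r :: nat
    and x :: "nat \<Rightarrow> 'g"
    and u :: "nat \<Rightarrow> word"
    and m :: "nat \<Rightarrow> nat"
  assumes u: "\<And>i. i < r \<Longrightarrow> u i \<in> carrier (free_group d)"
    and m: "\<And>i. i < r \<Longrightarrow> m i > 0"
    and presentation: "presented_by G d x r (\<lambda>i. u i [^]\<^bsub>free_group d\<^esub> m i)"
    and ord: "\<And>i. i < r \<Longrightarrow> group.ord G (word_eval G x (u i)) = m i"
  shows "(finite (carrier G) \<longrightarrow>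
            1 - real d + (\<Sum>i<r. 1 / real (m i)) > 0 \<and>
            real (Coset.order G) \<ge> 1 / (1 - real d + (\<Sum>i<r. 1 / real (m i)))) \<and>
         (first_l2_betti G d x r (\<lambda>i. u i [^]\<^bsub>free_group d\<^esub> m i) = 0 \<longrightarrow>
            1 - real d + (\<Sum>i<r. 1 / real (m i)) \<ge> 0)"
proof -
  interpret G: group G
    using presentation by (simp add: presented_by_def)
  interpret F: group "free_group d"
    by (rule group_free_group)
  interpret power_relator_complex G d x r u m
  proof
    show "x \<in> {..<d} \<rightarrow> carrier G"
      using presentation by (simp add: presented_by_def)
    show "u i [^]\<^bsub>free_group d\<^esub> m i \<in> carrier (free_group d)" if "i < r" for i
      using u[OF that] by simp
  qed (use u m ord in auto)
  define \<epsilon> where "\<epsilon> = 1 - real d + (\<Sum>i<r. 1 / real (m i))"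
  have "\<epsilon> > 0 \<and> real (Coset.order G) \<ge> 1 / \<epsilon>" if fin: "finite (carrier G)"
  proof -
    have order: "real (Coset.order G) > 0"
      using fin by (simp add: G.order_gt_0_iff_finite)
    have "Re (\<Sum>j<d. E (e (Edge j)) (\<one>\<^bsub>G\<^esub>, Edge j)) = 0"
      using finite_harmonic_projection_zero[OF presentation fin] by simp
    then have bound: "1 / real (Coset.order G) \<le> \<epsilon>"
      using harmonic_edge_trace_lower_bound[OF vertex_lower_bound_finite[OF fin]] by (simp add: \<epsilon>_def)
    moreover have "0 < 1 / real (Coset.order G)"
      using order by simp
    ultimately have "\<epsilon> > 0"
      by linarith
    then show ?thesis
      using bound order by (simp add: field_simps)
  qed
  moreover have "\<epsilon> \<ge> 0" if betti: "first_l2_betti G d x r (\<lambda>i. u i [^]\<^bsub>free_group d\<^esub> m i) = 0"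
  proof -
    have "Re (\<Sum>j<d. E (e (Edge j)) (\<one>\<^bsub>G\<^esub>, Edge j)) \<le> 0"
      using harmonic_trace_le_first_l2_betti unfolding betti by (simp del: Re_sum)
    then show ?thesis
      using harmonic_edge_trace_lower_bound[OF vertex_lower_bound] by (simp add: \<epsilon>_def)
  qed
  ultimately show ?thesis
    unfolding \<epsilon>_def by blast
qed

end
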